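(* Let $\mathcal A$ be a unital operator algebra with C$^*$-cover $\mathfrak A$ such that $\mathcal A$ is Dirichlet in $\mathfrak A$. Let $\pi:\mathfrak A\to\mathcal B(H)$ be an irreducible representation of $\mathfrak A$. If the weak closure of $\pi(\mathcal A)$ contains a masa (of $\mathcal B(H)$), then the lattice $\mathrm{Lat}(\pi(\mathcal A))$ is a nest, and $\pi(\mathcal A)$ is weakly dense in a nest algebra.
   Context: A C$^*$-cover of an operator algebra $\mathcal A$ is a C$^*$-algebra $\mathfrak A$ together with a completely isometric (homomorphic) embedding $j:\mathcal A\to\mathfrak A$; one writes $\mathcal A\subset\mathfrak A$. $\mathcal A$ is Dirichlet in $\mathfrak A$ if $\mathcal A+\mathcal A^*$ is norm-dense in $\mathfrak A$. Weak closure and weak density refer to the weak operator topology on $\mathcal B(H)$. A masa in $\mathcal B(H)$ is a maximal abelian self-adjoint subalgebra. $\mathrm{Lat}(\pi(\mathcal A))$ is the lattice of orthogonal projections whose ranges are invariant under $\pi(\mathcal A)$; it is a nest if it is totally ordered. A nest algebra is the algebra of all operators in $\mathcal B(H)$ leaving invariant every element of a given nest. *)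

theory Defs
  imports "HOL-Analysis.Analysis"
begin

class complex_normed_vector = real_normed_vector +
  fixes scaleC :: "complex \<Rightarrow> 'a \<Rightarrow> 'a" (infixr "*\<^sub>C" 75)
  assumes scaleC_add_right: "a *\<^sub>C (x + y) = a *\<^sub>C x + a *\<^sub>C y"
    and scaleC_add_left: "(a + b) *\<^sub>C x = a *\<^sub>C x + b *\<^sub>C x"
    and scaleC_scaleC: "a *\<^sub>C b *\<^sub>C x = (a * b) *\<^sub>C x"
    and scaleC_of_real: "complex_of_real r *\<^sub>C x = r *\<^sub>R x"
    and norm_scaleC: "norm (a *\<^sub>C x) = cmod a * norm x"

text \<open>The inner product is linear in the first argument.  The last axiom says at once that
  \<open>cinner x x\<close> is real, nonnegative, definite, and that it induces the norm.\<close>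

class complex_inner = complex_normed_vector +
  fixes cinner :: "'a \<Rightarrow> 'a \<Rightarrow> complex"
  assumes cinner_commute: "cinner x y = cnj (cinner y x)"
    and cinner_add_left: "cinner (x + y) z = cinner x z + cinner y z"
    and cinner_scaleC_left: "cinner (a *\<^sub>C x) y = a * cinner x y"
    and cinner_self: "cinner x x = complex_of_real ((norm x)\<^sup>2)"

class complex_hilbert = complex_inner + banach

text \<open>A C*-algebra need not have a unit.\<close>

class cstar_algebra = complex_normed_vector + real_normed_algebra + banach +
  fixes star :: "'a \<Rightarrow> 'a"
  assumes mult_scaleC_left: "(a *\<^sub>C x) * y = a *\<^sub>C (x * y)"
    and mult_scaleC_right: "x * (a *\<^sub>C y) = a *\<^sub>C (x * y)"
    and star_star: "star (star x) = x"
    and star_add: "star (x + y) = star x + star y"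
    and star_scaleC: "star (a *\<^sub>C x) = cnj a *\<^sub>C star x"
    and star_mult: "star (x * y) = star y * star x"
    and cstar_identity: "norm (star x * x) = (norm x)\<^sup>2"

definition bounded_ops :: "('h::complex_normed_vector \<Rightarrow> 'h) set" where
  "bounded_ops = {T. bounded_linear T \<and> (\<forall>c x. T (c *\<^sub>C x) = c *\<^sub>C T x)}"

definition cadjoint :: "('h::complex_inner \<Rightarrow> 'h) \<Rightarrow> ('h \<Rightarrow> 'h)" where
  "cadjoint T = (THE S. \<forall>x y. cinner (T x) y = cinner x (S y))"

text \<open>The weak operator topology is the initial topology on the bounded operators for the
  maps \<open>T \<mapsto> cinner (T x) y\<close>; the codomain \<open>'h \<times> 'h \<Rightarrow> complex\<close> carries the product topology.\<close>

definition wot :: "('h::complex_inner \<Rightarrow> 'h) topology" where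
  "wot = pullback_topology bounded_ops (\<lambda>T (x, y). cinner (T x) y) euclidean"

definition weakly_dense_in ::
    "('h::complex_inner \<Rightarrow> 'h) set \<Rightarrow> ('h \<Rightarrow> 'h) set \<Rightarrow> bool" where
  "weakly_dense_in S B \<longleftrightarrow> S \<subseteq> B \<and> B \<subseteq> wot closure_of S"

definition operator_subalgebra :: "('h::complex_normed_vector \<Rightarrow> 'h) set \<Rightarrow> bool" where
  "operator_subalgebra M \<longleftrightarrow> M \<subseteq> bounded_ops \<and> (\<lambda>_. 0) \<in> M \<and>
    (\<forall>S\<in>M. \<forall>T\<in>M. (\<lambda>x. S x + T x) \<in> M \<and> S \<circ> T \<in> M) \<and>
    (\<forall>c. \<forall>T\<in>M. (\<lambda>x. c *\<^sub>C T x) \<in> M)"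

definition abelian_selfadjoint_subalgebra :: "('h::complex_inner \<Rightarrow> 'h) set \<Rightarrow> bool" where
  "abelian_selfadjoint_subalgebra M \<longleftrightarrow> operator_subalgebra M \<and>
    (\<forall>T\<in>M. cadjoint T \<in> M) \<and> (\<forall>S\<in>M. \<forall>T\<in>M. S \<circ> T = T \<circ> S)"

definition masa :: "('h::complex_inner \<Rightarrow> 'h) set \<Rightarrow> bool" where
  "masa M \<longleftrightarrow> abelian_selfadjoint_subalgebra M \<and>
    (\<forall>M'. abelian_selfadjoint_subalgebra M' \<and> M \<subseteq> M' \<longrightarrow> M' = M)"

definition orth_projection :: "('h::complex_inner \<Rightarrow> 'h) \<Rightarrow> bool" where
  "orth_projection P \<longleftrightarrow> P \<in> bounded_ops \<and> P \<circ> P = P \<and> cadjoint P = P"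

definition leaves_invariant :: "('h \<Rightarrow> 'h) \<Rightarrow> ('h \<Rightarrow> 'h) \<Rightarrow> bool" where
  "leaves_invariant T P \<longleftrightarrow> T ` range P \<subseteq> range P"

definition Lat :: "('h::complex_inner \<Rightarrow> 'h) set \<Rightarrow> ('h \<Rightarrow> 'h) set" where
  "Lat S = {P. orth_projection P \<and> (\<forall>T\<in>S. leaves_invariant T P)}"

text \<open>Projections are ordered by inclusion of their ranges.\<close>

definition nest :: "('h::complex_inner \<Rightarrow> 'h) set \<Rightarrow> bool" where
  "nest N \<longleftrightarrow> (\<forall>P\<in>N. orth_projection P) \<and>
    (\<forall>P\<in>N. \<forall>Q\<in>N. range P \<subseteq> range Q \<or> range Q \<subseteq> range P)"

definition nest_algebra :: "('h::complex_inner \<Rightarrow> 'h) set \<Rightarrow> ('h \<Rightarrow> 'h) set" where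
  "nest_algebra N = {T \<in> bounded_ops. \<forall>P\<in>N. leaves_invariant T P}"

text \<open>An operator algebra is a norm-closed algebra of operators on a Hilbert space; it is unital
  if it has an identity element of norm one, which need not be the identity operator.\<close>

definition unital_operator_algebra :: "('k::complex_hilbert \<Rightarrow> 'k) set \<Rightarrow> bool" where
  "unital_operator_algebra A \<longleftrightarrow> operator_subalgebra A \<and>
    (\<forall>T\<in>bounded_ops. (\<forall>\<epsilon>>0. \<exists>S\<in>A. onorm (\<lambda>x. T x - S x) < \<epsilon>) \<longrightarrow> T \<in> A) \<and>
    (\<exists>e\<in>A. onorm e = 1 \<and> (\<forall>T\<in>A. e \<circ> T = T \<and> T \<circ> e = T))"

text \<open>An \<open>n \<times> n\<close> matrix is a function of two indices of which only the values
  at indices below \<open>n\<close> matter.  A matrix of operators on \<open>'k\<close> is normed as an operator on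
  the Hilbert space direct sum of \<open>n\<close> copies of \<open>'k\<close>.\<close>

definition op_matrix_norm ::
    "nat \<Rightarrow> (nat \<Rightarrow> nat \<Rightarrow> 'k::complex_inner \<Rightarrow> 'k) \<Rightarrow> real" where
  "op_matrix_norm n x =
    (SUP v \<in> {v :: nat \<Rightarrow> 'k. (\<Sum>j<n. (norm (v j))\<^sup>2) \<le> 1}.
      sqrt (\<Sum>i<n. (norm (\<Sum>j<n. x i j (v j)))\<^sup>2))"

definition matrix_times ::
    "nat \<Rightarrow> (nat \<Rightarrow> nat \<Rightarrow> 'a::cstar_algebra) \<Rightarrow> (nat \<Rightarrow> nat \<Rightarrow> 'a) \<Rightarrow> nat \<Rightarrow> nat \<Rightarrow> 'a" where
  "matrix_times n x y = (\<lambda>i k. \<Sum>j<n. x i j * y j k)"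

definition matrix_star :: "(nat \<Rightarrow> nat \<Rightarrow> 'a::cstar_algebra) \<Rightarrow> nat \<Rightarrow> nat \<Rightarrow> 'a" where
  "matrix_star x = (\<lambda>i j. star (x j i))"

text \<open>\<open>N\<close> is the C*-norm of the *-algebra of \<open>n \<times> n\<close> matrices over a C*-algebra.  Such a norm
  exists and is unique, and it is automatically complete.\<close>

definition cstar_matrix_norm ::
    "nat \<Rightarrow> ((nat \<Rightarrow> nat \<Rightarrow> 'a::cstar_algebra) \<Rightarrow> real) \<Rightarrow> bool" where
  "cstar_matrix_norm n N \<longleftrightarrow>
    (\<forall>x y. (\<forall>i<n. \<forall>j<n. x i j = y i j) \<longrightarrow> N x = N y) \<and>
    (\<forall>x. N x = 0 \<longleftrightarrow> (\<forall>i<n. \<forall>j<n. x i j = 0)) \<and>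
    (\<forall>x y. N (\<lambda>i j. x i j + y i j) \<le> N x + N y) \<and>
    (\<forall>c x. N (\<lambda>i j. c *\<^sub>C x i j) = cmod c * N x) \<and>
    (\<forall>x y. N (matrix_times n x y) \<le> N x * N y) \<and>
    (\<forall>x. N (matrix_times n (matrix_star x) x) = (N x)\<^sup>2)"

definition completely_isometric ::
    "('k::complex_hilbert \<Rightarrow> 'k) set \<Rightarrow> (('k \<Rightarrow> 'k) \<Rightarrow> 'a::cstar_algebra) \<Rightarrow> bool" where
  "completely_isometric A j \<longleftrightarrow>
    (\<forall>n. \<exists>N. cstar_matrix_norm n N \<and>
      (\<forall>x. (\<forall>i<n. \<forall>k<n. x i k \<in> A) \<longrightarrow> N (\<lambda>i k. j (x i k)) = op_matrix_norm n x))"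

definition algebra_hom_on ::
    "('k::complex_hilbert \<Rightarrow> 'k) set \<Rightarrow> (('k \<Rightarrow> 'k) \<Rightarrow> 'a::cstar_algebra) \<Rightarrow> bool" where
  "algebra_hom_on A j \<longleftrightarrow>
    (\<forall>S\<in>A. \<forall>T\<in>A. j (\<lambda>x. S x + T x) = j S + j T \<and> j (S \<circ> T) = j S * j T) \<and>
    (\<forall>c. \<forall>T\<in>A. j (\<lambda>x. c *\<^sub>C T x) = c *\<^sub>C j T)"

text \<open>The C*-algebra is the whole type \<open>'a\<close>.\<close>

definition cstar_cover ::
    "('k::complex_hilbert \<Rightarrow> 'k) set \<Rightarrow> (('k \<Rightarrow> 'k) \<Rightarrow> 'a::cstar_algebra) \<Rightarrow> bool" where
  "cstar_cover A j \<longleftrightarrow> algebra_hom_on A j \<and> completely_isometric A j"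

definition dirichlet_in ::
    "('k::complex_hilbert \<Rightarrow> 'k) set \<Rightarrow> (('k \<Rightarrow> 'k) \<Rightarrow> 'a::cstar_algebra) \<Rightarrow> bool" where
  "dirichlet_in A j \<longleftrightarrow> closure {j S + star (j T) | S T. S \<in> A \<and> T \<in> A} = UNIV"

definition star_representation ::
    "('a::cstar_algebra \<Rightarrow> 'h::complex_hilbert \<Rightarrow> 'h) \<Rightarrow> bool" where
  "star_representation \<pi> \<longleftrightarrow> (\<forall>a. \<pi> a \<in> bounded_ops) \<and>
    (\<forall>a b. \<pi> (a + b) = (\<lambda>x. \<pi> a x + \<pi> b x)) \<and>
    (\<forall>c a. \<pi> (c *\<^sub>C a) = (\<lambda>x. c *\<^sub>C \<pi> a x)) \<and>
    (\<forall>a b. \<pi> (a * b) = \<pi> a \<circ> \<pi> b) \<and>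
    (\<forall>a. \<pi> (star a) = cadjoint (\<pi> a))"

definition closed_csubspace :: "'h::complex_normed_vector set \<Rightarrow> bool" where
  "closed_csubspace V \<longleftrightarrow> closed V \<and> 0 \<in> V \<and>
    (\<forall>x\<in>V. \<forall>y\<in>V. x + y \<in> V) \<and> (\<forall>c. \<forall>x\<in>V. c *\<^sub>C x \<in> V)"

text \<open>As usual, the zero representation does not count as irreducible.\<close>

definition irreducible_representation ::
    "('a::cstar_algebra \<Rightarrow> 'h::complex_hilbert \<Rightarrow> 'h) \<Rightarrow> bool" where
  "irreducible_representation \<pi> \<longleftrightarrow> star_representation \<pi> \<and> (\<exists>a x. \<pi> a x \<noteq> 0) \<and>
    (\<forall>V. closed_csubspace V \<and> (\<forall>a. \<pi> a ` V \<subseteq> V) \<longrightarrow> V = {0} \<or> V = UNIV)"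

end

theory Submission
  imports Defs
begin

text \<open>Write \<open>D\<close> for the image of the algebra and \<open>B\<close> for its weak closure.  Since \<open>B\<close> contains a
  masa, every projection in \<open>Lat D\<close> commutes with the masa and so lies in it.  Take \<open>P\<close> and \<open>Q\<close> in
  \<open>Lat D\<close>, \<open>u\<close> in the range of \<open>Q - PQ\<close> and \<open>v\<close> in the range of \<open>P - PQ\<close>.  The functional
  \<open>X \<mapsto> cinner (X u) v\<close> kills \<open>D\<close> because of \<open>Q\<close> and the adjoints of \<open>D\<close> because of \<open>P\<close>.  By the
  Dirichlet property it kills the image of the whole C*-algebra, which is weakly dense by
  irreducibility, so \<open>u = 0\<close> or \<open>v = 0\<close>: the lattice is a nest.

  It remains to see that an operator \<open>T\<close> leaving \<open>Lat D\<close> invariant lies in \<open>B\<close>, that is, that every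
  functional \<open>X \<mapsto> (\<Sum>i<n. cinner (X (x i)) (y i))\<close> that kills \<open>D\<close> kills \<open>T\<close>.  The Dirichlet
  property gives more room than a masa alone: for \<open>P \<le> Q \<le> R\<close> in the nest the whole off-diagonal
  block \<open>(Q - P) X (R - Q)\<close> belongs to \<open>B\<close>, for every bounded \<open>X\<close> (lemma \<open>off_diagonal\<close>),
  since the adjoints of \<open>D\<close> have no such block.  Hence the functional, evaluated at the diagonal
  blocks of \<open>T\<close>, is additive over adjacent intervals of the nest, and the diagonal blocks have to
  be controlled.

  For this, let \<open>K\<close> be the closed span of the tuples \<open>(S (x i))\<close>, \<open>S \<in> D\<close>, in the direct sum of \<open>n\<close>
  copies of the Hilbert space.  It is invariant under \<open>B\<close> and reduces the masa, so the entries of the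
  matrix of its projection lie in the masa, and so do the positive operators \<open>m\<close> obtained by
  compressing this matrix to a vector of \<open>n\<close> scalars.  The invariance of \<open>K\<close> forces a spectral
  subspace of \<open>m\<close> for large values to be mapped by \<open>B\<close> into one for values hardly smaller
  (\<open>compression_separation\<close>), so every gap \<open>l < u\<close> is separated by an element of the nest: \<open>m \<ge> l\<close>
  below it and \<open>m \<le> u\<close> above it (\<open>compression_split\<close>).  Thus \<open>m\<close> is nearly constant on the
  intervals of a sufficiently fine finite partition of the nest.  There the matrix nearly
  commutes with \<open>T\<close>, and if it commuted exactly then \<open>K\<close> would be \<open>T\<close>-invariant and the functional
  would vanish at \<open>T\<close>.  Summing the errors over the partition shows that it does vanish.

  For the trivial nest the same argument, with commutation in place of the separation estimate,
  shows the density of an irreducible representation (\<open>irreducible_density\<close>).  The only spectral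
  theory needed is the projection that splits a self-adjoint operator at a real number, obtained
  from the absolute value; the iteration for square roots also yields the continuity of
  representations, which is what lets a functional vanish on the closure of a dense set.\<close>

section \<open>Complex Hilbert spaces\<close>

lemma scaleC_0_left [simp]: "0 *\<^sub>C (x::'h::complex_normed_vector) = 0"
  using scaleC_of_real[of 0 x] by simp

lemma scaleC_0_right [simp]: "c *\<^sub>C (0::'h::complex_normed_vector) = 0"
  using scaleC_add_right[of c 0 "0::'h"] by simp

lemma scaleC_1_left [simp]: "1 *\<^sub>C (x::'h::complex_normed_vector) = x"
  using scaleC_of_real[of 1 x] by simp

lemma scaleC_minus1: "(- 1) *\<^sub>C (x::'h::complex_normed_vector) = - x"
  using scaleC_of_real[of "-1" x] by simp

lemma scaleC_minus_right [simp]: "c *\<^sub>C (- x) = - (c *\<^sub>C (x::'h::complex_normed_vector))"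
  using scaleC_add_right[of c x "- x"] by (simp add: eq_neg_iff_add_eq_0 add.commute)

lemma scaleC_minus_left [simp]: "(- c) *\<^sub>C x = - (c *\<^sub>C (x::'h::complex_normed_vector))"
  using scaleC_add_left[of c "- c" x] by (simp add: eq_neg_iff_add_eq_0 add.commute)

lemma scaleC_diff_right: "c *\<^sub>C (x - y) = c *\<^sub>C x - c *\<^sub>C (y::'h::complex_normed_vector)"
  using scaleC_add_right[of c x "- y"] by simp

lemma cinner_add_right: "cinner x (y + z) = cinner x y + cinner x (z::'h::complex_inner)"
  by (metis cinner_commute cinner_add_left complex_cnj_add)

lemma cinner_scaleC_right: "cinner x (c *\<^sub>C y) = cnj c * cinner x (y::'h::complex_inner)"
  by (metis cinner_commute cinner_scaleC_left complex_cnj_mult)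

lemma cinner_scaleR_left: "cinner (r *\<^sub>R x) y = of_real r * cinner x (y::'h::complex_inner)"
  by (metis scaleC_of_real cinner_scaleC_left)

lemma cinner_scaleR_right: "cinner x (r *\<^sub>R y) = of_real r * cinner x (y::'h::complex_inner)"
  by (metis scaleC_of_real cinner_scaleC_right complex_cnj_complex_of_real)

lemma cinner_0_left [simp]: "cinner 0 (y::'h::complex_inner) = 0"
  using cinner_scaleC_left[of 0 y y] by simp

lemma cinner_0_right [simp]: "cinner (x::'h::complex_inner) 0 = 0"
  using cinner_scaleC_right[of x 0 x] by simp

lemma cinner_minus_left [simp]: "cinner (- x) y = - cinner x (y::'h::complex_inner)"
  using cinner_scaleC_left[of "-1" x y] by (simp add: scaleC_minus1)

lemma cinner_minus_right [simp]: "cinner x (- y) = - cinner x (y::'h::complex_inner)"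
  using cinner_scaleC_right[of x "-1" y] by (simp add: scaleC_minus1)

lemma cinner_diff_left: "cinner (x - y) z = cinner x z - cinner y (z::'h::complex_inner)"
  using cinner_add_left[of x "- y" z] by simp

lemma cinner_diff_right: "cinner x (y - z) = cinner x y - cinner x (z::'h::complex_inner)"
  using cinner_add_right[of x y "- z"] by simp

lemma cinner_sum_left: "cinner (\<Sum>i\<in>I. f i) y = (\<Sum>i\<in>I. cinner (f i) (y::'h::complex_inner))"
  by (induction I rule: infinite_finite_induct) (auto simp: cinner_add_left)

lemma cinner_sum_right: "cinner y (\<Sum>i\<in>I. f i) = (\<Sum>i\<in>I. cinner y (f i::'h::complex_inner))"
  by (induction I rule: infinite_finite_induct) (auto simp: cinner_add_right)

lemmas cinner_expand = cinner_add_left cinner_add_right cinner_diff_left cinner_diff_right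
  cinner_scaleC_left cinner_scaleC_right

lemma Re_cinner_self: "Re (cinner x x) = (norm (x::'h::complex_inner))\<^sup>2"
  by (simp add: cinner_self)

lemma norm_add_sq:
  "(norm (x + y))\<^sup>2 = (norm x)\<^sup>2 + 2 * Re (cinner x y) + (norm (y::'h::complex_inner))\<^sup>2"
proof -
  have "Re (cinner y x) = Re (cinner x y)" by (subst cinner_commute) simp
  then show ?thesis
    by (simp add: Re_cinner_self[symmetric] cinner_add_left cinner_add_right)
qed

lemma norm_diff_sq:
  "(norm (x - y))\<^sup>2 = (norm x)\<^sup>2 - 2 * Re (cinner x y) + (norm (y::'h::complex_inner))\<^sup>2"
  using norm_add_sq[of x "- y"] by simp

lemma cinner_eq_0_imp: "(\<And>y. cinner x y = 0) \<Longrightarrow> x = (0::'h::complex_inner)"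
  using cinner_self[of x] by simp

lemma cinner_ext: "(\<And>z. cinner x z = cinner y z) \<Longrightarrow> x = (y::'h::complex_inner)"
  using cinner_eq_0_imp[of "x - y"] by (simp add: cinner_diff_left)

lemma cinner_ext_right: "(\<And>z. cinner z x = cinner z y) \<Longrightarrow> x = (y::'h::complex_inner)"
  by (metis cinner_commute cinner_ext)

lemma Re_cinner_le: "Re (cinner x y) \<le> norm x * norm (y::'h::complex_inner)"
proof -
  have "(norm (x + y))\<^sup>2 \<le> (norm x + norm y)\<^sup>2"
    by (intro power_mono norm_triangle_ineq) auto
  then show ?thesis by (simp add: norm_add_sq power2_sum)
qed

text \<open>Rotating \<open>x\<close> by a unimodular scalar makes the inner product real, where the triangle inequality applies.\<close>

lemma cinner_Cauchy_Schwarz: "cmod (cinner x y) \<le> norm x * norm (y::'h::complex_inner)"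
proof (cases "cinner x y = 0")
  case False
  define c where "c = cnj (sgn (cinner x y))"
  have 1: "c * cinner x y = of_real (cmod (cinner x y))"
    unfolding c_def using False
    by (simp add: sgn_eq field_simps complex_norm_square[symmetric] power2_eq_square)
  have "cmod c = 1" unfolding c_def using False by (simp add: norm_sgn)
  then show ?thesis
    using Re_cinner_le[of "c *\<^sub>C x" y] 1 by (simp add: cinner_scaleC_left norm_scaleC)
qed simp

lemma bounded_bilinear_cinner: "bounded_bilinear (cinner :: 'h::complex_inner \<Rightarrow> 'h \<Rightarrow> complex)"
proof
  show "\<exists>K. \<forall>a b. norm (cinner a (b::'h)) \<le> norm a * norm b * K"
    using cinner_Cauchy_Schwarz by (intro exI[of _ 1]) auto
qed (auto simp: cinner_add_left cinner_add_right cinner_scaleR_left cinner_scaleR_right scaleR_conv_of_real)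

lemmas tendsto_cinner = bounded_bilinear.tendsto[OF bounded_bilinear_cinner]

lemma bounded_ops_linear:
  assumes "T \<in> bounded_ops"
  shows "T (x + y) = T x + T y" "T (x - y) = T x - T y" "T (c *\<^sub>C x) = c *\<^sub>C T x"
    "T 0 = 0" "T (- x) = - T x" "T (r *\<^sub>R x) = r *\<^sub>R T x"
    "T (\<Sum>i\<in>I. f i) = (\<Sum>i\<in>I. T (f i))" "bounded_linear T"
proof -
  show bl: "bounded_linear T" using assms by (simp add: bounded_ops_def)
  then have l: "linear T" by (rule bounded_linear.linear)
  show "T (x + y) = T x + T y" "T (x - y) = T x - T y" "T 0 = 0" "T (- x) = - T x"
    "T (r *\<^sub>R x) = r *\<^sub>R T x" "T (\<Sum>i\<in>I. f i) = (\<Sum>i\<in>I. T (f i))"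
    using l by (simp_all add: linear_add linear_diff linear_0 linear_neg linear_scale linear_sum)
  show "T (c *\<^sub>C x) = c *\<^sub>C T x" using assms by (simp add: bounded_ops_def)
qed

lemma bounded_opsI:
  fixes T :: "'h::complex_normed_vector \<Rightarrow> 'h"
  assumes "\<And>x y. T (x + y) = T x + T y" "\<And>c x. T (c *\<^sub>C x) = c *\<^sub>C T x"
    and "\<And>x. norm (T x) \<le> norm x * K"
  shows "T \<in> bounded_ops"
proof -
  have "T (r *\<^sub>R x) = r *\<^sub>R T x" for r x using assms(2)[of "of_real r" x] by (simp add: scaleC_of_real)
  then have "bounded_linear T" using assms by (intro bounded_linear_intro[where K = K]) auto
  then show ?thesis using assms(2) by (auto simp: bounded_ops_def)
qed

lemma bounded_ops_zero: "(\<lambda>x. 0) \<in> bounded_ops"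
  by (rule bounded_opsI[where K = 0]) auto

lemma bounded_ops_ident: "(\<lambda>x. x) \<in> bounded_ops"
  by (rule bounded_opsI[where K = 1]) auto

lemma bounded_ops_add:
  "S \<in> bounded_ops \<Longrightarrow> T \<in> bounded_ops \<Longrightarrow> (\<lambda>x. S x + T x) \<in> bounded_ops"
  by (auto simp: bounded_ops_def bounded_linear_add scaleC_add_right)

lemma bounded_ops_diff:
  "S \<in> bounded_ops \<Longrightarrow> T \<in> bounded_ops \<Longrightarrow> (\<lambda>x. S x - T x) \<in> bounded_ops"
  by (auto simp: bounded_ops_def bounded_linear_sub scaleC_diff_right)

lemma bounded_ops_compose:
  "S \<in> bounded_ops \<Longrightarrow> T \<in> bounded_ops \<Longrightarrow> (\<lambda>x. S (T x)) \<in> bounded_ops"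
  by (auto simp: bounded_ops_def bounded_linear_compose)

lemma bounded_ops_scaleC:
  fixes T :: "'h::complex_normed_vector \<Rightarrow> 'h"
  assumes "T \<in> bounded_ops" shows "(\<lambda>x. c *\<^sub>C T x) \<in> bounded_ops"
proof -
  obtain K where K: "\<And>x. norm (T x) \<le> norm x * K"
    using bounded_linear.bounded[OF bounded_ops_linear(8)[OF assms]] by blast
  show ?thesis
  proof (rule bounded_opsI[where K = "cmod c * K"])
    show "norm (c *\<^sub>C T x) \<le> norm x * (cmod c * K)" for x
      using mult_left_mono[OF K[of x], of "cmod c"] by (simp add: norm_scaleC ac_simps)
  qed (auto simp: bounded_ops_linear[OF assms] scaleC_add_right scaleC_scaleC mult.commute)
qed

lemma bounded_ops_sum:
  "finite I \<Longrightarrow> (\<And>i. i \<in> I \<Longrightarrow> T i \<in> bounded_ops) \<Longrightarrow> (\<lambda>x. \<Sum>i\<in>I. T i x) \<in> bounded_ops"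
  by (induction I rule: finite_induct) (auto intro: bounded_ops_zero bounded_ops_add)

lemma bounded_ops_bound:
  fixes T :: "'h::complex_normed_vector \<Rightarrow> 'h"
  assumes "T \<in> bounded_ops" obtains K where "K > 0" "\<And>x. norm (T x) \<le> K * norm x"
  using bounded_linear.pos_bounded[OF bounded_ops_linear(8)[OF assms]] by (metis mult.commute)

lemma tendsto_bounded_ops:
  assumes "T \<in> bounded_ops" "(f \<longlongrightarrow> l) F" shows "((\<lambda>x. T (f x)) \<longlongrightarrow> T l) F"
  using bounded_linear.tendsto[OF bounded_ops_linear(8)[OF assms(1)] assms(2)] .

section \<open>Orthogonal projection in a finite direct sum\<close>

definition tuple_inner :: "nat \<Rightarrow> (nat \<Rightarrow> 'h::complex_inner) \<Rightarrow> (nat \<Rightarrow> 'h) \<Rightarrow> complex" where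
  "tuple_inner n v w = (\<Sum>i<n. cinner (v i) (w i))"

definition tuple_norm2 :: "nat \<Rightarrow> (nat \<Rightarrow> 'h::complex_inner) \<Rightarrow> real" where
  "tuple_norm2 n v = (\<Sum>i<n. (norm (v i))\<^sup>2)"

lemma tuple_norm2_nonneg [simp]: "tuple_norm2 n v \<ge> 0"
  by (simp add: tuple_norm2_def sum_nonneg)

lemma tuple_inner_self: "tuple_inner n v v = of_real (tuple_norm2 n v)"
  by (simp add: tuple_inner_def tuple_norm2_def cinner_self)

lemma tuple_inner_commute: "tuple_inner n v w = cnj (tuple_inner n w v)"
  unfolding tuple_inner_def cnj_sum by (intro sum.cong refl) (metis cinner_commute)

lemma tuple_inner_diff_left:
  "tuple_inner n (\<lambda>i. u i - v i) w = tuple_inner n u w - tuple_inner n v w"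
  by (simp add: tuple_inner_def cinner_diff_left sum_subtractf)

lemma tuple_inner_add_left:
  "tuple_inner n (\<lambda>i. u i + v i) w = tuple_inner n u w + tuple_inner n v w"
  by (simp add: tuple_inner_def cinner_add_left sum.distrib)

lemma tuple_inner_scaleC_left:
  "tuple_inner n (\<lambda>i. c *\<^sub>C u i) w = c * tuple_inner n u w"
  by (simp add: tuple_inner_def cinner_scaleC_left sum_distrib_left)

lemma tuple_inner_scaleC_right:
  "tuple_inner n w (\<lambda>i. c *\<^sub>C u i) = cnj c * tuple_inner n w u"
  by (simp add: tuple_inner_def cinner_scaleC_right sum_distrib_left)

lemma tuple_norm2_eq_0_iff: "tuple_norm2 n v = 0 \<longleftrightarrow> (\<forall>i<n. v i = 0)"
  by (auto simp: tuple_norm2_def sum_nonneg_eq_0_iff)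

lemma norm_sq_le_tuple_norm2: "i < n \<Longrightarrow> (norm (v i))\<^sup>2 \<le> tuple_norm2 n v"
  unfolding tuple_norm2_def by (rule member_le_sum) auto

lemma tuple_norm2_diff:
  "tuple_norm2 n (\<lambda>i. u i - v i) = tuple_norm2 n u - 2 * Re (tuple_inner n u v) + tuple_norm2 n v"
  by (simp add: tuple_norm2_def tuple_inner_def norm_diff_sq sum.distrib sum_subtractf sum_distrib_left)

lemma tuple_parallelogram:
  fixes v :: "nat \<Rightarrow> 'h::complex_inner"
  shows "tuple_norm2 n (\<lambda>i. a i - b i) + 4 * tuple_norm2 n (\<lambda>i. v i - (1/2) *\<^sub>C (a i + b i))
    = 2 * tuple_norm2 n (\<lambda>i. v i - a i) + 2 * tuple_norm2 n (\<lambda>i. v i - b i)"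
proof -
  have *: "(norm (p - q))\<^sup>2 + 4 * (norm (x - (1/2) *\<^sub>C (p + q)))\<^sup>2
      = 2 * (norm (x - p))\<^sup>2 + 2 * (norm (x - q))\<^sup>2" for p q x :: 'h
  proof -
    have h: "x - (1/2) *\<^sub>C (p + q) = (1/2) *\<^sub>R ((x - p) + (x - q))"
    proof -
      have "(1/2::complex) *\<^sub>C (p + q) = (1/2) *\<^sub>R (p + q)"
        using scaleC_of_real[of "1/2" "p + q"] by simp
      moreover have "x = (1/2) *\<^sub>R (x + x)" by (simp add: scaleR_2[symmetric])
      ultimately show ?thesis by (smt (verit, best) add_diff_add scaleR_right_diff_distrib)
    qed
    have "p - q = (x - q) - (x - p)" by simp
    then show ?thesis unfolding h
      by (simp only: norm_scaleR norm_diff_sq[of "x - q" "x - p"] norm_add_sq[of "x - p" "x - q"] power_mult_distrib)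
        (simp add: power2_eq_square cinner_commute[of "x - q" "x - p"] add_divide_distrib)
  qed
  show ?thesis
    unfolding tuple_norm2_def sum_distrib_left sum.distrib[symmetric] by (intro sum.cong refl *)
qed

lemma tendsto_tuple_inner:
  assumes "\<And>i. i < n \<Longrightarrow> ((\<lambda>m. f m i) \<longlongrightarrow> a i) F" "\<And>i. i < n \<Longrightarrow> ((\<lambda>m. g m i) \<longlongrightarrow> b i) F"
  shows "((\<lambda>m. tuple_inner n (f m) (g m)) \<longlongrightarrow> tuple_inner n a b) F"
  unfolding tuple_inner_def using assms by (intro tendsto_sum tendsto_cinner) auto

lemma tendsto_tuple_norm2:
  assumes "\<And>i. i < n \<Longrightarrow> ((\<lambda>m. f m i) \<longlongrightarrow> a i) F"
  shows "((\<lambda>m. tuple_norm2 n (f m)) \<longlongrightarrow> tuple_norm2 n a) F"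
  unfolding tuple_norm2_def using assms by (intro tendsto_sum tendsto_power tendsto_norm) auto

text \<open>A sequence in the subspace \<open>V\<close> that minimizes the distance to \<open>v\<close> is Cauchy by the parallelogram law.
  The projection onto the closure of \<open>V\<close> comes with a sequence in \<open>V\<close> that converges to it: this covers
  projections onto orthogonal complements as well as the description of a closure by
  annihilating vectors.  Tuples are functions on all of \<open>nat\<close> of which the values below \<open>n\<close> count.\<close>

lemma tuple_projection_exists:
  fixes V :: "(nat \<Rightarrow> 'h::complex_hilbert) set"
  assumes zero: "(\<lambda>i. 0) \<in> V"
    and add: "\<And>u w. u \<in> V \<Longrightarrow> w \<in> V \<Longrightarrow> (\<lambda>i. u i + w i) \<in> V"
    and scale: "\<And>c u. u \<in> V \<Longrightarrow> (\<lambda>i. c *\<^sub>C u i) \<in> V"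
  obtains \<sigma> w where "\<And>m. \<sigma> m \<in> V" "\<And>i. i < n \<Longrightarrow> (\<lambda>m. \<sigma> m i) \<longlonglongrightarrow> w i"
    "\<And>u. u \<in> V \<Longrightarrow> tuple_inner n (\<lambda>i. v i - w i) u = 0"
proof -
  define f where "f u = tuple_norm2 n (\<lambda>i. v i - u i)" for u
  define d where "d = Inf (f ` V)"
  have bdd: "bdd_below (f ` V)" unfolding f_def by (intro bdd_belowI[of _ 0]) auto
  have dle: "d \<le> f u" if "u \<in> V" for u unfolding d_def using bdd that by (simp add: cInf_lower)
  have "\<exists>u\<in>V. f u < d + 1 / Suc m" for m
    using cInf_lessD[of "f ` V" "d + 1 / Suc m"] zero unfolding d_def by force
  then obtain \<sigma> where \<sigma>: "\<And>m. \<sigma> m \<in> V" "\<And>m. f (\<sigma> m) < d + 1 / Suc m" by metis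
  have close: "tuple_norm2 n (\<lambda>i. \<sigma> m i - \<sigma> k i) \<le> 2 / Suc m + 2 / Suc k" for m k
  proof -
    have "f (\<lambda>i. (1/2) *\<^sub>C (\<sigma> m i + \<sigma> k i)) \<ge> d" by (intro dle scale add \<sigma>)
    moreover have "tuple_norm2 n (\<lambda>i. \<sigma> m i - \<sigma> k i) + 4 * f (\<lambda>i. (1/2) *\<^sub>C (\<sigma> m i + \<sigma> k i))
        = 2 * f (\<sigma> m) + 2 * f (\<sigma> k)"
      unfolding f_def by (rule tuple_parallelogram)
    moreover have "2 / Suc m = 2 * (1 / Suc m)" "2 / Suc k = 2 * (1 / Suc k)" by simp_all
    ultimately show ?thesis using \<sigma>(2)[of m] \<sigma>(2)[of k] by linarith
  qed
  have scaled: "2 / real (Suc m) = 2 * (1 / real (Suc m))" for m by simp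
  have "Cauchy (\<lambda>m. \<sigma> m i)" if "i < n" for i
  proof (rule metric_CauchyI)
    fix e :: real assume "e > 0"
    then obtain N where N: "inverse (Suc N) < e\<^sup>2 / 4"
      using reals_Archimedean[of "e\<^sup>2 / 4"] by auto
    have "dist (\<sigma> m i) (\<sigma> k i) < e" if "m \<ge> N" "k \<ge> N" for m k
    proof -
      have "1 / Suc m \<le> 1 / Suc N" "1 / Suc k \<le> 1 / Suc N" using that by (auto simp: field_simps)
      then have "tuple_norm2 n (\<lambda>i. \<sigma> m i - \<sigma> k i) < e\<^sup>2"
        using close[of m k] N scaled[of m] scaled[of k] by (simp only: inverse_eq_divide)
      then have "(norm (\<sigma> m i - \<sigma> k i))\<^sup>2 < e\<^sup>2"
        using norm_sq_le_tuple_norm2[OF \<open>i < n\<close>, of "\<lambda>i. \<sigma> m i - \<sigma> k i"] by linarith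
      then show ?thesis using \<open>e > 0\<close> by (simp add: dist_norm power2_less_imp_less)
    qed
    then show "\<exists>M. \<forall>m\<ge>M. \<forall>k\<ge>M. dist (\<sigma> m i) (\<sigma> k i) < e" by blast
  qed
  then have "\<exists>l. (\<lambda>m. \<sigma> m i) \<longlonglongrightarrow> l" if "i < n" for i
    using that Cauchy_convergent convergent_def by blast
  then obtain w where w: "\<And>i. i < n \<Longrightarrow> (\<lambda>m. \<sigma> m i) \<longlonglongrightarrow> w i" by metis
  have fw: "f w \<le> d"
  proof (rule LIMSEQ_le)
    show "(\<lambda>m. f (\<sigma> m)) \<longlonglongrightarrow> f w" unfolding f_def
      using w by (intro tendsto_tuple_norm2 tendsto_diff tendsto_const) auto
    have "(\<lambda>m. d + 1 / Suc m) \<longlonglongrightarrow> d + 0"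
      by (intro tendsto_add tendsto_const) (use LIMSEQ_inverse_real_of_nat in \<open>simp add: inverse_eq_divide\<close>)
    then show "(\<lambda>m. d + 1 / Suc m) \<longlonglongrightarrow> d" by simp
  qed (use \<sigma>(2) less_imp_le in blast)
  have orth: "tuple_inner n (\<lambda>i. v i - w i) u = 0" if u: "u \<in> V" for u
  proof -
    define t where "t = tuple_inner n (\<lambda>i. v i - w i) u"
    define U where "U = tuple_norm2 n u"
    \<comment> \<open>a step along \<open>u\<close> short enough to decrease the distance unless \<open>t = 0\<close>; adding 1 avoids a division by 0\<close>
    define s where "s = 1 / (U + 1)"
    define c where "c = of_real s * t"
    have U0: "U \<ge> 0" by (simp add: U_def)
    have "f (\<lambda>i. w i + c *\<^sub>C u i) \<ge> d"
    proof (rule LIMSEQ_le_const)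
      show "(\<lambda>m. f (\<lambda>i. \<sigma> m i + c *\<^sub>C u i)) \<longlonglongrightarrow> f (\<lambda>i. w i + c *\<^sub>C u i)" unfolding f_def
        using w by (intro tendsto_tuple_norm2 tendsto_diff tendsto_add tendsto_const) auto
      show "\<exists>N. \<forall>m\<ge>N. d \<le> f (\<lambda>i. \<sigma> m i + c *\<^sub>C u i)" by (auto intro!: dle add scale \<sigma> u)
    qed
    moreover have "f (\<lambda>i. w i + c *\<^sub>C u i)
        = f w - 2 * Re (tuple_inner n (\<lambda>i. v i - w i) (\<lambda>i. c *\<^sub>C u i)) + tuple_norm2 n (\<lambda>i. c *\<^sub>C u i)"
      unfolding f_def tuple_norm2_diff[symmetric] by (simp add: algebra_simps)
    moreover have "tuple_inner n (\<lambda>i. v i - w i) (\<lambda>i. c *\<^sub>C u i) = of_real (s * (cmod t)\<^sup>2)"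
      unfolding tuple_inner_scaleC_right t_def[symmetric] c_def
      by (simp add: complex_norm_square mult.commute mult.left_commute del: of_real_power)
    moreover have "tuple_norm2 n (\<lambda>i. c *\<^sub>C u i) = s\<^sup>2 * (cmod t)\<^sup>2 * U"
      unfolding tuple_norm2_def U_def c_def
      by (simp add: norm_scaleC power_mult_distrib sum_distrib_left norm_mult)
    ultimately have "0 \<le> - 2 * (s * (cmod t)\<^sup>2) + s\<^sup>2 * (cmod t)\<^sup>2 * U" using fw by simp
    moreover have "s * U < 2 \<and> s > 0" unfolding s_def using U0 by (auto simp: field_simps)
    ultimately have "(cmod t)\<^sup>2 * (s * (2 - s * U)) \<le> 0" by (simp add: algebra_simps power2_eq_square)
    moreover have "s * (2 - s * U) > 0" using \<open>s * U < 2 \<and> s > 0\<close> by simp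
    ultimately have "(cmod t)\<^sup>2 \<le> 0" by (metis mult_le_0_iff not_less zero_le_power2 less_imp_le)
    then show ?thesis unfolding t_def[symmetric] by simp
  qed
  from that[OF \<sigma>(1) w orth] show thesis by blast
qed

definition tuple_perp :: "nat \<Rightarrow> (nat \<Rightarrow> 'h::complex_inner) set \<Rightarrow> (nat \<Rightarrow> 'h) set" where
  "tuple_perp n Y = {w. \<forall>y\<in>Y. tuple_inner n w y = 0}"

lemma tuple_perp_projection_exists:
  fixes Y :: "(nat \<Rightarrow> 'h::complex_hilbert) set"
  shows "\<exists>w \<in> tuple_perp n Y. \<forall>u \<in> tuple_perp n Y. tuple_inner n (\<lambda>i. v i - w i) u = 0"
proof -
  obtain \<sigma> w where *: "\<And>m. \<sigma> m \<in> tuple_perp n Y" "\<And>i. i < n \<Longrightarrow> (\<lambda>m. \<sigma> m i) \<longlonglongrightarrow> w i"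
    "\<And>u. u \<in> tuple_perp n Y \<Longrightarrow> tuple_inner n (\<lambda>i. v i - w i) u = 0"
    by (rule tuple_projection_exists[of "tuple_perp n Y" n v])
      (auto simp: tuple_perp_def tuple_inner_add_left tuple_inner_scaleC_left tuple_inner_def[of _ "\<lambda>_. 0"])
  have "tuple_inner n w y = 0" if "y \<in> Y" for y
  proof (rule LIMSEQ_unique)
    show "(\<lambda>m. tuple_inner n (\<sigma> m) y) \<longlonglongrightarrow> tuple_inner n w y"
      using *(2) by (intro tendsto_tuple_inner tendsto_const)
    show "(\<lambda>m. tuple_inner n (\<sigma> m) y) \<longlonglongrightarrow> 0"
      using *(1) that by (simp add: tuple_perp_def)
  qed
  then show ?thesis using *(3) by (intro bexI[of _ w]) (auto simp: tuple_perp_def)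
qed

text \<open>The error of the best approximation from \<open>V\<close> annihilates \<open>V\<close>, hence \<open>f\<close>, hence itself.\<close>

lemma double_perp_subset_closure:
  fixes V :: "'h::complex_hilbert set"
  assumes "0 \<in> V" "\<And>x y. x \<in> V \<Longrightarrow> y \<in> V \<Longrightarrow> x + y \<in> V" "\<And>c x. x \<in> V \<Longrightarrow> c *\<^sub>C x \<in> V"
    and f: "\<And>y. (\<And>v. v \<in> V \<Longrightarrow> cinner v y = 0) \<Longrightarrow> cinner f y = 0"
  shows "f \<in> closure V"
proof -
  obtain \<sigma> w where *: "\<And>m. \<sigma> m \<in> {u. u 0 \<in> V}" "\<And>i. i < 1 \<Longrightarrow> (\<lambda>m. \<sigma> m i) \<longlonglongrightarrow> w i"
    "\<And>u. u \<in> {u. u 0 \<in> V} \<Longrightarrow> tuple_inner 1 (\<lambda>i. f - w i) u = 0"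
    by (rule tuple_projection_exists[of "{u. u 0 \<in> V}" 1 "\<lambda>_. f"]) (use assms in auto)
  have lim: "(\<lambda>m. \<sigma> m 0) \<longlonglongrightarrow> w 0" using *(2) by simp
  have orth: "cinner (f - w 0) v = 0" if "v \<in> V" for v
    using *(3)[of "\<lambda>_. v"] that by (simp add: tuple_inner_def)
  then have orth': "cinner v (f - w 0) = 0" if "v \<in> V" for v
    using that by (subst cinner_commute) simp
  have "cinner f (f - w 0) = 0" by (rule f) (rule orth')
  moreover have "cinner (w 0) (f - w 0) = 0"
  proof (rule LIMSEQ_unique)
    show "(\<lambda>m. cinner (\<sigma> m 0) (f - w 0)) \<longlonglongrightarrow> cinner (w 0) (f - w 0)"
      by (intro tendsto_cinner lim tendsto_const)
    show "(\<lambda>m. cinner (\<sigma> m 0) (f - w 0)) \<longlonglongrightarrow> 0" using *(1) orth' by simp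
  qed
  ultimately have "cinner (f - w 0) (f - w 0) = 0" by (simp only: cinner_diff_left diff_self)
  then have "f = w 0" by (simp add: cinner_self)
  then show ?thesis using lim *(1) by (auto simp: closure_sequential intro!: exI[of _ "\<lambda>m. \<sigma> m 0"])
qed

section \<open>Adjoints and orthogonal projections\<close>

text \<open>The representing vector is a multiple of the part of any \<open>x0\<close> with \<open>f x0 \<noteq> 0\<close> that is orthogonal to the kernel.\<close>

lemma riesz_representation:
  fixes f :: "'h::complex_hilbert \<Rightarrow> complex"
  assumes add: "\<And>x y. f (x + y) = f x + f y" and scale: "\<And>c x. f (c *\<^sub>C x) = c * f x"
    and bound: "\<And>x. cmod (f x) \<le> K * norm x"
  obtains y where "\<And>x. f x = cinner x y"
proof (cases "\<forall>x. f x = 0")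
  case True
  then show thesis using that[of 0] by simp
next
  case False
  then obtain x0 where x0: "f x0 \<noteq> 0" by blast
  have f0: "f 0 = 0" using scale[of 0 0] by simp
  obtain \<sigma> w where *: "\<And>m. \<sigma> m \<in> {u. f (u 0) = 0}" "\<And>i. i < 1 \<Longrightarrow> (\<lambda>m. \<sigma> m i) \<longlonglongrightarrow> w i"
    "\<And>u. u \<in> {u. f (u 0) = 0} \<Longrightarrow> tuple_inner 1 (\<lambda>i. x0 - w i) u = 0"
    by (rule tuple_projection_exists[of "{u. f (u 0) = 0}" 1 "\<lambda>_. x0"]) (use f0 in \<open>auto simp: add scale\<close>)
  define e where "e = x0 - w 0"
  have diff: "f (x - y) = f x - f y" for x y
    using add[of x "- y"] scale[of "-1" y] by simp
  have orth: "cinner u e = 0" if "f u = 0" for u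
    using *(3)[of "\<lambda>_. u"] that by (subst cinner_commute) (simp add: tuple_inner_def e_def)
  have "bounded_linear f"
  proof (rule bounded_linear_intro[where K = K])
    show "f (r *\<^sub>R x) = r *\<^sub>R f x" for r x
      using scale[of "of_real r" x] by (simp add: scaleC_of_real scaleR_conv_of_real)
    show "norm (f x) \<le> norm x * K" for x using bound[of x] by (simp only: mult.commute)
  qed (rule add)
  from bounded_linear.tendsto[OF this *(2)[of 0]]
  have "(\<lambda>m. f (\<sigma> m 0)) \<longlonglongrightarrow> f (w 0)" by simp
  moreover have "(\<lambda>m. f (\<sigma> m 0)) \<longlonglongrightarrow> 0" using *(1) by simp
  ultimately have "f (w 0) = 0" by (rule LIMSEQ_unique)
  then have fe: "f e \<noteq> 0" using x0 by (simp add: e_def diff)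
  then have e0: "e \<noteq> 0" using f0 by auto
  show thesis
  proof (rule that[of "(cnj (f e) / cinner e e) *\<^sub>C e"])
    fix x
    have "cinner (f e *\<^sub>C x - f x *\<^sub>C e) e = 0" by (rule orth) (simp add: diff scale)
    then have "f e * cinner x e = f x * cinner e e"
      unfolding cinner_diff_left cinner_scaleC_left by (rule eq_iff_diff_eq_0[THEN iffD2])
    moreover have "cinner e e \<noteq> 0" using e0 by (simp add: cinner_self)
    ultimately have "f x = f e / cinner e e * cinner x e" by (simp add: field_simps)
    then show "f x = cinner x ((cnj (f e) / cinner e e) *\<^sub>C e)"
      by (simp add: cinner_scaleC_right cinner_commute[of e e, symmetric])
  qed
qed

lemma cadjoint_eqI:
  assumes "\<And>x y. cinner (T x) y = cinner x (S y)" shows "cadjoint T = S"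
  unfolding cadjoint_def
proof (rule the_equality)
  fix S' assume "\<forall>x y. cinner (T x) y = cinner x (S' y)"
  then show "S' = S" using assms by (intro ext cinner_ext_right) metis
qed (use assms in blast)

lemma adjoint_exists:
  fixes T :: "'h::complex_hilbert \<Rightarrow> 'h"
  assumes T: "T \<in> bounded_ops"
  obtains S where "\<And>x y. cinner (T x) y = cinner x (S y)"
proof -
  obtain K where K: "K > 0" "\<And>x. norm (T x) \<le> K * norm x" by (rule bounded_ops_bound[OF T]) blast
  have "\<exists>z. \<forall>x. cinner (T x) y = cinner x z" for y
  proof (rule riesz_representation[of "\<lambda>x. cinner (T x) y" "K * norm y"])
    show "cmod (cinner (T x) y) \<le> K * norm y * norm x" for x
      using cinner_Cauchy_Schwarz[of "T x" y] mult_right_mono[OF K(2)[of x], of "norm y"]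
      by (simp add: mult.commute mult.left_commute)
  qed (auto simp: bounded_ops_linear[OF T] cinner_add_left cinner_scaleC_left)
  then have "\<exists>S. \<forall>y x. cinner (T x) y = cinner x (S y)" by (intro choice) blast
  then show thesis using that by blast
qed

lemma cinner_cadjoint:
  fixes T :: "'h::complex_hilbert \<Rightarrow> 'h"
  assumes "T \<in> bounded_ops" shows "cinner (T x) y = cinner x (cadjoint T y)"
proof -
  obtain S where S: "\<And>x y. cinner (T x) y = cinner x (S y)" using adjoint_exists[OF assms] by blast
  then have "cadjoint T = S" by (rule cadjoint_eqI)
  then show ?thesis by (simp only: S)
qed

lemma cinner_cadjoint_left:
  fixes T :: "'h::complex_hilbert \<Rightarrow> 'h"
  assumes "T \<in> bounded_ops" shows "cinner (cadjoint T x) y = cinner x (T y)"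
  using arg_cong[OF cinner_cadjoint[OF assms, of y x], of cnj] by (simp only: cinner_commute[symmetric])

lemma cadjoint_bounded_ops:
  fixes T :: "'h::complex_hilbert \<Rightarrow> 'h"
  assumes T: "T \<in> bounded_ops" shows "cadjoint T \<in> bounded_ops"
proof -
  obtain K where K: "K > 0" "\<And>x. norm (T x) \<le> K * norm x" by (rule bounded_ops_bound[OF T]) blast
  show ?thesis
  proof (rule bounded_opsI[where K = K])
    show "cadjoint T (x + y) = cadjoint T x + cadjoint T y" for x y
      by (rule cinner_ext) (simp add: cinner_cadjoint_left[OF T] cinner_add_left)
    show "cadjoint T (c *\<^sub>C x) = c *\<^sub>C cadjoint T x" for c x
      by (rule cinner_ext) (simp add: cinner_cadjoint_left[OF T] cinner_scaleC_left)
    fix x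
    have "(norm (cadjoint T x))\<^sup>2 = Re (cinner x (T (cadjoint T x)))"
      by (simp add: Re_cinner_self[symmetric] cinner_cadjoint_left[OF T])
    also have "\<dots> \<le> norm x * (K * norm (cadjoint T x))"
      using Re_cinner_le[of x "T (cadjoint T x)"] mult_left_mono[OF K(2), of "norm x"]
      by (meson norm_ge_zero order_trans)
    finally show "norm (cadjoint T x) \<le> norm x * K"
      using K(1) by (cases "cadjoint T x = 0") (auto simp: power2_eq_square)
  qed
qed

lemma orth_projectionD:
  fixes P :: "'h::complex_hilbert \<Rightarrow> 'h"
  assumes "orth_projection P"
  shows "P \<in> bounded_ops" "P (P h) = P h" "cinner (P h) g = cinner h (P g)"
    "h \<in> range P \<longleftrightarrow> P h = h"
proof -
  have *: "P \<in> bounded_ops" "P \<circ> P = P" "cadjoint P = P"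
    using assms unfolding orth_projection_def by blast+
  show "P \<in> bounded_ops" by (rule *)
  show idem: "P (P h) = P h" for h using fun_cong[OF *(2), of h] by simp
  show "cinner (P h) g = cinner h (P g)"
    using cinner_cadjoint[OF *(1), of h g] unfolding *(3) .
  show "h \<in> range P \<longleftrightarrow> P h = h"
  proof
    assume "h \<in> range P"
    then obtain g where "h = P g" by blast
    then show "P h = h" by (simp only: idem)
  next
    assume "P h = h"
    then show "h \<in> range P" using rangeI[of P h] by simp
  qed
qed

lemma orth_projectionI:
  fixes P :: "'h::complex_hilbert \<Rightarrow> 'h"
  assumes "P \<in> bounded_ops" "\<And>h. P (P h) = P h" "\<And>h g. cinner (P h) g = cinner h (P g)"
  shows "orth_projection P"
  unfolding orth_projection_def
proof (intro conjI)
  show "cadjoint P = P" by (rule cadjoint_eqI) (rule assms(3))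
qed (use assms(1,2) in \<open>auto simp: fun_eq_iff\<close>)

lemma orth_projection_pythagoras:
  fixes P :: "'h::complex_hilbert \<Rightarrow> 'h"
  assumes P: "orth_projection P"
  shows "(norm h)\<^sup>2 = (norm (P h))\<^sup>2 + (norm (h - P h))\<^sup>2"
proof -
  have "cinner (P h) (h - P h) = 0"
    by (simp add: cinner_diff_right orth_projectionD(2)[OF P] orth_projectionD(3)[OF P, of h])
  then show ?thesis using norm_add_sq[of "P h" "h - P h"] by simp
qed

lemma orth_projection_norm_le:
  fixes P :: "'h::complex_hilbert \<Rightarrow> 'h"
  assumes P: "orth_projection P"
  shows "norm (P h) \<le> norm h"
proof (rule power2_le_imp_le)
  show "(norm (P h))\<^sup>2 \<le> (norm h)\<^sup>2" using orth_projection_pythagoras[OF P, of h] by simp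
qed simp

section \<open>The matrix of a projection\<close>

lemma tuple_inner_sum_left:
  "tuple_inner n (\<lambda>i. \<Sum>b\<in>I. f b i) w = (\<Sum>b\<in>I. tuple_inner n (f b) w)"
  by (simp add: tuple_inner_def cinner_sum_left) (rule sum.swap)

lemma tuple_inner_cong:
  "(\<And>i. i < n \<Longrightarrow> v i = v' i) \<Longrightarrow> (\<And>i. i < n \<Longrightarrow> w i = w' i) \<Longrightarrow> tuple_inner n v w = tuple_inner n v' w'"
  by (simp add: tuple_inner_def)

definition unit_tuple :: "nat \<Rightarrow> 'h::complex_inner \<Rightarrow> nat \<Rightarrow> 'h" where
  "unit_tuple b h = (\<lambda>i. if i = b then h else 0)"

lemma tuple_inner_unit_tuple:
  "b < n \<Longrightarrow> tuple_inner n v (unit_tuple b h) = cinner (v b) h"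
  "b < n \<Longrightarrow> tuple_inner n (unit_tuple b h) v = cinner h (v b)"
  by (simp_all add: tuple_inner_def unit_tuple_def if_distrib[of "cinner _"] if_distrib[of "\<lambda>x. cinner x _"] cong: if_cong)

lemma sum_unit_tuple: "i < n \<Longrightarrow> (\<Sum>b<n. unit_tuple b (v b) i) = v i"
  by (simp add: unit_tuple_def)

text \<open>The operators \<open>q a b\<close> are the entries of the orthogonal projection onto \<open>tuple_perp n Y\<close> in the direct sum
  of \<open>n\<close> copies of the Hilbert space.  Working with the entries keeps everything on the space itself, for any \<open>n\<close>.\<close>

locale projection_matrix =
  fixes n :: nat and Y :: "(nat \<Rightarrow> 'h::complex_hilbert) set" and q :: "nat \<Rightarrow> nat \<Rightarrow> 'h \<Rightarrow> 'h"
  assumes q_bounded: "q a b \<in> bounded_ops"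
    and q_hermitian: "a < n \<Longrightarrow> b < n \<Longrightarrow> cinner (q a b h) g = cinner h (q b a g)"
    and q_into: "(\<lambda>k. \<Sum>b<n. q k b (v b)) \<in> tuple_perp n Y"
    and q_fix: "v \<in> tuple_perp n Y \<Longrightarrow> k < n \<Longrightarrow> (\<Sum>b<n. q k b (v b)) = v k"

lemma projection_matrix_exists:
  fixes Y :: "(nat \<Rightarrow> 'h::complex_hilbert) set"
  shows "\<exists>q. projection_matrix n Y q"
proof -
  let ?K = "tuple_perp n Y"
  obtain p where pK: "\<And>v. p v \<in> ?K"
    and p_orth: "\<And>v u. u \<in> ?K \<Longrightarrow> tuple_inner n (\<lambda>i. v i - p v i) u = 0"
    using tuple_perp_projection_exists[of n Y] by metis
  have uniq: "p v i = w i" if w: "w \<in> ?K" "\<And>u. u \<in> ?K \<Longrightarrow> tuple_inner n (\<lambda>i. v i - w i) u = 0" and i: "i < n" for v w i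
  proof -
    let ?d = "\<lambda>i. p v i - w i"
    have d: "?d \<in> ?K" using w(1) pK[of v] by (simp add: tuple_perp_def tuple_inner_diff_left)
    have "tuple_inner n ?d ?d = 0"
      using w(2)[OF d] p_orth[OF d, of v] by (simp only: tuple_inner_diff_left) simp
    then show ?thesis using i by (simp add: tuple_inner_self tuple_norm2_eq_0_iff)
  qed
  have p_add: "p (\<lambda>i. u i + v i) k = p u k + p v k" if "k < n" for u v k
  proof (rule uniq[OF _ _ that])
    show "(\<lambda>i. p u i + p v i) \<in> ?K" using pK[of u] pK[of v] by (simp add: tuple_perp_def tuple_inner_add_left)
    fix w assume "w \<in> ?K"
    then show "tuple_inner n (\<lambda>i. u i + v i - (p u i + p v i)) w = 0"
      using p_orth[of w u] p_orth[of w v] by (simp only: tuple_inner_diff_left tuple_inner_add_left) simp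
  qed
  have p_scale: "p (\<lambda>i. c *\<^sub>C v i) k = c *\<^sub>C p v k" if "k < n" for c v k
  proof (rule uniq[OF _ _ that])
    show "(\<lambda>i. c *\<^sub>C p v i) \<in> ?K" using pK[of v] by (simp add: tuple_perp_def tuple_inner_scaleC_left)
    fix w assume "w \<in> ?K"
    then show "tuple_inner n (\<lambda>i. c *\<^sub>C v i - c *\<^sub>C p v i) w = 0"
      using p_orth[of w v] by (simp add: tuple_inner_diff_left tuple_inner_scaleC_left)
  qed
  have p_sa: "tuple_inner n (p v) u = tuple_inner n v (p u)" for u v
  proof -
    have "tuple_inner n v (p u) = tuple_inner n (p v) (p u)"
      using p_orth[OF pK, of v u] by (simp add: tuple_inner_diff_left)
    moreover have "tuple_inner n u (p v) = tuple_inner n (p u) (p v)"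
      using p_orth[OF pK, of u v] by (simp add: tuple_inner_diff_left)
    ultimately show ?thesis
      using tuple_inner_commute[of n "p v" u] tuple_inner_commute[of n "p v" "p u"] by simp
  qed
  have p_norm: "tuple_norm2 n (p v) \<le> tuple_norm2 n v" for v
  proof -
    have *: "tuple_inner n v (p v) = tuple_inner n (p v) (p v)"
      using p_orth[OF pK, of v v] by (simp add: tuple_inner_diff_left)
    have "0 \<le> tuple_norm2 n (\<lambda>i. v i - p v i)" by simp
    also have "\<dots> = tuple_norm2 n v - tuple_norm2 n (p v)"
      unfolding tuple_norm2_diff * tuple_inner_self by simp
    finally show ?thesis by simp
  qed
  have unit_add: "unit_tuple b (x + y) = (\<lambda>i. unit_tuple b x i + unit_tuple b y i)"
    and unit_scale: "unit_tuple b (c *\<^sub>C x) = (\<lambda>i. c *\<^sub>C unit_tuple b x i)" for b c and x y :: 'h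
    by (auto simp: unit_tuple_def)
  define q where "q a b h = (if a < n \<and> b < n then p (unit_tuple b h) a else 0)" for a b h
  have "projection_matrix n Y q"
  proof
    fix a b
    show "q a b \<in> bounded_ops"
    proof (cases "a < n \<and> b < n")
      case True
      show ?thesis
      proof (rule bounded_opsI[where K = 1])
        fix x
        have "(norm (q a b x))\<^sup>2 \<le> tuple_norm2 n (unit_tuple b x)"
          using norm_sq_le_tuple_norm2[of a n "p (unit_tuple b x)"] p_norm[of "unit_tuple b x"] True
          by (simp add: q_def)
        also have "\<dots> = (norm x)\<^sup>2"
        proof -
          have "complex_of_real (tuple_norm2 n (unit_tuple b x)) = cinner (unit_tuple b x b) x"
            using tuple_inner_self[of n "unit_tuple b x"] True by (simp add: tuple_inner_unit_tuple)
          then have "complex_of_real (tuple_norm2 n (unit_tuple b x)) = of_real ((norm x)\<^sup>2)"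
            unfolding unit_tuple_def by (simp only: if_True cinner_self refl)
          then show ?thesis by (simp only: of_real_eq_iff)
        qed
        finally show "norm (q a b x) \<le> norm x * 1" using power2_le_imp_le by auto
      qed (use True in \<open>simp_all add: q_def unit_add p_add unit_scale p_scale\<close>)
    next
      case False
      then have "q a b = (\<lambda>_. 0)" unfolding q_def by auto
      then show ?thesis using bounded_ops_zero by metis
    qed
    show "cinner (q a b h) g = cinner h (q b a g)" if "a < n" "b < n" for h g
      using p_sa[of "unit_tuple b h" "unit_tuple a g"] that
      by (simp add: q_def tuple_inner_unit_tuple)
  next
    fix v
    let ?Qv = "\<lambda>k. \<Sum>b<n. q k b (v b)"
    have Qv_inner: "tuple_inner n ?Qv u = (\<Sum>b<n. tuple_inner n (p (unit_tuple b (v b))) u)" for u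
      unfolding tuple_inner_sum_left by (intro sum.cong refl tuple_inner_cong) (auto simp: q_def)
    show into: "?Qv \<in> ?K" using pK unfolding tuple_perp_def by (simp add: Qv_inner)
    have v_inner: "tuple_inner n v u = (\<Sum>b<n. tuple_inner n (unit_tuple b (v b)) u)" for u
      unfolding tuple_inner_sum_left[symmetric] by (rule tuple_inner_cong) (auto simp: sum_unit_tuple)
    have orth: "tuple_inner n (\<lambda>i. v i - ?Qv i) u = 0" if "u \<in> ?K" for u
      unfolding tuple_inner_diff_left Qv_inner v_inner sum_subtractf[symmetric]
      using p_orth[OF that] by (intro sum.neutral) (auto simp: tuple_inner_diff_left)
    show "?Qv k = v k" if "v \<in> ?K" "k < n" for k
    proof -
      have "p v k = ?Qv k" by (rule uniq[OF into orth that(2)])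
      moreover have "p v k = v k"
        by (rule uniq[OF that(1) _ that(2)]) (simp add: tuple_inner_def)
      ultimately show ?thesis by simp
    qed
  qed
  then show ?thesis by blast
qed

context projection_matrix
begin

definition proj :: "(nat \<Rightarrow> 'h) \<Rightarrow> nat \<Rightarrow> 'h" where
  "proj v = (\<lambda>k. \<Sum>b<n. q k b (v b))"

lemma proj_in: "proj v \<in> tuple_perp n Y"
  unfolding proj_def by (rule q_into)

lemma proj_fix: "v \<in> tuple_perp n Y \<Longrightarrow> k < n \<Longrightarrow> proj v k = v k"
  unfolding proj_def by (rule q_fix)

lemma proj_selfadjoint: "tuple_inner n (proj v) w = tuple_inner n v (proj w)"
proof -
  have "tuple_inner n (proj v) w = (\<Sum>i<n. \<Sum>b<n. cinner (v b) (q b i (w i)))"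
    unfolding tuple_inner_def proj_def by (simp add: cinner_sum_left q_hermitian)
  also have "\<dots> = tuple_inner n v (proj w)"
    unfolding tuple_inner_def proj_def by (subst sum.swap) (simp add: cinner_sum_right)
  finally show ?thesis .
qed

lemma proj_unit_tuple: "b < n \<Longrightarrow> proj (unit_tuple b h) k = q k b h"
  by (simp add: proj_def unit_tuple_def if_distrib[of "q _ _"] bounded_ops_linear(4)[OF q_bounded] cong: if_cong)

text \<open>An operator that reduces the subspace commutes with the projection: \<open>PSP = SP\<close> by the invariance under \<open>S\<close>, and
  \<open>PSP = PS\<close> by the one under its adjoint.\<close>

lemma q_commute:
  assumes S: "S \<in> bounded_ops"
    and inv: "\<And>v. v \<in> tuple_perp n Y \<Longrightarrow> (\<lambda>i. S (v i)) \<in> tuple_perp n Y"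
    and inv': "\<And>v. v \<in> tuple_perp n Y \<Longrightarrow> (\<lambda>i. cadjoint S (v i)) \<in> tuple_perp n Y"
    and ab: "a < n" "b < n"
  shows "S (q a b h) = q a b (S h)"
proof (rule cinner_ext)
  fix g :: 'h
  let ?e = "unit_tuple b h" and ?f = "unit_tuple a g"
  have S0: "S 0 = 0" by (rule bounded_ops_linear(4)[OF S])
  have Se: "(\<lambda>i. S (?e i)) = unit_tuple b (S h)" by (auto simp: unit_tuple_def S0)
  have adj: "tuple_inner n (\<lambda>i. S (v i)) w = tuple_inner n v (\<lambda>i. cadjoint S (w i))" for v w
    by (simp add: tuple_inner_def cinner_cadjoint[OF S])
  have "cinner (q a b (S h)) g = tuple_inner n (proj (\<lambda>i. S (?e i))) ?f"
    by (simp add: Se tuple_inner_unit_tuple ab proj_unit_tuple)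
  also have "\<dots> = tuple_inner n (\<lambda>i. S (?e i)) (proj ?f)" by (rule proj_selfadjoint)
  also have "\<dots> = tuple_inner n ?e (\<lambda>i. cadjoint S (proj ?f i))" by (rule adj)
  also have "\<dots> = tuple_inner n ?e (proj (\<lambda>i. cadjoint S (proj ?f i)))"
    by (rule tuple_inner_cong) (auto simp: proj_fix[OF inv'[OF proj_in]])
  also have "\<dots> = tuple_inner n (\<lambda>i. S (proj ?e i)) (proj ?f)"
    by (simp add: proj_selfadjoint[symmetric] adj)
  also have "\<dots> = tuple_inner n (proj (\<lambda>i. S (proj ?e i))) ?f" by (rule proj_selfadjoint[symmetric])
  also have "\<dots> = tuple_inner n (\<lambda>i. S (proj ?e i)) ?f"
    by (rule tuple_inner_cong) (auto simp: proj_fix[OF inv[OF proj_in]])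
  also have "\<dots> = cinner (S (q a b h)) g" by (simp add: tuple_inner_unit_tuple ab proj_unit_tuple)
  finally show "cinner (S (q a b h)) g = cinner (q a b (S h)) g" by simp
qed

end

lemma perp_projection:
  fixes Y :: "'h::complex_hilbert set"
  obtains P where "orth_projection P" "\<And>h. P h = h \<longleftrightarrow> (\<forall>y\<in>Y. cinner h y = 0)"
    "\<And>S h. S \<in> bounded_ops \<Longrightarrow> (\<And>h. P h = h \<Longrightarrow> P (S h) = S h) \<Longrightarrow>
      (\<And>h. P h = h \<Longrightarrow> P (cadjoint S h) = cadjoint S h) \<Longrightarrow> S (P h) = P (S h)"
proof -
  let ?Y = "(\<lambda>y _. y) ` Y :: (nat \<Rightarrow> 'h) set"
  obtain q where "projection_matrix 1 ?Y q" using projection_matrix_exists by blast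
  then interpret projection_matrix 1 ?Y q .
  have perp: "v \<in> tuple_perp 1 ?Y \<longleftrightarrow> (\<forall>y\<in>Y. cinner (v 0) y = 0)" for v
    by (auto simp: tuple_perp_def tuple_inner_def)
  have range_iff: "q 0 0 h = h \<longleftrightarrow> (\<forall>y\<in>Y. cinner h y = 0)" for h
  proof
    assume "q 0 0 h = h"
    then show "\<forall>y\<in>Y. cinner h y = 0" using q_into[of "\<lambda>_. h"] by (simp add: perp[simplified])
  next
    assume "\<forall>y\<in>Y. cinner h y = 0"
    then show "q 0 0 h = h" using q_fix[of "\<lambda>_. h" 0] by (simp add: perp[simplified])
  qed
  show thesis
  proof (rule that[of "q 0 0"])
    show "orth_projection (q 0 0)"
    proof (rule orth_projectionI)
      show "q 0 0 (q 0 0 h) = q 0 0 h" for h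
        unfolding range_iff using q_into[of "\<lambda>_. h"] by (simp add: perp[simplified])
    qed (auto simp: q_bounded q_hermitian)
    show "S (q 0 0 h) = q 0 0 (S h)" if "S \<in> bounded_ops" "\<And>h. q 0 0 h = h \<Longrightarrow> q 0 0 (S h) = S h"
      "\<And>h. q 0 0 h = h \<Longrightarrow> q 0 0 (cadjoint S h) = cadjoint S h" for S h
      by (rule q_commute[OF that(1)]) (use that(2,3) in \<open>auto simp: perp[simplified] range_iff\<close>)
  qed (rule range_iff)
qed

section \<open>Square roots and spectral projections\<close>

text \<open>The fixed point \<open>z\<close> of \<open>t \<mapsto> (a + t\<^sup>2) / 2\<close> makes \<open>1 - z\<close> a square root of \<open>1 - a\<close>.  The iteration is not a
  uniform contraction when \<open>norm a = 1\<close>, but its increments are dominated by those of the scalar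
  iteration for \<open>a = 1\<close>, which increases and is bounded by 1.  The square root is reached within any closed set
  \<open>C\<close> that the iteration preserves, so it inherits symmetry and commutation properties.  The equation
  for \<open>z\<close> makes sense without a unit, and the product is a parameter, so that the lemma applies to C*-algebras
  and to operators alike.\<close>

lemma square_root_iteration:
  fixes mul :: "'b::banach \<Rightarrow> 'b \<Rightarrow> 'b"
  assumes mul: "bounded_bilinear mul" and submult: "\<And>x y. norm (mul x y) \<le> norm x * norm y"
    and a: "norm a \<le> 1"
    and C: "closed C" "0 \<in> C" "\<And>z. z \<in> C \<Longrightarrow> (1/2) *\<^sub>R (a + mul z z) \<in> C"
  obtains z where "z \<in> C" "norm z \<le> 1" "2 *\<^sub>R z = a + mul z z"
proof -
  interpret bounded_bilinear mul by (rule mul)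
  define step where "step x = (1/2) *\<^sub>R (a + mul x x)" for x
  define s :: "nat \<Rightarrow> real" where "s k = ((\<lambda>t. (1 + t\<^sup>2) / 2) ^^ k) 0" for k
  define z where "z k = (step ^^ k) 0" for k
  have s_Suc: "s (Suc k) = (1 + (s k)\<^sup>2) / 2" and z_Suc: "z (Suc k) = step (z k)" for k
    by (simp_all add: s_def z_def)
  have s01: "0 \<le> s k \<and> s k \<le> 1" for k
  proof (induction k)
    case (Suc k)
    then have "(s k)\<^sup>2 \<le> 1" by (simp add: power_le_one)
    then show ?case by (simp add: s_Suc)
  qed (simp add: s_def)
  have s_mono: "s k \<le> s (Suc k)" for k
    using zero_le_power2[of "s k - 1"] by (simp add: s_Suc power2_diff)
  have zs: "norm (z k) \<le> s k" for k
  proof (induction k)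
    case (Suc k)
    have "norm (mul (z k) (z k)) \<le> s k * s k"
      using submult[of "z k" "z k"] mult_mono[OF Suc Suc] s01[of k] by fastforce
    then show ?case unfolding z_Suc s_Suc step_def
      using a norm_triangle_ineq[of a "mul (z k) (z k)"] by (simp add: power2_eq_square)
  qed (simp add: z_def s_def)
  have incr: "norm (z (Suc k) - z k) \<le> s (Suc k) - s k" for k
  proof (induction k)
    case 0
    then show ?case using a by (simp add: z_def s_def step_def zero_left)
  next
    case (Suc k)
    let ?x = "z (Suc k)" and ?y = "z k"
    have "mul ?x ?x - mul ?y ?y = mul ?x (?x - ?y) + mul (?x - ?y) ?y"
      by (simp add: diff_left diff_right)
    then have "norm (mul ?x ?x - mul ?y ?y) \<le> norm ?x * norm (?x - ?y) + norm (?x - ?y) * norm ?y"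
      using submult[of ?x "?x - ?y"] submult[of "?x - ?y" ?y]
        norm_triangle_ineq[of "mul ?x (?x - ?y)" "mul (?x - ?y) ?y"] by simp
    also have "\<dots> \<le> s (Suc k) * (s (Suc k) - s k) + (s (Suc k) - s k) * s k"
      using Suc zs[of k] zs[of "Suc k"] s01 s_mono[of k] by (intro add_mono mult_mono) auto
    finally have *: "norm (mul ?x ?x - mul ?y ?y) \<le> (s (Suc k))\<^sup>2 - (s k)\<^sup>2"
      by (simp add: algebra_simps power2_eq_square)
    have "z (Suc (Suc k)) - z (Suc k) = (1/2) *\<^sub>R (mul ?x ?x - mul ?y ?y)"
      unfolding z_Suc[of "Suc k"] z_Suc[of k] step_def scaleR_right_diff_distrib[symmetric]
      by (simp add: z_Suc[of k, unfolded step_def, symmetric])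
    then have "norm (z (Suc (Suc k)) - z (Suc k)) = norm (mul ?x ?x - mul ?y ?y) / 2" by simp
    also have "\<dots> \<le> s (Suc (Suc k)) - s (Suc k)"
    proof -
      have half: "N / 2 \<le> t - r" if "N \<le> X - W" "t = (1 + X) / 2" "r = (1 + W) / 2" for N X W t r :: real
        using that by simp
      show ?thesis by (rule half[OF * s_Suc s_Suc])
    qed
    finally show ?case .
  qed
  have incseq_s: "incseq s" using s_mono by (intro incseq_SucI)
  have dist_z: "norm (z n - z m) \<le> s n - s m" if "m \<le> n" for m n
    using that
  proof (induction n rule: dec_induct)
    case (step k)
    have "norm (z (Suc k) - z m) \<le> norm (z (Suc k) - z k) + norm (z k - z m)"
      using norm_triangle_ineq[of "z (Suc k) - z k" "z k - z m"] by simp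
    then show ?case using step.IH incr[of k] by linarith
  qed simp
  have "convergent s"
  proof (rule Bseq_mono_convergent)
    show "Bseq s" using s01 by (intro BseqI'[of _ 1]) auto
  qed (use incseqD[OF incseq_s] in blast)
  then have Cs: "Cauchy s" by (rule convergent_Cauchy)
  have "Cauchy z"
  proof (rule metric_CauchyI)
    fix e :: real assume "e > 0"
    then obtain M where M: "\<And>m n. m \<ge> M \<Longrightarrow> n \<ge> M \<Longrightarrow> dist (s m) (s n) < e"
      using metric_CauchyD[OF Cs] by blast
    have "dist (z m) (z n) < e" if "m \<ge> M" "n \<ge> M" for m n
    proof (cases "m \<le> n")
      case True
      then show ?thesis using dist_z[OF True] M[OF that] by (simp add: dist_norm norm_minus_commute dist_real_def)
    next
      case False
      then show ?thesis using dist_z[of n m] M[OF that] by (simp add: dist_norm dist_real_def)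
    qed
    then show "\<exists>M. \<forall>m\<ge>M. \<forall>n\<ge>M. dist (z m) (z n) < e" by blast
  qed
  then obtain l where l: "z \<longlonglongrightarrow> l" using Cauchy_convergent convergent_def by blast
  have zC: "z k \<in> C" for k by (induction k) (auto simp: z_Suc step_def C(3), simp add: z_def C(2))
  show thesis
  proof (rule that)
    show "l \<in> C" using closed_sequentially[OF C(1) zC l] .
    show "norm l \<le> 1"
      by (rule LIMSEQ_le_const2[OF tendsto_norm[OF l]]) (use zs s01 order_trans in blast)
    have "(\<lambda>k. 2 *\<^sub>R z (Suc k)) \<longlonglongrightarrow> 2 *\<^sub>R l" by (intro tendsto_scaleR tendsto_const LIMSEQ_Suc l)
    moreover have "(\<lambda>k. 2 *\<^sub>R z (Suc k)) \<longlonglongrightarrow> a + mul l l"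
      unfolding z_Suc step_def by (simp, intro tendsto_add tendsto_const tendsto l)
    ultimately show "2 *\<^sub>R l = a + mul l l" by (rule LIMSEQ_unique)
  qed
qed

text \<open>The operator \<open>A\<close> is \<open>1 - z\<close> where \<open>z\<close> is the fixed point of the iteration for \<open>a = 1 - T\<^sup>2\<close>, a contraction; the
  closed set consists of the self-adjoint operators that commute with everything that commutes with \<open>T\<close>.\<close>

lemma absolute_value_exists:
  fixes T :: "'h::complex_hilbert \<Rightarrow> 'h"
  assumes T: "T \<in> bounded_ops" and sa: "\<And>x y. cinner (T x) y = cinner x (T y)"
    and contr: "\<And>x. norm (T x) \<le> norm x"
  obtains A where "A \<in> bounded_ops" "\<And>x. A (A x) = T (T x)" "\<And>x. Re (cinner (A x) x) \<ge> 0"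
    "\<And>x y. cinner (A x) y = cinner x (A y)"
    "\<And>S x. S \<in> bounded_ops \<Longrightarrow> (\<And>x. S (T x) = T (S x)) \<Longrightarrow> S (A x) = A (S x)"
proof -
  define a where "a = Blinfun (\<lambda>x. x - T (T x))"
  have "(\<lambda>x. x - T (T x)) \<in> bounded_ops" by (rule bounded_ops_diff[OF bounded_ops_ident bounded_ops_compose[OF T T]])
  then have bl: "bounded_linear (\<lambda>x. x - T (T x))" by (rule bounded_ops_linear(8))
  have a_apply: "blinfun_apply a x = x - T (T x)" for x
    unfolding a_def by (simp add: bounded_linear_Blinfun_apply[OF bl])
  have norm_a: "norm a \<le> 1"
  proof (rule norm_blinfun_bound)
    fix x
    have "(norm (x - T (T x)))\<^sup>2 = (norm x)\<^sup>2 - 2 * (norm (T x))\<^sup>2 + (norm (T (T x)))\<^sup>2"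
      unfolding norm_diff_sq by (simp add: sa[symmetric] cinner_self)
    also have "\<dots> \<le> (norm x)\<^sup>2"
      using power_mono[OF contr[of "T x"] norm_ge_zero, of 2] zero_le_power2[of "norm (T x)"] by linarith
    finally have "norm (x - T (T x)) \<le> norm x" by (rule power2_le_imp_le) simp
    then show "norm (blinfun_apply a x) \<le> 1 * norm x" by (simp add: a_apply)
  qed simp
  define C where "C = {Z :: 'h \<Rightarrow>\<^sub>L 'h. (\<forall>c x. blinfun_apply Z (c *\<^sub>C x) = c *\<^sub>C blinfun_apply Z x) \<and>
     (\<forall>x y. cinner (blinfun_apply Z x) y = cinner x (blinfun_apply Z y)) \<and>
     (\<forall>S\<in>bounded_ops. (\<forall>x. S (T x) = T (S x)) \<longrightarrow> (\<forall>x. S (blinfun_apply Z x) = blinfun_apply Z (S x)))}"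
  have bl_scaleC: "bounded_linear (\<lambda>x::'h. c *\<^sub>C x)" for c
    using bounded_ops_linear(8)[OF bounded_ops_scaleC[OF bounded_ops_ident]] .
  have lim: "(\<lambda>k. blinfun_apply (f k) x) \<longlonglongrightarrow> blinfun_apply Z x" if "f \<longlonglongrightarrow> Z" for f and Z :: "'h \<Rightarrow>\<^sub>L 'h" and x
    using that by (intro tendsto_intros)
  have "closed C"
    unfolding closed_sequential_limits
  proof (intro allI impI, elim conjE)
    fix f :: "nat \<Rightarrow> 'h \<Rightarrow>\<^sub>L 'h" and Z assume fC: "\<forall>k. f k \<in> C" and fZ: "f \<longlonglongrightarrow> Z"
    note lz = lim[OF fZ]
    show "Z \<in> C" unfolding C_def
    proof (intro CollectI conjI allI ballI impI)
      fix c x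
      have "(\<lambda>k. blinfun_apply (f k) (c *\<^sub>C x)) \<longlonglongrightarrow> c *\<^sub>C blinfun_apply Z x"
        using bounded_linear.tendsto[OF bl_scaleC lz[of x], of c] fC by (simp add: C_def)
      then show "blinfun_apply Z (c *\<^sub>C x) = c *\<^sub>C blinfun_apply Z x" by (rule LIMSEQ_unique[OF lz])
    next
      fix x y
      have "(\<lambda>k. cinner (blinfun_apply (f k) x) y) \<longlonglongrightarrow> cinner x (blinfun_apply Z y)"
        using tendsto_cinner[OF tendsto_const[of x] lz[of y]] fC by (simp add: C_def)
      then show "cinner (blinfun_apply Z x) y = cinner x (blinfun_apply Z y)"
        by (rule LIMSEQ_unique[OF tendsto_cinner[OF lz tendsto_const]])
    next
      fix S x assume S: "S \<in> bounded_ops" "\<forall>x. S (T x) = T (S x)"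
      have "(\<lambda>k. blinfun_apply (f k) (S x)) \<longlonglongrightarrow> S (blinfun_apply Z x)"
        using tendsto_bounded_ops[OF S(1) lz[of x]] fC S by (simp add: C_def)
      then show "S (blinfun_apply Z x) = blinfun_apply Z (S x)" by (rule LIMSEQ_unique[OF _ lz])
    qed
  qed
  moreover have "0 \<in> C" unfolding C_def by (auto simp: bounded_ops_linear)
  moreover have "(1/2) *\<^sub>R (a + (Z o\<^sub>L Z)) \<in> C" if "Z \<in> C" for Z
  proof -
    have Z: "\<And>c x. blinfun_apply Z (c *\<^sub>C x) = c *\<^sub>C blinfun_apply Z x"
      "\<And>x y. cinner (blinfun_apply Z x) y = cinner x (blinfun_apply Z y)"
      "\<And>S x. S \<in> bounded_ops \<Longrightarrow> \<forall>x. S (T x) = T (S x) \<Longrightarrow> S (blinfun_apply Z x) = blinfun_apply Z (S x)"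
      using that by (auto simp: C_def)
    have ev: "blinfun_apply ((1/2) *\<^sub>R (a + (Z o\<^sub>L Z))) x = (1/2) *\<^sub>R (x - T (T x) + blinfun_apply Z (blinfun_apply Z x))" for x
      by (simp add: blinfun.bilinear_simps a_apply)
    have sc: "(1/2) *\<^sub>R (c *\<^sub>C x) = c *\<^sub>C ((1/2) *\<^sub>R x)" for c and x :: 'h
      by (simp only: scaleC_of_real[symmetric] scaleC_scaleC mult.commute)
    show ?thesis unfolding C_def mem_Collect_eq ev
    proof (intro conjI allI ballI impI)
      show "(1/2) *\<^sub>R (c *\<^sub>C x - T (T (c *\<^sub>C x)) + blinfun_apply Z (blinfun_apply Z (c *\<^sub>C x)))
          = c *\<^sub>C (1/2) *\<^sub>R (x - T (T x) + blinfun_apply Z (blinfun_apply Z x))" for c x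
        by (simp only: Z(1) bounded_ops_linear(3)[OF T] scaleC_diff_right[symmetric] scaleC_add_right[symmetric] sc)
      show "cinner ((1/2) *\<^sub>R (x - T (T x) + blinfun_apply Z (blinfun_apply Z x))) y
          = cinner x ((1/2) *\<^sub>R (y - T (T y) + blinfun_apply Z (blinfun_apply Z y)))" for x y
        by (simp only: cinner_scaleR_left cinner_scaleR_right cinner_expand sa Z(2))
      show "S ((1/2) *\<^sub>R (x - T (T x) + blinfun_apply Z (blinfun_apply Z x)))
          = (1/2) *\<^sub>R (S x - T (T (S x)) + blinfun_apply Z (blinfun_apply Z (S x)))"
        if "S \<in> bounded_ops" "\<forall>x. S (T x) = T (S x)" for S x
        by (simp only: bounded_ops_linear(1,2,6)[OF that(1)] that(2)[rule_format] Z(3)[OF that])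
    qed
  qed
  ultimately obtain Z where ZC: "Z \<in> C" and nZ: "norm Z \<le> 1" and eq: "2 *\<^sub>R Z = a + (Z o\<^sub>L Z)"
    using square_root_iteration[OF bounded_bilinear_blinfun_compose norm_blinfun_compose norm_a, of C] by blast
  have Z: "\<And>c x. blinfun_apply Z (c *\<^sub>C x) = c *\<^sub>C blinfun_apply Z x"
    "\<And>x y. cinner (blinfun_apply Z x) y = cinner x (blinfun_apply Z y)"
    "\<And>S x. S \<in> bounded_ops \<Longrightarrow> \<forall>x. S (T x) = T (S x) \<Longrightarrow> S (blinfun_apply Z x) = blinfun_apply Z (S x)"
    using ZC by (auto simp: C_def)
  define A where "A x = x - blinfun_apply Z x" for x
  have Zb: "blinfun_apply Z \<in> bounded_ops"
    using Z(1) by (auto simp: bounded_ops_def blinfun.bounded_linear_right)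
  show thesis
  proof (rule that[of A])
    show "A \<in> bounded_ops" unfolding A_def by (intro bounded_ops_diff bounded_ops_ident Zb)
    show "A (A x) = T (T x)" for x
    proof -
      have "2 *\<^sub>R blinfun_apply Z x = x - T (T x) + blinfun_apply Z (blinfun_apply Z x)"
        using arg_cong[OF eq, of "\<lambda>Z. blinfun_apply Z x"] by (simp add: blinfun.bilinear_simps a_apply)
      then show ?thesis unfolding A_def by (simp add: blinfun.bilinear_simps scaleR_2 algebra_simps)
    qed
    show "Re (cinner (A x) x) \<ge> 0" for x
    proof -
      have "norm (blinfun_apply Z x) \<le> norm x"
        using norm_blinfun[of Z x] nZ mult_right_mono[of "norm Z" 1 "norm x"] by simp
      then have "Re (cinner (blinfun_apply Z x) x) \<le> norm x * norm x"
        using Re_cinner_le[of "blinfun_apply Z x" x] mult_right_mono[of _ "norm x" "norm x"] by fastforce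
      then show ?thesis unfolding A_def by (simp add: cinner_diff_left cinner_self power2_eq_square)
    qed
    show "cinner (A x) y = cinner x (A y)" for x y by (simp add: A_def cinner_expand Z(2))
    show "S (A x) = A (S x)" if "S \<in> bounded_ops" "\<And>x. S (T x) = T (S x)" for S x
      using that by (simp add: A_def bounded_ops_linear(2)[OF that(1)] Z(3))
  qed
qed

text \<open>Scale \<open>m - r\<close> to a contraction \<open>T\<close> with absolute value \<open>A\<close> and let \<open>E\<close> project onto the kernel of \<open>A - T\<close>.
  There \<open>T = A \<ge> 0\<close>; and since \<open>(A - T) (A + T) = 0\<close>, the orthogonal complement of this kernel is annihilated by \<open>A + T\<close>, so
  \<open>T = - A \<le> 0\<close> there.\<close>

lemma spectral_projection_exists:
  fixes m :: "'h::complex_hilbert \<Rightarrow> 'h" and r :: real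
  assumes m: "m \<in> bounded_ops" and sa: "\<And>x y. cinner (m x) y = cinner x (m y)"
  obtains E where "orth_projection E"
    "\<And>S h. S \<in> bounded_ops \<Longrightarrow> (\<And>x. S (m x) = m (S x)) \<Longrightarrow> S (E h) = E (S h)"
    "\<And>h. E h = h \<Longrightarrow> r * (norm h)\<^sup>2 \<le> Re (cinner (m h) h)"
    "\<And>h. E h = 0 \<Longrightarrow> Re (cinner (m h) h) \<le> r * (norm h)\<^sup>2"
proof -
  define U where "U x = m x - of_real r *\<^sub>C x" for x
  have U: "U \<in> bounded_ops" unfolding U_def
    by (intro bounded_ops_diff m bounded_ops_scaleC[OF bounded_ops_ident])
  obtain K where K: "K > 0" "\<And>x. norm (U x) \<le> K * norm x" by (rule bounded_ops_bound[OF U]) blast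
  define T where "T x = of_real (1 / K) *\<^sub>C U x" for x
  have T: "T \<in> bounded_ops" unfolding T_def by (intro bounded_ops_scaleC U)
  have Tsa: "cinner (T x) y = cinner x (T y)" for x y
    by (simp add: T_def U_def cinner_scaleC_left cinner_scaleC_right cinner_diff_left cinner_diff_right sa)
  have "norm (T x) \<le> norm x" for x
    using K(2)[of x] K(1) by (simp add: T_def norm_scaleC norm_divide field_simps)
  then obtain A where A: "A \<in> bounded_ops" "\<And>x. A (A x) = T (T x)" "\<And>x. Re (cinner (A x) x) \<ge> 0"
    "\<And>x y. cinner (A x) y = cinner x (A y)"
    "\<And>S x. S \<in> bounded_ops \<Longrightarrow> (\<And>x. S (T x) = T (S x)) \<Longrightarrow> S (A x) = A (S x)"
    using absolute_value_exists[OF T Tsa] by blast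
  have commT: "S (T x) = T (S x)" if "S \<in> bounded_ops" "\<And>x. S (m x) = m (S x)" for S x
    by (simp add: T_def U_def bounded_ops_linear[OF that(1)] that(2))
  obtain E where E: "orth_projection E" "\<And>h. E h = h \<longleftrightarrow> (\<forall>y\<in>range (\<lambda>g. A g - T g). cinner h y = 0)"
    "\<And>S h. S \<in> bounded_ops \<Longrightarrow> (\<And>h. E h = h \<Longrightarrow> E (S h) = S h) \<Longrightarrow>
      (\<And>h. E h = h \<Longrightarrow> E (cadjoint S h) = cadjoint S h) \<Longrightarrow> S (E h) = E (S h)"
    by (rule perp_projection) blast
  have E_iff: "E h = h \<longleftrightarrow> A h = T h" for h
  proof -
    have "E h = h \<longleftrightarrow> (\<forall>g. cinner (A h - T h) g = 0)"
      unfolding E(2) by (simp add: cinner_diff_left cinner_diff_right A(4) Tsa)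
    also have "\<dots> \<longleftrightarrow> A h = T h" using cinner_eq_0_imp[of "A h - T h"] by auto
    finally show ?thesis .
  qed
  have Re_T: "Re (cinner (T h) h) = (Re (cinner (m h) h) - r * (norm h)\<^sup>2) / K" for h
    by (simp add: T_def U_def cinner_scaleC_left cinner_diff_left cinner_self diff_divide_distrib)
  have TA: "T (A x) = A (T x)" for x using A(5)[OF T] by simp
  show thesis
  proof (rule that[OF E(1)])
    fix S h assume S: "S \<in> bounded_ops" and comm: "\<And>x. S (m x) = m (S x)"
    have adj_comm: "cadjoint S (m x) = m (cadjoint S x)" for x
      by (rule cinner_ext) (simp add: cinner_cadjoint_left[OF S] sa comm)
    have inv: "E (R h) = R h" if "R \<in> bounded_ops" "\<And>x. R (m x) = m (R x)" "E h = h" for R h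
      using commT[OF that(1,2)] A(5)[OF that(1)] that(3) unfolding E_iff by metis
    show "S (E h) = E (S h)"
      by (rule E(3)[OF S]) (use inv[OF S comm] inv[OF cadjoint_bounded_ops[OF S] adj_comm] in auto)
  next
    fix h assume "E h = h"
    then have "Re (cinner (T h) h) \<ge> 0" using A(3)[of h] by (simp add: E_iff)
    then show "r * (norm h)\<^sup>2 \<le> Re (cinner (m h) h)" using K(1) unfolding Re_T by (simp add: field_simps)
  next
    fix h assume h: "E h = 0"
    have "A h + T h = 0"
    proof (rule cinner_eq_0_imp)
      fix g
      have "A (A g + T g) = T (A g + T g)"
        by (simp add: bounded_ops_linear(1)[OF A(1)] bounded_ops_linear(1)[OF T] A(2) TA add.commute)
      then have "E (A g + T g) = A g + T g" by (simp add: E_iff)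
      then have "cinner h (A g + T g) = cinner (E h) (A g + T g)"
        using orth_projectionD(3)[OF E(1), of h "A g + T g"] by simp
      then show "cinner (A h + T h) g = 0" by (simp add: h cinner_expand A(4) Tsa)
    qed
    then have "T h = - A h" by (simp add: eq_neg_iff_add_eq_0 add.commute)
    then have "Re (cinner (T h) h) \<le> 0" using A(3)[of h] by simp
    then show "Re (cinner (m h) h) \<le> r * (norm h)\<^sup>2" using K(1) unfolding Re_T by (simp add: field_simps)
  qed
qed

section \<open>Compressions of a projection matrix\<close>

text \<open>Cauchy--Schwarz for the positive form of \<open>m\<close>, read off from its value at \<open>u - m u / c\<close>.  Positivity is assumed
  along the line through \<open>u\<close> in direction \<open>m u\<close>, so that the bound can be used on a subspace invariant
  under \<open>m\<close>.\<close>

lemma norm_le_of_form_bounds: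
  fixes m :: "'h::complex_hilbert \<Rightarrow> 'h"
  assumes m: "m \<in> bounded_ops" and sa: "\<And>x y. cinner (m x) y = cinner x (m y)" and c: "c > 0"
    and lower: "\<And>t. 0 \<le> Re (cinner (m (u + t *\<^sub>R m u)) (u + t *\<^sub>R m u))"
    and upper: "Re (cinner (m (m u)) (m u)) \<le> c * (norm (m u))\<^sup>2" "Re (cinner (m u) u) \<le> c * (norm u)\<^sup>2"
  shows "norm (m u) \<le> c * norm u"
proof -
  let ?s = "1 / c"
  have eq: "Re (cinner (m (u + t *\<^sub>R m u)) (u + t *\<^sub>R m u))
      = Re (cinner (m u) u) + 2 * t * (norm (m u))\<^sup>2 + t\<^sup>2 * Re (cinner (m (m u)) (m u))" for t
    by (simp add: bounded_ops_linear[OF m] cinner_add_left cinner_add_right cinner_scaleR_left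
        cinner_scaleR_right sa[of "m u" u] cinner_self algebra_simps power2_eq_square)
  have "0 \<le> Re (cinner (m u) u) + 2 * (- ?s) * (norm (m u))\<^sup>2 + (- ?s)\<^sup>2 * Re (cinner (m (m u)) (m u))"
    using lower[of "- ?s"] unfolding eq .
  also have "\<dots> \<le> c * (norm u)\<^sup>2 + 2 * (- ?s) * (norm (m u))\<^sup>2 + ?s\<^sup>2 * (c * (norm (m u))\<^sup>2)"
    using mult_left_mono[OF upper(1) zero_le_power2, of ?s] upper(2) unfolding power2_minus by linarith
  also have "\<dots> = c * (norm u)\<^sup>2 - (norm (m u))\<^sup>2 / c"
    using c by (simp add: power2_eq_square field_simps)
  finally have "(norm (m u))\<^sup>2 \<le> (c * norm u)\<^sup>2" using c by (simp add: field_simps power2_eq_square)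
  then show ?thesis by (rule power2_le_imp_le) (use c in simp)
qed

text \<open>The scalar is the supremum of the lower bounds of the form, which by the dichotomy is also an upper bound.\<close>

lemma scalar_of_dichotomy:
  fixes m :: "'h::complex_hilbert \<Rightarrow> 'h"
  assumes m: "m \<in> bounded_ops" and sa: "\<And>x y. cinner (m x) y = cinner x (m y)"
    and dich: "\<And>r. (\<forall>h. r * (norm h)\<^sup>2 \<le> Re (cinner (m h) h)) \<or> (\<forall>h. Re (cinner (m h) h) \<le> r * (norm h)\<^sup>2)"
  obtains r where "\<And>h. m h = r *\<^sub>R h"
proof (cases "\<forall>h::'h. h = 0")
  case True
  show thesis by (rule that[of 0]) (metis True)
next
  case False
  then obtain h0 :: 'h where "h0 \<noteq> 0" by blast
  then have h0: "(norm h0)\<^sup>2 > 0" by simp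
  obtain K where K: "K > 0" "\<And>x. norm (m x) \<le> K * norm x" by (rule bounded_ops_bound[OF m]) blast
  have abs: "\<bar>Re (cinner (m h) h)\<bar> \<le> K * (norm h)\<^sup>2" for h
  proof -
    have "\<bar>Re (cinner (m h) h)\<bar> \<le> norm (m h) * norm h"
      using abs_Re_le_cmod[of "cinner (m h) h"] cinner_Cauchy_Schwarz[of "m h" h] by linarith
    also have "\<dots> \<le> K * norm h * norm h" by (intro mult_right_mono K) auto
    finally show ?thesis by (simp add: power2_eq_square mult.assoc)
  qed
  define L where "L = {r. \<forall>h. r * (norm h)\<^sup>2 \<le> Re (cinner (m h) h)}"
  have "- K \<in> L" unfolding L_def using abs by (auto simp: abs_le_iff minus_le_iff)
  have ub: "r \<le> Re (cinner (m h0) h0) / (norm h0)\<^sup>2" if "r \<in> L" for r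
    using that h0 by (auto simp: L_def field_simps)
  then have bdd: "bdd_above L" by (rule bdd_aboveI)
  define s where "s = Sup L"
  have low: "s * (norm h)\<^sup>2 \<le> Re (cinner (m h) h)" for h
  proof (cases "h = 0")
    case False
    then have "(norm h)\<^sup>2 > 0" by simp
    then have "r \<le> Re (cinner (m h) h) / (norm h)\<^sup>2" if "r \<in> L" for r
      using that by (auto simp: L_def field_simps)
    then have "s \<le> Re (cinner (m h) h) / (norm h)\<^sup>2"
      unfolding s_def using \<open>- K \<in> L\<close> by (intro cSup_least) auto
    then show ?thesis using \<open>(norm h)\<^sup>2 > 0\<close> by (simp add: field_simps)
  qed simp
  have up: "Re (cinner (m h) h) \<le> (s + e) * (norm h)\<^sup>2" if "e > 0" for h e
  proof -
    have "s + e \<notin> L" using cSup_upper[OF _ bdd, of "s + e"] that unfolding s_def by auto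
    then show ?thesis using dich[of "s + e"] by (auto simp: L_def)
  qed
  define m' where "m' h = m h - of_real s *\<^sub>C h" for h
  have m': "m' \<in> bounded_ops" unfolding m'_def
    by (rule bounded_ops_diff[OF m bounded_ops_scaleC[OF bounded_ops_ident]])
  have sa': "cinner (m' x) y = cinner x (m' y)" for x y
    by (simp add: m'_def cinner_expand sa)
  have form: "Re (cinner (m' h) h) = Re (cinner (m h) h) - s * (norm h)\<^sup>2" for h
    by (simp add: m'_def cinner_expand cinner_self)
  have small: "norm (m' u) \<le> e * norm u" if "e > 0" for e u
    using low up[OF that] by (intro norm_le_of_form_bounds[OF m' sa' that]) (auto simp: form algebra_simps)
  have "m' u = 0" for u
  proof (rule ccontr)
    assume "m' u \<noteq> 0"
    then have "norm (m' u) > 0" by simp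
    define e where "e = norm (m' u) / (2 * (norm u + 1))"
    have "e > 0" using \<open>norm (m' u) > 0\<close> by (simp add: e_def add_nonneg_pos)
    have "e * norm u \<le> e * (norm u + 1)" using \<open>e > 0\<close> by simp
    also have "\<dots> = norm (m' u) / 2"
      unfolding e_def using add_nonneg_pos[OF norm_ge_zero zero_less_one, of u] by (simp add: field_simps)
    finally show False using small[OF \<open>e > 0\<close>, of u] \<open>norm (m' u) > 0\<close> by simp
  qed
  then show thesis by (intro that[of s]) (simp add: m'_def scaleC_of_real)
qed

text \<open>The vector \<open>e\<^sub>a + \<i>\<^sup>l e\<^sub>b\<close> of the polarization identity.\<close>

definition polarizing_tuple :: "nat \<Rightarrow> nat \<Rightarrow> nat \<Rightarrow> nat \<Rightarrow> complex" where
  "polarizing_tuple a b l i = (if i = a then 1 else 0) + (if i = b then \<i> ^ l else 0)"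

lemma sum_polarizing_tuple:
  fixes f :: "nat \<Rightarrow> 'h::complex_normed_vector"
  assumes "a < n" "b < n"
  shows "(\<Sum>i<n. polarizing_tuple a b l i *\<^sub>C f i) = f a + \<i> ^ l *\<^sub>C f b"
    "(\<Sum>i<n. cnj (polarizing_tuple a b l i) *\<^sub>C f i) = f a + cnj (\<i> ^ l) *\<^sub>C f b"
  using assms unfolding polarizing_tuple_def complex_cnj_add scaleC_add_left sum.distrib
  by (simp_all add: if_distrib[of cnj] if_distrib[of "\<lambda>c. c *\<^sub>C _"] cong: if_cong)

context projection_matrix
begin

text \<open>With \<open>Q\<close> the matrix of the projection and \<open>\<xi>\<close> a column of \<open>n\<close> scalars, this is \<open>\<xi>\<^sup>* Q \<xi>\<close>.  These operators are
  positive, and by polarization they determine \<open>Q\<close>.\<close>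

definition compression :: "(nat \<Rightarrow> complex) \<Rightarrow> 'h \<Rightarrow> 'h" where
  "compression \<xi> h = (\<Sum>a<n. cnj (\<xi> a) *\<^sub>C (\<Sum>b<n. \<xi> b *\<^sub>C q a b h))"

lemma compression_bounded: "compression \<xi> \<in> bounded_ops"
  unfolding compression_def by (intro bounded_ops_sum bounded_ops_scaleC q_bounded finite_lessThan)

lemma compression_eq: "compression \<xi> h = (\<Sum>a<n. cnj (\<xi> a) *\<^sub>C proj (\<lambda>i. \<xi> i *\<^sub>C h) a)"
  by (simp add: compression_def proj_def bounded_ops_linear(3)[OF q_bounded])

lemma cinner_compression:
  "cinner (compression \<xi> h) g = tuple_inner n (proj (\<lambda>i. \<xi> i *\<^sub>C h)) (\<lambda>i. \<xi> i *\<^sub>C g)"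
  by (simp add: compression_eq tuple_inner_def cinner_sum_left cinner_scaleC_left cinner_scaleC_right)

lemma compression_selfadjoint: "cinner (compression \<xi> h) g = cinner h (compression \<xi> g)"
proof -
  have "cinner (compression \<xi> h) g = tuple_inner n (\<lambda>i. \<xi> i *\<^sub>C h) (proj (\<lambda>i. \<xi> i *\<^sub>C g))"
    unfolding cinner_compression by (rule proj_selfadjoint)
  also have "\<dots> = cnj (cinner (compression \<xi> g) h)"
    unfolding cinner_compression by (rule tuple_inner_commute)
  finally show ?thesis by (simp only: cinner_commute[of h])
qed

lemma compression_form:
  "Re (cinner (compression \<xi> h) h) = tuple_norm2 n (proj (\<lambda>i. \<xi> i *\<^sub>C h))"
proof -
  let ?v = "\<lambda>i. \<xi> i *\<^sub>C h"
  have "tuple_inner n (proj ?v) ?v = tuple_inner n (proj (proj ?v)) ?v"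
    by (rule tuple_inner_cong) (auto simp: proj_fix[OF proj_in])
  then have "cinner (compression \<xi> h) h = tuple_inner n (proj ?v) (proj ?v)"
    by (simp only: cinner_compression proj_selfadjoint)
  then show ?thesis by (simp add: tuple_inner_self)
qed

lemma compression_commute:
  assumes S: "S \<in> bounded_ops" and "\<And>a b h. a < n \<Longrightarrow> b < n \<Longrightarrow> S (q a b h) = q a b (S h)"
  shows "S (compression \<xi> h) = compression \<xi> (S h)"
  by (simp add: compression_def bounded_ops_linear[OF S] assms(2))

lemma polarization:
  assumes "a < n" "b < n"
  shows "4 *\<^sub>C q a b h = (\<Sum>l<4. cnj (\<i> ^ l) *\<^sub>C compression (polarizing_tuple a b l) h)"
proof -
  have c: "compression (polarizing_tuple a b l) h
      = q a a h + \<i> ^ l *\<^sub>C q a b h + cnj (\<i> ^ l) *\<^sub>C (q b a h + \<i> ^ l *\<^sub>C q b b h)" for l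
    unfolding compression_def sum_polarizing_tuple[OF assms] ..
  have four: "4 *\<^sub>C x = x + (x + (x + x))" for x :: 'h
  proof -
    have "x + (x + (x + x)) = (1 + (1 + (1 + 1))) *\<^sub>C x" by (simp only: scaleC_add_left scaleC_1_left)
    then show ?thesis by simp
  qed
  have "(\<Sum>l<4. cnj (\<i> ^ l) *\<^sub>C compression (polarizing_tuple a b l) h)
    = (\<Sum>l<4. cnj (\<i> ^ l)) *\<^sub>C q a a h + (\<Sum>l<4. cnj (\<i> ^ l) * \<i> ^ l) *\<^sub>C q a b h
      + (\<Sum>l<4. cnj (\<i> ^ l) * cnj (\<i> ^ l)) *\<^sub>C q b a h + (\<Sum>l<4. cnj (\<i> ^ l) * (cnj (\<i> ^ l) * \<i> ^ l)) *\<^sub>C q b b h"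
    unfolding c by (simp add: eval_nat_numeral lessThan_Suc scaleC_add_right scaleC_add_left scaleC_scaleC four algebra_simps)
  also have "\<dots> = 4 *\<^sub>C q a b h" by (simp add: eval_nat_numeral lessThan_Suc four)
  finally show ?thesis by (rule sym)
qed

lemma q_commute_of_compressions:
  assumes X: "X \<in> bounded_ops" and comm: "\<And>\<xi> h. X (compression \<xi> h) = compression \<xi> (X h)"
    and ab: "a < n" "b < n"
  shows "X (q a b h) = q a b (X h)"
proof -
  have "4 *\<^sub>C X (q a b h) = X (4 *\<^sub>C q a b h)" by (simp add: bounded_ops_linear(3)[OF X])
  also have "\<dots> = 4 *\<^sub>C q a b (X h)"
    unfolding polarization[OF ab] by (simp add: bounded_ops_linear[OF X] comm)
  finally have "(1/4) *\<^sub>C 4 *\<^sub>C X (q a b h) = (1/4) *\<^sub>C 4 *\<^sub>C q a b (X h)" by simp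
  then show ?thesis by (simp add: scaleC_scaleC)
qed

lemma perp_invariant_of_compressions:
  assumes X: "X \<in> bounded_ops" and comm: "\<And>\<xi> h. X (compression \<xi> h) = compression \<xi> (X h)"
    and v: "v \<in> tuple_perp n Y"
  shows "(\<lambda>i. X (v i)) \<in> tuple_perp n Y"
proof -
  have "X (v k) = proj (\<lambda>i. X (v i)) k" if "k < n" for k
  proof -
    have "X (v k) = X (proj v k)" by (simp add: proj_fix[OF v that])
    also have "\<dots> = proj (\<lambda>i. X (v i)) k"
      using that by (simp add: proj_def bounded_ops_linear(7)[OF X] q_commute_of_compressions[OF X comm])
    finally show ?thesis .
  qed
  then have "tuple_inner n (\<lambda>i. X (v i)) y = tuple_inner n (proj (\<lambda>i. X (v i))) y" for y
    by (intro tuple_inner_cong) auto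
  then show ?thesis using proj_in[of "\<lambda>i. X (v i)"] by (simp add: tuple_perp_def)
qed

end

section \<open>Weak closures of algebras of operators\<close>

text \<open>The closure of an algebra \<open>D\<close> of operators for the weak operator topology, described by the functionals \<open>X \<mapsto> (\<Sum>i<n. cinner (X (x i)) (y i))\<close>
  that kill \<open>D\<close> (\<open>wot_closure_eq_annihilator_closure\<close>); in this form closure arguments become algebra.\<close>

definition annihilator_closure :: "('h::complex_inner \<Rightarrow> 'h) set \<Rightarrow> ('h \<Rightarrow> 'h) set" where
  "annihilator_closure D = {T \<in> bounded_ops. \<forall>n x y.
     (\<forall>S\<in>D. tuple_inner n (\<lambda>i. S (x i)) y = 0) \<longrightarrow> tuple_inner n (\<lambda>i. T (x i)) y = 0}"

lemma annihilator_closureD: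
  assumes "T \<in> annihilator_closure D" "\<And>S. S \<in> D \<Longrightarrow> tuple_inner n (\<lambda>i. S (x i)) y = 0"
  shows "tuple_inner n (\<lambda>i. T (x i)) y = 0"
  using assms unfolding annihilator_closure_def by blast

lemma annihilator_closure_bounded: "T \<in> annihilator_closure D \<Longrightarrow> T \<in> bounded_ops"
  by (simp add: annihilator_closure_def)

lemma annihilator_closure_superset: "D \<subseteq> bounded_ops \<Longrightarrow> D \<subseteq> annihilator_closure D"
  by (auto simp: annihilator_closure_def)

text \<open>Multiplication is separately weakly continuous: the adjoint of a left factor from \<open>D\<close> moves onto \<open>y\<close>, and
  afterwards the right factor moves into \<open>x\<close>.\<close>

lemma annihilator_closure_compose:
  fixes D :: "('h::complex_hilbert \<Rightarrow> 'h) set"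
  assumes D: "operator_subalgebra D" and R: "R \<in> annihilator_closure D" and T: "T \<in> annihilator_closure D"
  shows "(\<lambda>x. R (T x)) \<in> annihilator_closure D"
  unfolding annihilator_closure_def
proof (intro CollectI conjI allI impI)
  show "(\<lambda>x. R (T x)) \<in> bounded_ops"
    by (rule bounded_ops_compose) (use R T annihilator_closure_bounded in auto)
  fix n and x y :: "nat \<Rightarrow> 'h"
  assume *: "\<forall>S\<in>D. tuple_inner n (\<lambda>i. S (x i)) y = 0"
  show "tuple_inner n (\<lambda>i. R (T (x i))) y = 0"
  proof (rule annihilator_closureD[OF R])
    fix S assume S: "S \<in> D"
    then have Sb: "S \<in> bounded_ops" using D by (auto simp: operator_subalgebra_def)
    have adj: "tuple_inner n (\<lambda>i. S (v i)) y = tuple_inner n v (\<lambda>i. cadjoint S (y i))" for v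
      by (simp add: tuple_inner_def cinner_cadjoint[OF Sb])
    have "tuple_inner n (\<lambda>i. T (x i)) (\<lambda>i. cadjoint S (y i)) = 0"
    proof (rule annihilator_closureD[OF T])
      fix S' assume "S' \<in> D"
      then have "S \<circ> S' \<in> D" using D S by (auto simp: operator_subalgebra_def)
      with * have "tuple_inner n (\<lambda>i. (S \<circ> S') (x i)) y = 0" by blast
      then show "tuple_inner n (\<lambda>i. S' (x i)) (\<lambda>i. cadjoint S (y i)) = 0"
        by (simp add: adj)
    qed
    then show "tuple_inner n (\<lambda>i. S (T (x i))) y = 0" by (simp add: adj)
  qed
qed

lemma annihilator_closure_diff:
  assumes "R \<in> annihilator_closure D" "T \<in> annihilator_closure D"
  shows "(\<lambda>x. R x - T x) \<in> annihilator_closure D"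
  using assms unfolding annihilator_closure_def
  by (auto intro: bounded_ops_diff simp: tuple_inner_diff_left)

text \<open>Finite-dimensional Hahn--Banach: a vector satisfying all linear relations that hold on a subspace of
  \<open>n\<close>-tuples belongs to the subspace.  The induction eliminates the last coordinate by means of a vector
  of \<open>V\<close> with last coordinate 1.\<close>

lemma finite_interpolation:
  fixes V :: "(nat \<Rightarrow> complex) set"
  assumes "V \<noteq> {}" and "\<And>u w. u \<in> V \<Longrightarrow> w \<in> V \<Longrightarrow> (\<lambda>i. u i + w i) \<in> V"
    and "\<And>c u. u \<in> V \<Longrightarrow> (\<lambda>i. c * u i) \<in> V"
    and "\<And>c. (\<And>u. u \<in> V \<Longrightarrow> (\<Sum>i<n. c i * u i) = 0) \<Longrightarrow> (\<Sum>i<n. c i * t i) = 0"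
  shows "\<exists>u\<in>V. \<forall>i<n. u i = t i"
  using assms
proof (induction n arbitrary: V t)
  case (Suc n)
  note add = Suc.prems(2) and scale = Suc.prems(3) and ann = Suc.prems(4)
  show ?case
  proof (cases "\<forall>u\<in>V. u n = 0")
    case True
    have "t n = 0"
      using ann[of "\<lambda>i. if i = n then 1 else 0"] True by (simp add: if_distrib[of "\<lambda>c. c * _"] cong: if_cong)
    have "\<exists>u\<in>V. \<forall>i<n. u i = t i"
    proof (rule Suc.IH)
      fix c assume c: "\<And>u. u \<in> V \<Longrightarrow> (\<Sum>i<n. c i * u i) = 0"
      show "(\<Sum>i<n. c i * t i) = 0" using ann[of c] c True \<open>t n = 0\<close> by simp
    qed (use Suc.prems in auto)
    then show ?thesis using True \<open>t n = 0\<close> by (auto simp: less_Suc_eq)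
  next
    case False
    then obtain u where u: "u \<in> V" "u n \<noteq> 0" by blast
    define s where "s i = (1 / u n) * u i" for i
    have s: "s \<in> V" "s n = 1" using scale[OF u(1), of "1 / u n"] u(2) by (auto simp: s_def[abs_def])
    define V' where "V' = {w \<in> V. w n = 0}"
    define t' where "t' i = t i - t n * s i" for i
    have "\<exists>w\<in>V'. \<forall>i<n. w i = t' i"
    proof (rule Suc.IH)
      have "(\<lambda>i. 0 * u i) \<in> V" by (rule scale[OF u(1)])
      then have "(\<lambda>i. 0) \<in> V'" by (simp add: V'_def)
      then show "V' \<noteq> {}" by blast
      fix c assume c: "\<And>w. w \<in> V' \<Longrightarrow> (\<Sum>i<n. c i * w i) = 0"
      \<comment> \<open>a relation on \<open>V'\<close> extends to one on \<open>V\<close> by choosing its last coefficient so that it kills \<open>s\<close>\<close>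
      define d where "d i = (if i = n then - (\<Sum>i<n. c i * s i) else c i)" for i
      have dsum: "(\<Sum>i<Suc n. d i * w i) = (\<Sum>i<n. c i * w i) - (\<Sum>i<n. c i * s i) * w n" for w
        by (simp add: d_def)
      have "(\<Sum>i<Suc n. d i * w i) = 0" if w: "w \<in> V" for w
      proof -
        have "(\<lambda>i. w i + (- w n) * s i) \<in> V'" unfolding V'_def using add[OF w scale[OF s(1), of "- w n"]] s(2) by simp
        from c[OF this] show ?thesis
          unfolding dsum by (simp add: algebra_simps sum.distrib sum_subtractf sum_distrib_left sum_negf)
      qed
      then have "(\<Sum>i<Suc n. d i * t i) = 0" by (rule ann)
      then show "(\<Sum>i<n. c i * t' i) = 0"
        unfolding dsum by (simp add: t'_def algebra_simps sum_subtractf sum_distrib_left)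
    qed (use add scale in \<open>auto simp: V'_def\<close>)
    then obtain w where w: "w \<in> V" "w n = 0" "\<And>i. i < n \<Longrightarrow> w i = t' i" by (auto simp: V'_def)
    show ?thesis
    proof (rule bexI)
      show "(\<lambda>i. w i + t n * s i) \<in> V" by (rule add[OF w(1) scale[OF s(1)]])
      show "\<forall>i<Suc n. w i + t n * s i = t i" using w(2,3) s(2) by (auto simp: less_Suc_eq t'_def)
    qed
  qed
qed auto

text \<open>A basic weak neighbourhood constrains finitely many matrix coefficients, and by \<open>finite_interpolation\<close> some
  element of \<open>D\<close> attains these coefficients exactly.\<close>

lemma wot_closure_eq_annihilator_closure:
  fixes D :: "('h::complex_hilbert \<Rightarrow> 'h) set"
  assumes D: "operator_subalgebra D"
  shows "wot closure_of D = annihilator_closure D"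
proof
  have Db: "D \<subseteq> bounded_ops" using D by (simp add: operator_subalgebra_def)
  let ?g = "\<lambda>T (x, y). cinner (T x) (y :: 'h)"
  have top: "topspace wot = (bounded_ops :: ('h \<Rightarrow> 'h) set)"
    by (simp add: wot_def topspace_pullback_topology)
  have open_wot: "openin wot U \<longleftrightarrow> (\<exists>W. open W \<and> U = ?g -` W \<inter> bounded_ops)" for U :: "('h \<Rightarrow> 'h) set"
    by (simp add: wot_def openin_pullback_topology)
  show "wot closure_of D \<subseteq> annihilator_closure D"
  proof
    fix T assume T: "T \<in> wot closure_of D"
    have Tb: "T \<in> bounded_ops" using T closure_of_subset_topspace[of wot D] top by blast
    show "T \<in> annihilator_closure D"
      unfolding annihilator_closure_def
    proof (intro CollectI conjI allI impI)
      fix n and x y :: "nat \<Rightarrow> 'h"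
      assume 0: "\<forall>S\<in>D. tuple_inner n (\<lambda>i. S (x i)) y = 0"
      show "tuple_inner n (\<lambda>i. T (x i)) y = 0"
      proof (rule ccontr)
        assume nz: "tuple_inner n (\<lambda>i. T (x i)) y \<noteq> 0"
        let ?W = "{f :: 'h \<times> 'h \<Rightarrow> complex. (\<Sum>i<n. f (x i, y i)) \<noteq> 0}"
        have "continuous_on UNIV (\<lambda>f :: 'h \<times> 'h \<Rightarrow> complex. \<Sum>i<n. f (x i, y i))"
          by (intro continuous_intros continuous_on_product_coordinates)
        then have "open ?W" by (intro open_Collect_neq continuous_on_const)
        then have o: "openin wot (?g -` ?W \<inter> bounded_ops)" unfolding open_wot by blast
        have i: "T \<in> ?g -` ?W \<inter> bounded_ops" using nz Tb by (simp add: tuple_inner_def)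
        have "\<forall>U. T \<in> U \<and> openin wot U \<longrightarrow> (\<exists>S. S \<in> D \<and> S \<in> U)"
          using T unfolding in_closure_of by (rule conjunct2)
        from this[rule_format, OF conjI[OF i o]]
        have "\<exists>S. S \<in> D \<and> S \<in> ?g -` ?W \<inter> bounded_ops" .
        then obtain S where "S \<in> D" "S \<in> ?g -` ?W \<inter> bounded_ops" by blast
        then show False using 0 by (simp add: tuple_inner_def)
      qed
    qed (rule Tb)
  qed
  show "annihilator_closure D \<subseteq> wot closure_of D"
  proof
    fix T assume T: "T \<in> annihilator_closure D"
    have Tb: "T \<in> bounded_ops" using T by (rule annihilator_closure_bounded)
    show "T \<in> wot closure_of D" unfolding in_closure_of
    proof (intro conjI allI impI)
      show "T \<in> topspace wot" using Tb top by simp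
      fix U assume "T \<in> U \<and> openin wot U"
      then obtain W where W: "open W" "U = ?g -` W \<inter> bounded_ops" "T \<in> U" unfolding open_wot by blast
      have "\<exists>X. ?g T \<in> (\<Pi>\<^sub>E i\<in>UNIV. X i) \<and> (\<forall>i. openin euclidean (X i)) \<and>
          finite {i. X i \<noteq> topspace euclidean} \<and> (\<Pi>\<^sub>E i\<in>UNIV. X i) \<subseteq> W"
        by (rule product_topology_open_contains_basis)
          (use W in \<open>auto simp: open_fun_def open_openin\<close>)
      then obtain X where X: "?g T \<in> (\<Pi>\<^sub>E i\<in>UNIV. X i)" "finite {i. X i \<noteq> UNIV}" "(\<Pi>\<^sub>E i\<in>UNIV. X i) \<subseteq> W"
        by auto
      obtain xs where xs: "set xs = {i. X i \<noteq> UNIV}" using finite_list[OF X(2)] by blast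
      define x y where "x i = fst (xs ! i)" and "y i = snd (xs ! i)" for i
      define n where "n = length xs"
      let ?V = "(\<lambda>S i. cinner (S (x i)) (y i)) ` D"
      have "\<exists>u\<in>?V. \<forall>i<n. u i = cinner (T (x i)) (y i)"
      proof (rule finite_interpolation)
        show "?V \<noteq> {}" using D by (auto simp: operator_subalgebra_def)
        show "(\<lambda>i. u i + w i) \<in> ?V" if "u \<in> ?V" "w \<in> ?V" for u w
        proof -
          from that obtain S R where SR: "S \<in> D" "R \<in> D" "u = (\<lambda>i. cinner (S (x i)) (y i))" "w = (\<lambda>i. cinner (R (x i)) (y i))" by auto
          then have "(\<lambda>x. S x + R x) \<in> D" using D by (auto simp: operator_subalgebra_def)
          then show ?thesis unfolding SR by (intro image_eqI) (auto simp: cinner_add_left)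
        qed
        show "(\<lambda>i. c * u i) \<in> ?V" if "u \<in> ?V" for c u
        proof -
          from that obtain S where SR: "S \<in> D" "u = (\<lambda>i. cinner (S (x i)) (y i))" by auto
          then have "(\<lambda>x. c *\<^sub>C S x) \<in> D" using D by (auto simp: operator_subalgebra_def)
          then show ?thesis unfolding SR by (intro image_eqI) (auto simp: cinner_scaleC_left)
        qed
        fix c assume c: "\<And>u. u \<in> ?V \<Longrightarrow> (\<Sum>i<n. c i * u i) = 0"
        have eq: "tuple_inner n (\<lambda>i. S (x i)) (\<lambda>i. cnj (c i) *\<^sub>C y i) = (\<Sum>i<n. c i * cinner (S (x i)) (y i))" for S
          by (simp add: tuple_inner_def cinner_scaleC_right)
        show "(\<Sum>i<n. c i * cinner (T (x i)) (y i)) = 0"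
          using annihilator_closureD[OF T, of n x "\<lambda>i. cnj (c i) *\<^sub>C y i"] c unfolding eq by blast
      qed
      then obtain S where S: "S \<in> D" "\<And>i. i < n \<Longrightarrow> cinner (S (x i)) (y i) = cinner (T (x i)) (y i)" by auto
      have "?g S \<in> (\<Pi>\<^sub>E i\<in>UNIV. X i)"
      proof (intro PiE_I)
        fix p :: "'h \<times> 'h"
        show "?g S p \<in> X p"
        proof (cases "X p = UNIV")
          case False
          then have "p \<in> set xs" using xs by simp
          then obtain i where i: "i < n" "p = xs ! i" by (auto simp: in_set_conv_nth n_def)
          have "?g S p = ?g T p" using S(2)[OF i(1)] by (simp add: i(2) x_def y_def case_prod_beta)
          then show ?thesis using X(1)[unfolded PiE_iff] by (cases p) auto
        qed simp
      qed simp
      then have "S \<in> U" using X(3) W(2) S(1) Db by auto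
      then show "\<exists>S. S \<in> D \<and> S \<in> U" using S(1) by blast
    qed
  qed
qed

section \<open>Representations of C*-algebras\<close>

lemma norm_star: "norm (star x) = norm (x::'a::cstar_algebra)"
proof -
  have le: "norm y \<le> norm (star y)" for y :: 'a
  proof (cases "y = 0")
    case False
    have "norm y * norm y \<le> norm (star y) * norm y"
      using norm_mult_ineq[of "star y" y] by (simp add: cstar_identity power2_eq_square)
    then show ?thesis using False by simp
  qed simp
  show ?thesis using le[of x] le[of "star x"] by (simp add: star_star)
qed

lemma bounded_linear_star: "bounded_linear (star :: 'a::cstar_algebra \<Rightarrow> 'a)"
proof (rule bounded_linear_intro[where K = 1])
  show "star (r *\<^sub>R x) = r *\<^sub>R star x" for r and x :: 'a
    using star_scaleC[of "of_real r" x] by (simp add: scaleC_of_real)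
qed (auto simp: star_add norm_star)

lemma star_representationD:
  fixes \<pi> :: "'a::cstar_algebra \<Rightarrow> 'h::complex_hilbert \<Rightarrow> 'h"
  assumes "star_representation \<pi>"
  shows "\<pi> a \<in> bounded_ops" "\<pi> (a + b) h = \<pi> a h + \<pi> b h" "\<pi> (c *\<^sub>C a) h = c *\<^sub>C \<pi> a h"
    "\<pi> (a * b) h = \<pi> a (\<pi> b h)" "cadjoint (\<pi> a) = \<pi> (star a)"
    "cinner (\<pi> a h) g = cinner h (\<pi> (star a) g)"
proof -
  show b: "\<pi> a \<in> bounded_ops" and "\<pi> (a + b) h = \<pi> a h + \<pi> b h" "\<pi> (c *\<^sub>C a) h = c *\<^sub>C \<pi> a h"
    "\<pi> (a * b) h = \<pi> a (\<pi> b h)" and ad: "cadjoint (\<pi> a) = \<pi> (star a)"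
    using assms by (simp_all add: star_representation_def)
  show "cinner (\<pi> a h) g = cinner h (\<pi> (star a) g)"
    using cinner_cadjoint[OF b, of h g] unfolding ad .
qed

text \<open>If \<open>norm b \<le> 1\<close>, then \<open>1 - b\<^sup>*b = (1 - z)\<^sup>2\<close> with \<open>z\<close> self-adjoint, whence
  \<open>(norm h)\<^sup>2 - (norm (\<pi> b h))\<^sup>2 = (norm (h - \<pi> z h))\<^sup>2 \<ge> 0\<close>.\<close>

lemma star_representation_contractive:
  fixes \<pi> :: "'a::cstar_algebra \<Rightarrow> 'h::complex_hilbert \<Rightarrow> 'h"
  assumes \<pi>: "star_representation \<pi>"
  shows "norm (\<pi> b h) \<le> norm b * norm h"
proof -
  note rep = star_representationD[OF \<pi>]
  have unit: "norm (\<pi> b h) \<le> norm h" if b: "norm b \<le> 1" for b h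
  proof -
    let ?a = "star b * b" and ?C = "{z :: 'a. star z = z}"
    have "closed ?C"
      by (intro closed_Collect_eq linear_continuous_on bounded_linear_star continuous_on_id)
    moreover have "star 0 = (0::'a)" using bounded_linear.linear[OF bounded_linear_star] by (rule linear_0)
    moreover have "star ((1/2) *\<^sub>R (?a + z * z)) = (1/2) *\<^sub>R (?a + z * z)" if "star z = z" for z
      by (simp add: linear_scale[OF bounded_linear.linear[OF bounded_linear_star]] star_add star_mult star_star that)
    moreover have "norm ?a \<le> 1" using b by (simp add: cstar_identity power_le_one)
    ultimately obtain z where z: "star z = z" "2 *\<^sub>R z = ?a + z * z"
      using square_root_iteration[OF bounded_bilinear_mult norm_mult_ineq, of ?a ?C] by auto
    have "2 *\<^sub>C z = ?a + z * z" using z(2) scaleC_of_real[of 2 z] by simp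
    then have "\<pi> (2 *\<^sub>C z) h = \<pi> (?a + z * z) h" by (rule arg_cong)
    then have "2 *\<^sub>C \<pi> z h = \<pi> (star b) (\<pi> b h) + \<pi> z (\<pi> z h)" by (simp only: rep(2,3,4))
    then have "cinner (2 *\<^sub>C \<pi> z h) h = cinner (\<pi> (star b) (\<pi> b h) + \<pi> z (\<pi> z h)) h" by simp
    also have "\<dots> = cinner (\<pi> b h) (\<pi> b h) + cinner (\<pi> z h) (\<pi> z h)"
      by (simp add: cinner_add_left rep(6)[of "star b"] rep(6)[of z "\<pi> z h"] star_star z(1))
    finally have "2 * Re (cinner (\<pi> z h) h) = (norm (\<pi> b h))\<^sup>2 + (norm (\<pi> z h))\<^sup>2"
      by (simp add: cinner_scaleC_left complex_eq_iff cinner_self)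
    then have "(norm (\<pi> b h))\<^sup>2 = (norm h)\<^sup>2 - (norm (\<pi> z h - h))\<^sup>2"
      by (simp add: norm_diff_sq)
    then have "(norm (\<pi> b h))\<^sup>2 \<le> (norm h)\<^sup>2" by simp
    then show ?thesis by (rule power2_le_imp_le) simp
  qed
  show ?thesis
  proof (cases "b = 0")
    case True
    then show ?thesis using rep(3)[of 0 b h] by simp
  next
    case False
    let ?c = "complex_of_real (1 / norm b)"
    have "norm (\<pi> (?c *\<^sub>C b) h) \<le> norm h" by (rule unit) (simp add: norm_scaleC norm_divide)
    then show ?thesis using False by (simp add: rep(3) norm_scaleC norm_divide field_simps)
  qed
qed

text \<open>The zeros of the functional form a closed set of elements of the C*-algebra, as representations are continuous.\<close>

lemma dirichlet_annihilator:
  fixes \<pi> :: "'a::cstar_algebra \<Rightarrow> 'h::complex_hilbert \<Rightarrow> 'h"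
  assumes \<pi>: "star_representation \<pi>" and dir: "dirichlet_in A j"
    and A: "\<And>S. S \<in> A \<Longrightarrow> tuple_inner n (\<lambda>i. \<pi> (j S) (x i)) y = 0"
    and A': "\<And>S. S \<in> A \<Longrightarrow> tuple_inner n (\<lambda>i. \<pi> (star (j S)) (x i)) y = 0"
  shows "tuple_inner n (\<lambda>i. \<pi> a (x i)) y = 0"
proof -
  note rep = star_representationD[OF \<pi>]
  have bl: "bounded_linear (\<lambda>a. \<pi> a h)" for h
  proof (rule bounded_linear_intro[where K = "norm h"])
    show "\<pi> (r *\<^sub>R a) h = r *\<^sub>R \<pi> a h" for r a
      using rep(3)[of "of_real r" a h] by (simp add: scaleC_of_real)
  qed (use star_representation_contractive[OF \<pi>] in \<open>auto simp: rep(2)\<close>)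
  let ?Z = "{a. tuple_inner n (\<lambda>i. \<pi> a (x i)) y = 0}"
  have "continuous_on UNIV (\<lambda>a. tuple_inner n (\<lambda>i. \<pi> a (x i)) y)"
    unfolding tuple_inner_def
    by (intro continuous_on_sum bounded_bilinear.continuous_on[OF bounded_bilinear_cinner]
        linear_continuous_on bl continuous_on_const)
  then have "closed ?Z" by (intro closed_Collect_eq continuous_on_const)
  moreover have "{j S + star (j T) | S T. S \<in> A \<and> T \<in> A} \<subseteq> ?Z"
    using A A' by (auto simp: rep(2) tuple_inner_add_left)
  ultimately have "closure {j S + star (j T) | S T. S \<in> A \<and> T \<in> A} \<subseteq> ?Z"
    by (simp add: closure_minimal)
  then show ?thesis using dir by (auto simp: dirichlet_in_def)
qed

text \<open>The range of each spectral projection of \<open>m\<close> is invariant, hence trivial.\<close>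

lemma irreducible_commutant_scalar:
  fixes \<pi> :: "'a::cstar_algebra \<Rightarrow> 'h::complex_hilbert \<Rightarrow> 'h"
  assumes irr: "irreducible_representation \<pi>" and m: "m \<in> bounded_ops"
    and sa: "\<And>x y. cinner (m x) y = cinner x (m y)"
    and comm: "\<And>a h. \<pi> a (m h) = m (\<pi> a h)"
  obtains r where "\<And>h. m h = r *\<^sub>R h"
proof (rule scalar_of_dichotomy[OF m sa])
  fix r
  have \<pi>: "star_representation \<pi>" using irr by (simp add: irreducible_representation_def)
  note rep = star_representationD[OF \<pi>]
  obtain E where E: "orth_projection E"
    "\<And>S h. S \<in> bounded_ops \<Longrightarrow> (\<And>x. S (m x) = m (S x)) \<Longrightarrow> S (E h) = E (S h)"
    "\<And>h. E h = h \<Longrightarrow> r * (norm h)\<^sup>2 \<le> Re (cinner (m h) h)"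
    "\<And>h. E h = 0 \<Longrightarrow> Re (cinner (m h) h) \<le> r * (norm h)\<^sup>2"
    by (rule spectral_projection_exists[OF m sa, where r = r]) blast
  note Eb = orth_projectionD(1)[OF E(1)]
  let ?V = "{h. E h = h}"
  have "continuous_on UNIV E" by (rule linear_continuous_on[OF bounded_ops_linear(8)[OF Eb]])
  then have "closed ?V" by (intro closed_Collect_eq continuous_on_id)
  then have "closed_csubspace ?V" by (auto simp: closed_csubspace_def bounded_ops_linear[OF Eb])
  moreover have "\<pi> a ` ?V \<subseteq> ?V" for a by (auto simp: E(2)[OF rep(1) comm, symmetric])
  ultimately have "?V = {0} \<or> ?V = UNIV" using irr by (simp add: irreducible_representation_def)
  then show "(\<forall>h. r * (norm h)\<^sup>2 \<le> Re (cinner (m h) h)) \<or> (\<forall>h. Re (cinner (m h) h) \<le> r * (norm h)\<^sup>2)"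
  proof
    assume V: "?V = {0}"
    have "E h = 0" for h using V orth_projectionD(2)[OF E(1), of h] by blast
    then show ?thesis using E(4) by blast
  qed (use E(3) in blast)
qed (rule that)

text \<open>The subspace generated by the tuple \<open>x\<close> reduces the representation, so by Schur's lemma the entries of its projection are
  scalars.  Such a subspace is invariant under every operator \<open>X\<close>, and it contains \<open>x\<close> because the
  identity is a weak limit of represented elements.\<close>

lemma irreducible_density:
  fixes \<pi> :: "'a::cstar_algebra \<Rightarrow> 'h::complex_hilbert \<Rightarrow> 'h"
  assumes irr: "irreducible_representation \<pi>"
    and nondeg: "(\<lambda>h. h) \<in> annihilator_closure (range \<pi>)"
  shows "annihilator_closure (range \<pi>) = bounded_ops"
proof
  show "annihilator_closure (range \<pi>) \<subseteq> bounded_ops" using annihilator_closure_bounded by blast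
  show "bounded_ops \<subseteq> annihilator_closure (range \<pi>)"
  proof
    fix X :: "'h \<Rightarrow> 'h" assume X: "X \<in> bounded_ops"
    have \<pi>: "star_representation \<pi>" using irr by (simp add: irreducible_representation_def)
    note rep = star_representationD[OF \<pi>]
    have "tuple_inner n (\<lambda>i. X (x i)) y = 0" if y: "\<forall>S\<in>range \<pi>. tuple_inner n (\<lambda>i. S (x i)) y = 0" for n x y
    proof -
      define Y where "Y = {y. \<forall>S\<in>range \<pi>. tuple_inner n (\<lambda>i. S (x i)) y = 0}"
      have yY: "y \<in> Y" using y by (simp add: Y_def)
      have xK: "x \<in> tuple_perp n Y"
        unfolding tuple_perp_def using annihilator_closureD[OF nondeg, of n x] by (auto simp: Y_def)
      have adj: "tuple_inner n (\<lambda>i. \<pi> a (v i)) w = tuple_inner n v (\<lambda>i. \<pi> (star a) (w i))" for a v w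
        by (simp add: tuple_inner_def rep(6))
      have Y_inv: "(\<lambda>i. \<pi> a (w i)) \<in> Y" if w: "w \<in> Y" for a w
        unfolding Y_def
      proof (intro CollectI ballI)
        fix S assume "S \<in> range \<pi>"
        then obtain b where b: "S = \<pi> b" by blast
        have "tuple_inner n (\<lambda>i. \<pi> b (x i)) (\<lambda>i. \<pi> a (w i)) = tuple_inner n (\<lambda>i. \<pi> (star a * b) (x i)) w"
          by (simp add: rep(4) adj star_star)
        then show "tuple_inner n (\<lambda>i. S (x i)) (\<lambda>i. \<pi> a (w i)) = 0" using w b by (simp add: Y_def)
      qed
      have K_inv: "(\<lambda>i. \<pi> a (v i)) \<in> tuple_perp n Y" if "v \<in> tuple_perp n Y" for a v
        using that Y_inv unfolding tuple_perp_def by (auto simp: adj)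
      obtain q where "projection_matrix n Y q" using projection_matrix_exists by blast
      then interpret projection_matrix n Y q .
      have comm_q: "\<pi> a (q c b h) = q c b (\<pi> a h)" if "c < n" "b < n" for a b c h
        by (rule q_commute[OF rep(1) _ _ that]) (simp_all add: K_inv rep(5))
      have comm: "X (compression \<xi> h) = compression \<xi> (X h)" for \<xi> h
      proof -
        obtain r where r: "\<And>h. compression \<xi> h = r *\<^sub>R h"
          by (rule irreducible_commutant_scalar[OF irr compression_bounded[of \<xi>] compression_selfadjoint])
            (use compression_commute[OF rep(1) comm_q] in auto)
        show ?thesis by (simp add: r bounded_ops_linear(6)[OF X])
      qed
      show ?thesis
        using perp_invariant_of_compressions[OF X comm xK] yY by (simp add: tuple_perp_def)
    qed
    then show "X \<in> annihilator_closure (range \<pi>)" using X by (simp add: annihilator_closure_def)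
  qed
qed

section \<open>Maximal abelian self-adjoint algebras\<close>

definition commutant :: "('h::complex_normed_vector \<Rightarrow> 'h) set \<Rightarrow> ('h \<Rightarrow> 'h) set" where
  "commutant Z = {T \<in> bounded_ops. \<forall>R\<in>Z. \<forall>x. R (T x) = T (R x)}"

lemma operator_subalgebra_commutant:
  assumes "Z \<subseteq> bounded_ops" shows "operator_subalgebra (commutant Z)"
  using assms unfolding operator_subalgebra_def commutant_def
  by (auto simp: subset_iff bounded_ops_linear(1,3,4) comp_def
      intro: bounded_ops_zero bounded_ops_add bounded_ops_compose bounded_ops_scaleC)

lemma cadjoint_commutant:
  fixes Z :: "('h::complex_hilbert \<Rightarrow> 'h) set"
  assumes Z: "Z \<subseteq> bounded_ops" "\<And>R. R \<in> Z \<Longrightarrow> cadjoint R \<in> Z" and T: "T \<in> commutant Z"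
  shows "cadjoint T \<in> commutant Z"
proof -
  have Tb: "T \<in> bounded_ops" using T by (simp add: commutant_def)
  have "R (cadjoint T x) = cadjoint T (R x)" if R: "R \<in> Z" for R x
  proof (rule cinner_ext)
    fix g
    have Rb: "R \<in> bounded_ops" using R Z by blast
    have "cadjoint R (T g) = T (cadjoint R g)" using T Z(2)[OF R] by (simp add: commutant_def)
    then show "cinner (R (cadjoint T x)) g = cinner (cadjoint T (R x)) g"
      by (simp add: cinner_cadjoint[OF Rb] cinner_cadjoint_left[OF Tb])
  qed
  then show ?thesis using cadjoint_bounded_ops[OF Tb] by (simp add: commutant_def)
qed

text \<open>The bicommutant of the masa together with \<open>T\<close> is an abelian self-adjoint algebra, hence equal to the masa.\<close>

lemma masa_contains_commuting_selfadjoint: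
  fixes M :: "('h::complex_hilbert \<Rightarrow> 'h) set"
  assumes M: "masa M" and T: "T \<in> bounded_ops" and sa: "cadjoint T = T"
    and comm: "\<And>S x. S \<in> M \<Longrightarrow> S (T x) = T (S x)"
  shows "T \<in> M"
proof -
  have Malg: "abelian_selfadjoint_subalgebra M" using M by (simp add: masa_def)
  have Mb: "M \<subseteq> bounded_ops" and Mstar: "\<And>S. S \<in> M \<Longrightarrow> cadjoint S \<in> M"
    and Mab: "\<And>S R x. S \<in> M \<Longrightarrow> R \<in> M \<Longrightarrow> S (R x) = R (S x)"
    using Malg by (auto simp: abelian_selfadjoint_subalgebra_def operator_subalgebra_def fun_eq_iff)
  let ?X = "insert T M"
  let ?M = "commutant (commutant ?X)"
  have Xb: "?X \<subseteq> bounded_ops" and Xstar: "\<And>R. R \<in> ?X \<Longrightarrow> cadjoint R \<in> ?X"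
    using Mb T Mstar sa by auto
  have cb: "commutant Z \<subseteq> bounded_ops" for Z :: "('h \<Rightarrow> 'h) set" by (auto simp: commutant_def)
  have sub: "?X \<subseteq> ?M" using Xb by (auto simp: commutant_def)
  have "?X \<subseteq> commutant ?X" using Xb comm Mab by (auto simp: commutant_def)
  then have ab: "?M \<subseteq> commutant ?X" by (auto simp: commutant_def)
  have "abelian_selfadjoint_subalgebra ?M"
    unfolding abelian_selfadjoint_subalgebra_def
  proof (intro conjI ballI)
    show "operator_subalgebra ?M" by (rule operator_subalgebra_commutant[OF cb])
    show "cadjoint R \<in> ?M" if "R \<in> ?M" for R
      by (rule cadjoint_commutant[OF cb cadjoint_commutant[OF Xb Xstar] that])
    show "R \<circ> S = S \<circ> R" if "R \<in> ?M" "S \<in> ?M" for R S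
    proof
      show "(R \<circ> S) x = (S \<circ> R) x" for x
        using that(2) subsetD[OF ab that(1)] unfolding commutant_def[of "commutant ?X"] by auto
    qed
  qed
  then have "?M = M" using M sub by (auto simp: masa_def)
  then show ?thesis using sub by blast
qed

lemma masa_contains_ident:
  fixes M :: "('h::complex_hilbert \<Rightarrow> 'h) set"
  assumes "masa M" shows "(\<lambda>x. x) \<in> M"
  by (rule masa_contains_commuting_selfadjoint[OF assms bounded_ops_ident]) (auto intro: cadjoint_eqI)

section \<open>Invariant projections\<close>

text \<open>The assumption \<open>dense\<close> says that \<open>D\<close> and its adjoints together span a weakly dense subspace of the bounded
  operators; this is all that is kept of the Dirichlet property and of irreducibility.\<close>

locale masa_algebra =
  fixes D M :: "('h::complex_hilbert \<Rightarrow> 'h) set"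
  assumes D: "operator_subalgebra D" and M: "masa M" and M_sub: "M \<subseteq> annihilator_closure D"
    and dense: "\<And>n x y X. (\<And>S. S \<in> D \<Longrightarrow> tuple_inner n (\<lambda>i. S (x i)) y = 0) \<Longrightarrow>
      (\<And>S. S \<in> D \<Longrightarrow> tuple_inner n (\<lambda>i. cadjoint S (x i)) y = 0) \<Longrightarrow>
      X \<in> bounded_ops \<Longrightarrow> tuple_inner n (\<lambda>i. X (x i)) y = 0"
begin

abbreviation "B \<equiv> annihilator_closure D"
abbreviation "L \<equiv> Lat D"

definition below :: "('h \<Rightarrow> 'h) \<Rightarrow> ('h \<Rightarrow> 'h) \<Rightarrow> bool" where
  "below P Q \<longleftrightarrow> (\<forall>h. Q (P h) = P h)"

lemma D_bounded: "S \<in> D \<Longrightarrow> S \<in> bounded_ops"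
  using D by (auto simp: operator_subalgebra_def)

lemma D_sub_B: "S \<in> D \<Longrightarrow> S \<in> B"
  using annihilator_closure_superset[of D] D_bounded by blast

lemma M_facts:
  shows M_bounded: "S \<in> M \<Longrightarrow> S \<in> bounded_ops" and M_B: "S \<in> M \<Longrightarrow> S \<in> B"
    and M_adjoint: "S \<in> M \<Longrightarrow> cadjoint S \<in> M"
    and M_commute: "S \<in> M \<Longrightarrow> R \<in> M \<Longrightarrow> S (R x) = R (S x)"
proof -
  have *: "abelian_selfadjoint_subalgebra M" using M by (simp add: masa_def)
  then show "S \<in> M \<Longrightarrow> cadjoint S \<in> M" by (simp add: abelian_selfadjoint_subalgebra_def)
  show "S \<in> M \<Longrightarrow> R \<in> M \<Longrightarrow> S (R x) = R (S x)"
    using * unfolding abelian_selfadjoint_subalgebra_def by (metis comp_apply)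
  show "S \<in> M \<Longrightarrow> S \<in> B" using M_sub by blast
  then show "S \<in> M \<Longrightarrow> S \<in> bounded_ops" using annihilator_closure_bounded by blast
qed

lemma ident_B: "(\<lambda>h. h) \<in> B"
  using M_B[OF masa_contains_ident[OF M]] .

lemma L_projection: "P \<in> L \<Longrightarrow> orth_projection P"
  by (simp add: Lat_def)

lemmas L_D = orth_projectionD[OF L_projection]

lemma L_iff: "P \<in> L \<longleftrightarrow> orth_projection P \<and> (\<forall>S\<in>D. \<forall>h. P h = h \<longrightarrow> P (S h) = S h)"
proof (cases "orth_projection P")
  case True
  have "leaves_invariant S P \<longleftrightarrow> (\<forall>h. P h = h \<longrightarrow> P (S h) = S h)" for S
  proof -
    have "leaves_invariant S P \<longleftrightarrow> (\<forall>h\<in>range P. S h \<in> range P)"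
      unfolding leaves_invariant_def by (rule image_subset_iff)
    also have "\<dots> \<longleftrightarrow> (\<forall>h. P h = h \<longrightarrow> P (S h) = S h)"
      unfolding Ball_def orth_projectionD(4)[OF True] ..
    finally show ?thesis .
  qed
  then show ?thesis by (simp add: Lat_def)
qed (simp add: Lat_def)

lemma L_invariant:
  assumes P: "P \<in> L" and S: "S \<in> B" and h: "P h = h"
  shows "P (S h) = S h"
proof (rule cinner_ext)
  fix g
  have "tuple_inner 1 (\<lambda>i. S h) (\<lambda>_. g - P g) = 0"
  proof (rule annihilator_closureD[OF S])
    fix R assume "R \<in> D"
    then have "P (R h) = R h" using P h by (simp add: L_iff)
    then have "cinner (R h) (P g) = cinner (R h) g" using L_D(3)[OF P, of "R h" g] by simp
    then show "tuple_inner 1 (\<lambda>i. R h) (\<lambda>_. g - P g) = 0" by (simp add: tuple_inner_def cinner_diff_right)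
  qed
  then show "cinner (P (S h)) g = cinner (S h) g"
    by (simp add: tuple_inner_def cinner_diff_right L_D(3)[OF P])
qed

text \<open>The masa is self-adjoint and leaves the range of \<open>P\<close> invariant, so the range reduces it.\<close>

lemma L_commutes_M:
  assumes P: "P \<in> L" and S: "S \<in> M" shows "S (P h) = P (S h)"
proof -
  note Sb = M_bounded[OF S]
  have 1: "P (R (P h)) = R (P h)" if "R \<in> M" for R h
    by (rule L_invariant[OF P M_B[OF that] L_D(2)[OF P]])
  have "P (S h) = P (S (P h))"
  proof (rule cinner_ext)
    fix g
    have "cinner (P (S h)) g = cinner h (cadjoint S (P g))"
      by (simp add: L_D(3)[OF P] cinner_cadjoint[OF Sb])
    also have "\<dots> = cinner h (P (cadjoint S (P g)))" by (simp only: 1[OF M_adjoint[OF S]])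
    also have "\<dots> = cinner (P (S (P h))) g"
      by (simp add: L_D(3)[OF P] cinner_cadjoint[OF Sb])
    finally show "cinner (P (S h)) g = cinner (P (S (P h))) g" .
  qed
  then show ?thesis by (simp only: 1[OF S])
qed

lemma L_subset_M:
  assumes P: "P \<in> L" shows "P \<in> M"
proof (rule masa_contains_commuting_selfadjoint[OF M L_D(1)[OF P]])
  show "cadjoint P = P" by (rule cadjoint_eqI) (rule L_D(3)[OF P])
qed (rule L_commutes_M[OF P])

lemma range_subset_iff_below:
  assumes "P \<in> L" "Q \<in> L" shows "range P \<subseteq> range Q \<longleftrightarrow> below P Q"
  unfolding below_def using L_D(4)[OF assms(2)] by blast

lemma below_swap:
  assumes "P \<in> L" "Q \<in> L" "below P Q" shows "P (Q h) = P h"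
  using M_commute[OF L_subset_M[OF assms(1)] L_subset_M[OF assms(2)], of h] assms(3)
  by (simp add: below_def)

lemma below_trans: "P \<in> L \<Longrightarrow> Q \<in> L \<Longrightarrow> R \<in> L \<Longrightarrow> below P Q \<Longrightarrow> below Q R \<Longrightarrow> below P R"
  unfolding below_def by metis

lemma zero_L: "(\<lambda>h. 0) \<in> L" and ident_L: "(\<lambda>h. h) \<in> L"
  using D_bounded by (auto simp: L_iff bounded_ops_zero bounded_ops_ident bounded_ops_linear intro!: orth_projectionI)

text \<open>Otherwise there are nonzero vectors \<open>v\<close> in the range of \<open>P - PQ\<close> and \<open>u\<close> in the range of \<open>Q - PQ\<close>.  The functional
  \<open>X \<mapsto> cinner (X u) v\<close> kills \<open>D\<close> and its adjoints, but not the rank-one operator taking \<open>u\<close> to a multiple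
  of \<open>v\<close>.\<close>

lemma L_total:
  assumes P: "P \<in> L" and Q: "Q \<in> L"
  shows "below P Q \<or> below Q P"
proof (rule ccontr)
  assume "\<not> (below P Q \<or> below Q P)"
  then obtain g g' where g: "Q (P g) \<noteq> P g" and g': "P (Q g') \<noteq> Q g'" by (auto simp: below_def)
  have comm: "P (Q h) = Q (P h)" for h by (rule M_commute[OF L_subset_M[OF P] L_subset_M[OF Q]])
  define v where "v = P g - Q (P g)"
  define u where "u = Q g' - P (Q g')"
  have v: "P v = v" "Q v = 0" and u: "Q u = u" "P u = 0"
    unfolding v_def u_def
    by (simp_all add: bounded_ops_linear[OF L_D(1)[OF P]] bounded_ops_linear[OF L_D(1)[OF Q]]
        L_D(2)[OF P] L_D(2)[OF Q] comm)
  have "tuple_inner 1 (\<lambda>i. cinner u u *\<^sub>C v) (\<lambda>_. v) = 0"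
  proof (rule dense[of 1 "\<lambda>_. u" "\<lambda>_. v" "\<lambda>h. cinner h u *\<^sub>C v"])
    fix S assume S: "S \<in> D"
    have "cinner (S u) v = cinner (S u) (Q v)"
      using L_invariant[OF Q D_sub_B[OF S] u(1)] L_D(3)[OF Q, of "S u" v] by simp
    then show "tuple_inner 1 (\<lambda>i. S u) (\<lambda>_. v) = 0" by (simp add: v tuple_inner_def)
    have "cinner u (S v) = cinner (P u) (S v)"
      using L_invariant[OF P D_sub_B[OF S] v(1)] L_D(3)[OF P, of u "S v"] by simp
    then show "tuple_inner 1 (\<lambda>i. cadjoint S u) (\<lambda>_. v) = 0"
      by (simp add: u tuple_inner_def cinner_cadjoint_left[OF D_bounded[OF S]])
  next
    show "(\<lambda>h. cinner h u *\<^sub>C v) \<in> bounded_ops"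
    proof (rule bounded_opsI[where K = "norm u * norm v"])
      show "norm (cinner h u *\<^sub>C v) \<le> norm h * (norm u * norm v)" for h
        using mult_right_mono[OF cinner_Cauchy_Schwarz[of h u], of "norm v"]
        by (simp add: norm_scaleC mult.assoc)
    qed (simp_all add: cinner_add_left cinner_scaleC_left scaleC_add_left scaleC_scaleC)
  qed
  then have "u = 0 \<or> v = 0" by (auto simp: tuple_inner_def cinner_scaleC_left cinner_self)
  then show False using g g' by (auto simp: u_def v_def)
qed

lemma nest_L: "nest L"
  unfolding nest_def using L_projection L_total range_subset_iff_below by blast

text \<open>Compressing to the block maps \<open>D\<close> into \<open>B\<close> and maps the adjoints of \<open>D\<close> to 0, because \<open>S\<close> maps the range of \<open>Q\<close>
  into itself.  So the compression maps everything into \<open>B\<close>.\<close>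

lemma off_diagonal:
  assumes P: "P \<in> L" and Q: "Q \<in> L" and R: "R \<in> L" and PQ: "below P Q" and QR: "below Q R"
    and X: "X \<in> bounded_ops"
  shows "(\<lambda>h. Q (X (R h - Q h)) - P (X (R h - Q h))) \<in> B"
  unfolding annihilator_closure_def
proof (intro CollectI conjI allI impI)
  note b = L_D(1)[OF P] L_D(1)[OF Q] L_D(1)[OF R]
  have d2: "(\<lambda>h. R h - Q h) \<in> bounded_ops" by (rule bounded_ops_diff[OF b(3,2)])
  have d1: "(\<lambda>h. Q h - P h) \<in> B" "(\<lambda>h. R h - Q h) \<in> B"
    using P Q R by (intro annihilator_closure_diff M_B L_subset_M; simp)+
  show "(\<lambda>h. Q (X (R h - Q h)) - P (X (R h - Q h))) \<in> bounded_ops"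
    by (rule bounded_ops_compose[OF bounded_ops_diff[OF b(2,1)] bounded_ops_compose[OF X d2]])
  fix n and x y :: "nat \<Rightarrow> 'h"
  assume ann: "\<forall>S\<in>D. tuple_inner n (\<lambda>i. S (x i)) y = 0"
  have sa: "tuple_inner n (\<lambda>i. Q (w i) - P (w i)) y = tuple_inner n w (\<lambda>i. Q (y i) - P (y i))" for w
    by (simp add: tuple_inner_def cinner_diff_left cinner_diff_right L_D(3)[OF P] L_D(3)[OF Q])
  have "tuple_inner n (\<lambda>i. X (R (x i) - Q (x i))) (\<lambda>i. Q (y i) - P (y i)) = 0"
  proof (rule dense[OF _ _ X])
    fix S assume S: "S \<in> D"
    have "(\<lambda>h. Q (S (R h - Q h)) - P (S (R h - Q h))) \<in> B"
      by (rule annihilator_closure_compose[OF D d1(1) annihilator_closure_compose[OF D D_sub_B[OF S] d1(2)]])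
    from annihilator_closureD[OF this, of n x y] ann
    show "tuple_inner n (\<lambda>i. S (R (x i) - Q (x i))) (\<lambda>i. Q (y i) - P (y i)) = 0"
      by (simp add: sa)
    have "cinner (cadjoint S (R h - Q h)) (Q g - P g) = 0" for h g
    proof -
      have "Q (Q g - P g) = Q g - P g" using PQ
        by (simp add: bounded_ops_linear[OF b(2)] L_D(2)[OF Q] below_def)
      then have "Q (S (Q g - P g)) = S (Q g - P g)" by (rule L_invariant[OF Q D_sub_B[OF S]])
      then have "cinner (R h - Q h) (S (Q g - P g)) = cinner (Q (R h - Q h)) (S (Q g - P g))"
        using L_D(3)[OF Q, of "R h - Q h" "S (Q g - P g)"] by simp
      also have "Q (R h - Q h) = 0"
        using below_swap[OF Q R QR] by (simp add: bounded_ops_linear[OF b(2)] L_D(2)[OF Q])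
      finally show ?thesis by (simp add: cinner_cadjoint_left[OF D_bounded[OF S]])
    qed
    then show "tuple_inner n (\<lambda>i. cadjoint S (R (x i) - Q (x i))) (\<lambda>i. Q (y i) - P (y i)) = 0"
      by (simp add: tuple_inner_def)
  qed
  then show "tuple_inner n (\<lambda>i. Q (X (R (x i) - Q (x i))) - P (X (R (x i) - Q (x i)))) y = 0"
    unfolding sa .
qed

end

section \<open>Splitting compressions along the nest\<close>

lemma Re_tuple_inner_le:
  "Re (tuple_inner n v w) \<le> sqrt (tuple_norm2 n v) * sqrt (tuple_norm2 n w)"
proof -
  have "Re (tuple_inner n v w) \<le> (\<Sum>i<n. norm (v i) * norm (w i))"
    unfolding tuple_inner_def Re_sum by (intro sum_mono Re_cinner_le)
  also have "\<dots> \<le> L2_set (\<lambda>i. norm (v i)) {..<n} * L2_set (\<lambda>i. norm (w i)) {..<n}"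
    using L2_set_mult_ineq[of "\<lambda>i. norm (v i)" "\<lambda>i. norm (w i)" "{..<n}"] by simp
  finally show ?thesis by (simp add: L2_set_def tuple_norm2_def)
qed

text \<open>An invariant subspace of the \<open>n\<close>-fold ampliation of \<open>B\<close>.  It reduces the masa, so the matrix of its
  projection has entries in the masa.\<close>

locale invariant_tuple_space = masa_algebra D M + projection_matrix n Y q
  for D M :: "('h::complex_hilbert \<Rightarrow> 'h) set" and n :: nat and Y :: "(nat \<Rightarrow> 'h) set"
    and q :: "nat \<Rightarrow> nat \<Rightarrow> 'h \<Rightarrow> 'h" +
  assumes K_inv: "S \<in> annihilator_closure D \<Longrightarrow> v \<in> tuple_perp n Y \<Longrightarrow> (\<lambda>i. S (v i)) \<in> tuple_perp n Y"
begin

lemma q_commutes_M: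
  assumes "S \<in> M" "a < n" "b < n" shows "S (q a b h) = q a b (S h)"
  by (rule q_commute[OF M_bounded[OF assms(1)] _ _ assms(2,3)])
    (use K_inv M_B M_adjoint assms(1) in auto)

lemma compression_commutes_M: "S \<in> M \<Longrightarrow> S (compression \<xi> h) = compression \<xi> (S h)"
  by (rule compression_commute[OF M_bounded]) (auto intro: q_commutes_M)

text \<open>Let \<open>w\<close> be the projection of the tuple \<open>(\<xi> i h)\<close>.  As \<open>(X w)\<close> stays in the invariant subspace, pairing it with
  \<open>(\<xi> i g)\<close>, \<open>g = X (m h)\<close>, is pairing it with the projection of that tuple, whose norm is at most
  \<open>sqrt l * norm g\<close> because \<open>m \<le> l\<close> on the range of \<open>X\<close>.  The squared norm of \<open>w\<close> is the form at \<open>h\<close>, which is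
  at most \<open>(norm (m h))\<^sup>2 / u\<close> by the lower bound at \<open>h\<close>.\<close>

lemma compression_estimate:
  assumes X: "X \<in> B" and bound: "\<And>h. norm (X h) \<le> k * norm h"
    and E: "\<And>g. Re (cinner (compression \<xi> (X g)) (X g)) \<le> l * (norm (X g))\<^sup>2"
    and l: "l \<ge> 0" and u: "u > 0" and h: "u * (norm h)\<^sup>2 \<le> Re (cinner (compression \<xi> h) h)"
  shows "norm (X (compression \<xi> h)) \<le> sqrt (l / u) * k * norm (compression \<xi> h)"
proof -
  let ?m = "compression \<xi>"
  let ?w = "proj (\<lambda>i. \<xi> i *\<^sub>C h)"
  define g where "g = X (?m h)"
  note Xb = annihilator_closure_bounded[OF X]
  have Xw: "(\<lambda>i. X (?w i)) \<in> tuple_perp n Y" by (rule K_inv[OF X proj_in])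
  let ?g = "proj (\<lambda>i. \<xi> i *\<^sub>C g)"
  have "cinner (X (?m h)) g = tuple_inner n (\<lambda>i. X (?w i)) (\<lambda>i. \<xi> i *\<^sub>C g)"
    by (simp add: compression_eq bounded_ops_linear[OF Xb] tuple_inner_def cinner_sum_left
        cinner_scaleC_left cinner_scaleC_right)
  also have "\<dots> = tuple_inner n (proj (\<lambda>i. X (?w i))) (\<lambda>i. \<xi> i *\<^sub>C g)"
    by (rule tuple_inner_cong) (auto simp: proj_fix[OF Xw])
  also have "\<dots> = tuple_inner n (\<lambda>i. X (?w i)) ?g" by (rule proj_selfadjoint)
  finally have "(norm g)\<^sup>2 = Re (tuple_inner n (\<lambda>i. X (?w i)) ?g)"
    by (metis g_def Re_cinner_self)
  also have "\<dots> \<le> sqrt (tuple_norm2 n (\<lambda>i. X (?w i))) * sqrt (tuple_norm2 n ?g)"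
    by (rule Re_tuple_inner_le)
  finally have ng: "(norm g)\<^sup>2 \<le> sqrt (tuple_norm2 n (\<lambda>i. X (?w i))) * sqrt (tuple_norm2 n ?g)" .
  have "tuple_norm2 n (\<lambda>i. X (?w i)) \<le> k\<^sup>2 * tuple_norm2 n ?w"
    unfolding tuple_norm2_def sum_distrib_left
    by (intro sum_mono) (use power_mono[OF bound norm_ge_zero, of _ 2] in \<open>simp add: power_mult_distrib\<close>)
  also have "tuple_norm2 n ?w = Re (cinner (?m h) h)" by (rule compression_form[symmetric])
  also have "k\<^sup>2 * \<dots> \<le> k\<^sup>2 * ((norm (?m h))\<^sup>2 / u)"
  proof (rule mult_left_mono)
    have "u * (norm h * norm h) \<le> norm (?m h) * norm h"
      using h Re_cinner_le[of "?m h" h] by (simp add: power2_eq_square)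
    then have "u * norm h \<le> norm (?m h)" by (cases "h = 0") auto
    then have "norm h \<le> norm (?m h) / u" using u by (simp add: field_simps)
    then have "norm (?m h) * norm h \<le> norm (?m h) * (norm (?m h) / u)" by (rule mult_left_mono) simp
    then show "Re (cinner (?m h) h) \<le> (norm (?m h))\<^sup>2 / u"
      using Re_cinner_le[of "?m h" h] by (simp add: power2_eq_square)
  qed simp
  finally have 1: "tuple_norm2 n (\<lambda>i. X (?w i)) \<le> k\<^sup>2 * ((norm (?m h))\<^sup>2 / u)" .
  have 2: "tuple_norm2 n ?g \<le> l * (norm g)\<^sup>2"
    using E[of "?m h"] by (simp add: compression_form[symmetric] g_def)
  have k: "k \<ge> 0 \<or> g = 0"
  proof (cases "?m h = 0")
    case False
    then show ?thesis using order_trans[OF norm_ge_zero bound[of "?m h"]] by (simp add: zero_le_mult_iff)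
  qed (simp add: g_def bounded_ops_linear[OF Xb])
  show ?thesis
  proof (cases "g = 0")
    case True
    have "k * norm (?m h) \<ge> 0" by (rule order_trans[OF norm_ge_zero bound])
    then have "sqrt (l / u) * (k * norm (?m h)) \<ge> 0"
      by (rule mult_nonneg_nonneg[rotated]) (use l u in simp)
    then show ?thesis using True by (simp add: g_def mult.assoc)
  next
    case False
    have k0: "k \<ge> 0" using k False by simp
    have "(norm g)\<^sup>2 \<le> sqrt (k\<^sup>2 * ((norm (?m h))\<^sup>2 / u)) * sqrt (l * (norm g)\<^sup>2)"
      by (rule order_trans[OF ng]) (intro mult_mono real_sqrt_le_mono 1 2; simp add: u less_imp_le)
    also have "\<dots> = (sqrt (l / u) * k * norm (?m h)) * norm g"
      using k0 by (simp add: real_sqrt_mult real_sqrt_divide)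
    finally show ?thesis using False by (simp add: g_def[symmetric] power2_eq_square)
  qed
qed

text \<open>The block \<open>X\<close> of \<open>S\<close> from the part where \<open>m \<ge> u\<close> to the part where \<open>m \<le> l\<close> satisfies
  \<open>norm X \<le> sqrt (l / u) * norm X\<close>, by the preceding estimate and the density of the range of \<open>m\<close> in the
  first part.  As \<open>l < u\<close>, it vanishes.\<close>

lemma compression_separation:
  assumes S: "S \<in> B" and lu: "l < u"
    and E: "orth_projection E" "E \<in> M" "\<And>h. E h = 0 \<Longrightarrow> Re (cinner (compression \<xi> h) h) \<le> l * (norm h)\<^sup>2"
    and F: "orth_projection F" "F \<in> M" "\<And>h. F h = h \<Longrightarrow> u * (norm h)\<^sup>2 \<le> Re (cinner (compression \<xi> h) h)"
  shows "E (S (F h)) = S (F h)"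
proof -
  let ?m = "compression \<xi>"
  note Eb = orth_projectionD(1)[OF E(1)] and Fb = orth_projectionD(1)[OF F(1)]
  define X where "X g = S (F g) - E (S (F g))" for g
  have SF: "(\<lambda>g. S (F g)) \<in> B" by (rule annihilator_closure_compose[OF D S M_B[OF F(2)]])
  have X: "X \<in> B" unfolding X_def
    by (rule annihilator_closure_diff[OF SF annihilator_closure_compose[OF D M_B[OF E(2)] SF]])
  note Xb = annihilator_closure_bounded[OF X]
  have EX: "E (X g) = 0" for g
    by (simp add: X_def bounded_ops_linear[OF Eb] orth_projectionD(2)[OF E(1)])
  have XF: "X g = X (F g)" for g by (simp add: X_def orth_projectionD(2)[OF F(1)])
  have form0: "0 \<le> Re (cinner (?m g) g)" for g by (simp add: compression_form)
  have "X g = 0" for g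
  \<comment> \<open>the form is nonnegative, so a negative \<open>l\<close> leaves no room for the range of \<open>X\<close>\<close>
  proof (cases "l < 0")
    case True
    have "0 \<le> l * (norm (X g))\<^sup>2" using form0[of "X g"] E(3)[OF EX, of g] by linarith
    then show ?thesis using True by (auto simp: zero_le_mult_iff)
  next
    case False
    then have l: "l \<ge> 0" and u: "u > 0" using lu by auto
    define k where "k = onorm X"
    define r where "r = sqrt (l / u)"
    have r: "r < 1" "r \<ge> 0" unfolding r_def using l u lu by (auto simp: real_sqrt_lt_1_iff)
    have bl: "bounded_linear X" by (rule bounded_ops_linear(8)[OF Xb])
    have k: "norm (X g) \<le> k * norm g" for g unfolding k_def by (rule onorm[OF bl])
    let ?V = "?m ` {h. F h = h}"
    have "norm (X f) \<le> r * k * norm f" if f: "F f = f" for f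
    proof -
      have "f \<in> closure ?V"
      proof (rule double_perp_subset_closure)
        show "0 \<in> ?V" using bounded_ops_linear(4)[OF compression_bounded] bounded_ops_linear(4)[OF Fb]
          by (auto intro!: image_eqI[of _ _ 0])
        show "x + y \<in> ?V" if "x \<in> ?V" "y \<in> ?V" for x y
          using that by (auto simp: bounded_ops_linear(1)[OF compression_bounded, symmetric] bounded_ops_linear(1)[OF Fb])
        show "c *\<^sub>C x \<in> ?V" if "x \<in> ?V" for c x
          using that by (auto simp: bounded_ops_linear(3)[OF compression_bounded, symmetric] bounded_ops_linear(3)[OF Fb])
        fix y assume y: "\<And>v. v \<in> ?V \<Longrightarrow> cinner v y = 0"
        have "cinner (?m (F y)) y = 0" by (rule y) (simp add: orth_projectionD(2)[OF F(1)])
        moreover have "F (?m (F y)) = ?m (F y)"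
          by (simp add: compression_commutes_M[OF F(2)] orth_projectionD(2)[OF F(1)])
        ultimately have "cinner (?m (F y)) (F y) = 0"
          using orth_projectionD(3)[OF F(1), of "?m (F y)" y] by simp
        then have "u * (norm (F y))\<^sup>2 \<le> 0"
          using F(3)[of "F y"] by (simp add: orth_projectionD(2)[OF F(1)])
        then have "F y = 0" using u by (simp add: mult_le_0_iff)
        then show "cinner f y = 0" using orth_projectionD(3)[OF F(1), of f y] f by simp
      qed
      moreover have "closed {f. norm (X f) \<le> r * k * norm f}"
        by (intro closed_Collect_le continuous_intros linear_continuous_on bl)
      moreover have "?V \<subseteq> {f. norm (X f) \<le> r * k * norm f}"
        using compression_estimate[OF X k E(3)[OF EX] l u F(3)] by (auto simp: r_def)
      ultimately show ?thesis using closure_minimal[of ?V] by blast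
    qed
    then have XrF: "norm (X g) \<le> r * k * norm (F g)" for g
      using XF[of g] orth_projectionD(2)[OF F(1), of g] by metis
    have k0: "k \<ge> 0" unfolding k_def by (rule onorm_pos_le[OF bl])
    have "norm (X g) \<le> r * k * norm g" for g
      by (rule order_trans[OF XrF mult_left_mono[OF orth_projection_norm_le[OF F(1)]]]) (simp add: r k0)
    then have "k \<le> r * k" unfolding k_def by (intro onorm_bound) (simp_all add: r k0[unfolded k_def])
    then have "k * (1 - r) \<le> 0" by (simp add: algebra_simps)
    then have "k = 0" using k0 r by (auto simp: mult_le_0_iff)
    then show ?thesis using k[of g] by simp
  qed
  then show ?thesis by (simp add: X_def)
qed

text \<open>The projection \<open>R\<close> onto the \<open>B\<close>-invariant subspace generated by the part where \<open>m \<ge> u\<close>; this subspace stays within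
  the part where \<open>m \<ge> l\<close>.\<close>

lemma compression_split:
  assumes lu: "l < u"
  obtains R where "R \<in> L" "\<And>h. R h = h \<Longrightarrow> l * (norm h)\<^sup>2 \<le> Re (cinner (compression \<xi> h) h)"
    "\<And>h. R h = 0 \<Longrightarrow> Re (cinner (compression \<xi> h) h) \<le> u * (norm h)\<^sup>2"
proof -
  let ?m = "compression \<xi>"
  have ex: "\<exists>E. orth_projection E \<and> E \<in> M \<and> (\<forall>h. E h = h \<longrightarrow> r * (norm h)\<^sup>2 \<le> Re (cinner (?m h) h)) \<and>
      (\<forall>h. E h = 0 \<longrightarrow> Re (cinner (?m h) h) \<le> r * (norm h)\<^sup>2)" for r
  proof -
    obtain E where E: "orth_projection E"
      "\<And>S h. S \<in> bounded_ops \<Longrightarrow> (\<And>x. S (?m x) = ?m (S x)) \<Longrightarrow> S (E h) = E (S h)"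
      "\<And>h. E h = h \<Longrightarrow> r * (norm h)\<^sup>2 \<le> Re (cinner (?m h) h)"
      "\<And>h. E h = 0 \<Longrightarrow> Re (cinner (?m h) h) \<le> r * (norm h)\<^sup>2"
      by (rule spectral_projection_exists[OF compression_bounded[of \<xi>] compression_selfadjoint, where r = r]) blast
    have "E \<in> M"
    proof (rule masa_contains_commuting_selfadjoint[OF M orth_projectionD(1)[OF E(1)]])
      show "cadjoint E = E" using E(1) by (simp add: orth_projection_def)
      show "S (E x) = E (S x)" if "S \<in> M" for S x
        by (rule E(2)[OF M_bounded[OF that] compression_commutes_M[OF that]])
    qed
    then show ?thesis using E(1,3,4) by blast
  qed
  obtain E where E: "orth_projection E" "E \<in> M" "\<And>h. E h = h \<Longrightarrow> l * (norm h)\<^sup>2 \<le> Re (cinner (?m h) h)"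
    "\<And>h. E h = 0 \<Longrightarrow> Re (cinner (?m h) h) \<le> l * (norm h)\<^sup>2" using ex[of l] by blast
  obtain F where F: "orth_projection F" "F \<in> M" "\<And>h. F h = h \<Longrightarrow> u * (norm h)\<^sup>2 \<le> Re (cinner (?m h) h)"
    "\<And>h. F h = 0 \<Longrightarrow> Re (cinner (?m h) h) \<le> u * (norm h)\<^sup>2" using ex[of u] by blast
  let ?Z = "{y. \<forall>S\<in>B. \<forall>h. cinner (S (F h)) y = 0}"
  obtain R where R: "orth_projection R" "\<And>h. R h = h \<longleftrightarrow> (\<forall>y\<in>?Z. cinner h y = 0)"
    by (rule perp_projection[of ?Z]) blast
  have "R \<in> L" unfolding L_iff
  proof (intro conjI ballI allI impI)
    fix S h assume S: "S \<in> D" and h: "R h = h"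
    have "cinner (S h) y = 0" if y: "y \<in> ?Z" for y
    proof -
      have "cadjoint S y \<in> ?Z"
      proof (intro CollectI ballI allI)
        fix T h assume T: "T \<in> B"
        have "(\<lambda>x. S (T x)) \<in> B" by (rule annihilator_closure_compose[OF D D_sub_B[OF S] T])
        moreover have "\<forall>S\<in>B. \<forall>h. cinner (S (F h)) y = 0" using y by simp
        ultimately have "cinner (S (T (F h))) y = 0" by (auto dest: bspec)
        then show "cinner (T (F h)) (cadjoint S y) = 0" by (simp add: cinner_cadjoint[OF D_bounded[OF S]])
      qed
      then show ?thesis using h R(2)[of h] by (simp add: cinner_cadjoint[OF D_bounded[OF S]])
    qed
    then show "R (S h) = S h" by (simp add: R(2))
  qed (rule R(1))
  moreover have "E h = h" if "R h = h" for h
  proof -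
    have "cinner h (g - E g) = 0" for g
    proof -
      have "g - E g \<in> ?Z"
      proof (intro CollectI ballI allI)
        fix S h assume "S \<in> B"
        then have "E (S (F h)) = S (F h)" by (rule compression_separation[OF _ lu E(1,2,4) F(1-3)])
        then show "cinner (S (F h)) (g - E g) = 0"
          using orth_projectionD(3)[OF E(1), of "S (F h)" g] by (simp add: cinner_diff_right)
      qed
      then show ?thesis using that R(2)[of h] by blast
    qed
    then show ?thesis by (intro cinner_ext) (simp add: cinner_diff_right orth_projectionD(3)[OF E(1)])
  qed
  moreover have "F h = 0" if "R h = 0" for h
  proof (rule cinner_eq_0_imp)
    fix g
    have "R (F g) = F g" unfolding R(2)
    proof
      fix y assume "y \<in> ?Z"
      then have "\<forall>S\<in>B. \<forall>h. cinner (S (F h)) y = 0" by simp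
      from bspec[OF this ident_B] show "cinner (F g) y = 0" by simp
    qed
    then show "cinner (F h) g = 0"
      using orth_projectionD(3)[OF R(1), of h "F g"] that by (simp add: orth_projectionD(3)[OF F(1)])
  qed
  ultimately show thesis using that E(3) F(4) by blast
qed

end

section \<open>Refining intervals of the nest\<close>

context masa_algebra
begin

text \<open>The vectors of the interval \<open>Q - P\<close> of the nest.\<close>

definition between :: "('h \<Rightarrow> 'h) \<Rightarrow> ('h \<Rightarrow> 'h) \<Rightarrow> 'h \<Rightarrow> bool" where
  "between P Q h \<longleftrightarrow> Q h = h \<and> P h = 0"

definition form_in :: "('h \<Rightarrow> 'h) \<Rightarrow> ('h \<Rightarrow> 'h) \<Rightarrow> ('h \<Rightarrow> 'h) \<Rightarrow> real \<Rightarrow> real \<Rightarrow> bool" where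
  "form_in m P Q \<alpha> \<beta> \<longleftrightarrow> (\<forall>h. between P Q h \<longrightarrow>
     \<alpha> * (norm h)\<^sup>2 \<le> Re (cinner (m h) h) \<and> Re (cinner (m h) h) \<le> \<beta> * (norm h)\<^sup>2)"

lemma between_mono:
  assumes "P \<in> L" "P' \<in> L" "Q \<in> L" "Q' \<in> L" "below P P'" "below Q' Q" "between P' Q' h"
  shows "between P Q h"
proof -
  have "Q h = h" using assms(6,7) by (metis below_def between_def)
  moreover have "P h = P (P' h)" by (rule below_swap[OF assms(1,2,5), symmetric])
  then have "P h = 0" using assms(7) by (simp add: between_def bounded_ops_linear(4)[OF L_D(1)[OF assms(1)]])
  ultimately show ?thesis by (simp add: between_def)
qed

text \<open>A property of intervals that is inherited by adjacent unions holds for all intervals once it holds for those on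
  which the form of \<open>m\<close> varies by at most \<open>2 * \<epsilon>\<close>.  If the form varies by \<open>(k + 1) * \<epsilon>\<close>, splitting the nest
  between \<open>\<alpha> + \<epsilon>\<close> and \<open>\<alpha> + 2 * \<epsilon>\<close> leaves an interval of variation \<open>2 * \<epsilon>\<close> and one of variation \<open>k * \<epsilon>\<close>.
  The induction replaces the choice of a finite partition of the nest.\<close>

lemma refine_along_operator:
  fixes G :: "('h \<Rightarrow> 'h) \<Rightarrow> ('h \<Rightarrow> 'h) \<Rightarrow> bool"
  assumes add: "\<And>P R Q. P \<in> L \<Longrightarrow> R \<in> L \<Longrightarrow> Q \<in> L \<Longrightarrow> below P R \<Longrightarrow> below R Q \<Longrightarrow> G P R \<Longrightarrow> G R Q \<Longrightarrow> G P Q"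
    and split: "\<And>l u. l < u \<Longrightarrow> \<exists>R\<in>L. (\<forall>h. R h = h \<longrightarrow> l * (norm h)\<^sup>2 \<le> Re (cinner (m h) h)) \<and>
      (\<forall>h. R h = 0 \<longrightarrow> Re (cinner (m h) h) \<le> u * (norm h)\<^sup>2)"
    and nonneg: "\<And>h. 0 \<le> Re (cinner (m h) h)" and mb: "m \<in> bounded_ops"
    and \<epsilon>: "\<epsilon> > 0"
    and L: "P0 \<in> L" "Q0 \<in> L" "below P0 Q0"
    and small: "\<And>P Q \<gamma>. P \<in> L \<Longrightarrow> Q \<in> L \<Longrightarrow> below P0 P \<Longrightarrow> below P Q \<Longrightarrow> below Q Q0 \<Longrightarrow>
      form_in m P Q \<gamma> (\<gamma> + 2 * \<epsilon>) \<Longrightarrow> G P Q"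
  shows "G P0 Q0"
proof -
  have main: "G P Q" if "P \<in> L" "Q \<in> L" "below P0 P" "below P Q" "below Q Q0"
    "form_in m P Q \<alpha> (\<alpha> + real k * \<epsilon>)" for k \<alpha> P Q
    using that
  proof (induction k arbitrary: \<alpha> P Q)
    case 0
    note PQ = 0
    have "form_in m P Q \<alpha> (\<alpha> + 2 * \<epsilon>)" unfolding form_in_def
    proof (intro allI impI)
      fix h assume h: "between P Q h"
      have "\<alpha> * (norm h)\<^sup>2 \<le> (\<alpha> + 2 * \<epsilon>) * (norm h)\<^sup>2" using \<epsilon> by (intro mult_right_mono) auto
      then show "\<alpha> * (norm h)\<^sup>2 \<le> Re (cinner (m h) h) \<and> Re (cinner (m h) h) \<le> (\<alpha> + 2 * \<epsilon>) * (norm h)\<^sup>2"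
        using PQ(6) h unfolding form_in_def by fastforce
    qed
    then show ?case by (rule small[OF PQ(1-5)])
  next
    case (Suc k)
    note PQ = Suc.prems
    obtain R where R: "R \<in> L" "\<And>h. R h = h \<Longrightarrow> (\<alpha> + \<epsilon>) * (norm h)\<^sup>2 \<le> Re (cinner (m h) h)"
      "\<And>h. R h = 0 \<Longrightarrow> Re (cinner (m h) h) \<le> (\<alpha> + 2 * \<epsilon>) * (norm h)\<^sup>2"
      using split[of "\<alpha> + \<epsilon>" "\<alpha> + 2 * \<epsilon>"] \<epsilon> by auto
    have eq: "\<alpha> + real (Suc k) * \<epsilon> = (\<alpha> + \<epsilon>) + real k * \<epsilon>" by (simp add: algebra_simps)
    have lower: "G P' Q'" if P'Q': "P' \<in> L" "Q' \<in> L" "below P P'" "below P' Q'" "below Q' Q" "below Q' R" for P' Q'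
    proof (rule Suc.IH[OF P'Q'(1,2) _ P'Q'(4)])
      show "below P0 P'" by (rule below_trans[OF L(1) PQ(1) P'Q'(1) PQ(3) P'Q'(3)])
      show "below Q' Q0" by (rule below_trans[OF P'Q'(2) PQ(2) L(2) P'Q'(5) PQ(5)])
      show "form_in m P' Q' (\<alpha> + \<epsilon>) (\<alpha> + \<epsilon> + real k * \<epsilon>)"
        unfolding form_in_def
      proof (intro allI impI conjI)
        fix h assume h: "between P' Q' h"
        have "R h = h" using P'Q'(6) h by (metis below_def between_def)
        then show "(\<alpha> + \<epsilon>) * (norm h)\<^sup>2 \<le> Re (cinner (m h) h)" by (rule R(2))
        show "Re (cinner (m h) h) \<le> (\<alpha> + \<epsilon> + real k * \<epsilon>) * (norm h)\<^sup>2"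
          using PQ(6) between_mono[OF PQ(1) P'Q'(1) PQ(2) P'Q'(2,3,5) h] unfolding form_in_def eq by blast
      qed
    qed
    have upper: "G P' Q'" if P'Q': "P' \<in> L" "Q' \<in> L" "below P P'" "below P' Q'" "below Q' Q" "below R P'" for P' Q'
    proof (rule small[OF P'Q'(1,2) _ P'Q'(4)])
      show "below P0 P'" by (rule below_trans[OF L(1) PQ(1) P'Q'(1) PQ(3) P'Q'(3)])
      show "below Q' Q0" by (rule below_trans[OF P'Q'(2) PQ(2) L(2) P'Q'(5) PQ(5)])
      show "form_in m P' Q' \<alpha> (\<alpha> + 2 * \<epsilon>)"
        unfolding form_in_def
      proof (intro allI impI conjI)
        fix h assume h: "between P' Q' h"
        have "R h = R (P' h)" by (rule below_swap[OF R(1) P'Q'(1,6), symmetric])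
        then have "R h = 0" using h by (simp add: between_def bounded_ops_linear(4)[OF L_D(1)[OF R(1)]])
        then show "Re (cinner (m h) h) \<le> (\<alpha> + 2 * \<epsilon>) * (norm h)\<^sup>2" by (rule R(3))
        show "\<alpha> * (norm h)\<^sup>2 \<le> Re (cinner (m h) h)"
          using PQ(6) between_mono[OF PQ(1) P'Q'(1) PQ(2) P'Q'(2,3,5) h] unfolding form_in_def by blast
      qed
    qed
    have refl: "below T T" if "T \<in> L" for T unfolding below_def using L_D(2)[OF that] by blast
    consider "below R P" | "below Q R" | "below P R" "below R Q"
      using L_total[OF R(1) PQ(1)] L_total[OF R(1) PQ(2)] by blast
    then show ?case
    proof cases
      case 1
      show ?thesis by (rule upper[OF PQ(1,2) refl[OF PQ(1)] PQ(4) refl[OF PQ(2)] 1])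
    next
      case 2
      show ?thesis by (rule lower[OF PQ(1,2) refl[OF PQ(1)] PQ(4) refl[OF PQ(2)] 2])
    next
      case 3
      show ?thesis
        by (rule add[OF PQ(1) R(1) PQ(2) 3 lower[OF PQ(1) R(1) refl[OF PQ(1)] 3 refl[OF R(1)]]
            upper[OF R(1) PQ(2) 3 refl[OF PQ(2)] refl[OF R(1)]]])
    qed
  qed
  obtain K where K: "K > 0" "\<And>x. norm (m x) \<le> K * norm x" by (rule bounded_ops_bound[OF mb]) blast
  obtain k :: nat where k: "K / \<epsilon> \<le> real k" using real_arch_simple by blast
  have "form_in m P0 Q0 0 (0 + real k * \<epsilon>)" unfolding form_in_def
  proof (intro allI impI conjI)
    fix h
    have "Re (cinner (m h) h) \<le> norm (m h) * norm h" by (rule Re_cinner_le)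
    also have "\<dots> \<le> K * norm h * norm h" by (intro mult_right_mono K) simp
    also have "\<dots> \<le> (0 + real k * \<epsilon>) * (norm h)\<^sup>2"
      unfolding power2_eq_square mult.assoc[symmetric] using k \<epsilon>
      by (intro mult_right_mono) (auto simp: field_simps)
    finally show "Re (cinner (m h) h) \<le> (0 + real k * \<epsilon>) * (norm h)\<^sup>2" .
  qed (use nonneg in simp)
  then show ?thesis
    by (rule main[OF L(1,2) _ L(3), rotated 2]) (auto simp: below_def L_D(2)[OF L(1)] L_D(2)[OF L(2)])
qed

end

context invariant_tuple_space
begin

text \<open>One compression after another, as small variation passes to smaller intervals.\<close>

lemma refine_along_compressions:
  fixes G :: "('h \<Rightarrow> 'h) \<Rightarrow> ('h \<Rightarrow> 'h) \<Rightarrow> bool"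
  assumes add: "\<And>P R Q. P \<in> L \<Longrightarrow> R \<in> L \<Longrightarrow> Q \<in> L \<Longrightarrow> below P R \<Longrightarrow> below R Q \<Longrightarrow> G P R \<Longrightarrow> G R Q \<Longrightarrow> G P Q"
    and \<epsilon>: "\<epsilon> > 0"
    and small: "\<And>P Q. P \<in> L \<Longrightarrow> Q \<in> L \<Longrightarrow> below P Q \<Longrightarrow>
      (\<And>\<xi>. \<xi> \<in> set xs \<Longrightarrow> \<exists>\<gamma>. form_in (compression \<xi>) P Q \<gamma> (\<gamma> + 2 * \<epsilon>)) \<Longrightarrow> G P Q"
    and L: "P0 \<in> L" "Q0 \<in> L" "below P0 Q0"
  shows "G P0 Q0"
  using small L
proof (induction xs arbitrary: P0 Q0)
  case Nil
  then show ?case by simp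
next
  case (Cons \<xi> xs)
  note small = Cons.prems(1)
  show ?case
  proof (rule Cons.IH[OF _ Cons.prems(2-4)])
    fix P Q assume PQ: "P \<in> L" "Q \<in> L" "below P Q"
      and xs: "\<And>\<xi>. \<xi> \<in> set xs \<Longrightarrow> \<exists>\<gamma>. form_in (compression \<xi>) P Q \<gamma> (\<gamma> + 2 * \<epsilon>)"
    show "G P Q"
    proof (rule refine_along_operator[OF add _ _ compression_bounded \<epsilon> PQ])
      show "\<exists>R\<in>L. (\<forall>h. R h = h \<longrightarrow> l * (norm h)\<^sup>2 \<le> Re (cinner (compression \<xi> h) h)) \<and>
          (\<forall>h. R h = 0 \<longrightarrow> Re (cinner (compression \<xi> h) h) \<le> u * (norm h)\<^sup>2)" if "l < u" for l u
        by (rule compression_split[OF that, of \<xi>]) blast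
      show "0 \<le> Re (cinner (compression \<xi> h) h)" for h by (simp add: compression_form)
      fix P' Q' \<gamma>
      assume P'Q': "P' \<in> L" "Q' \<in> L" "below P P'" "below P' Q'" "below Q' Q"
        and f: "form_in (compression \<xi>) P' Q' \<gamma> (\<gamma> + 2 * \<epsilon>)"
      show "G P' Q'"
      proof (rule small[OF P'Q'(1,2,4)])
        fix \<zeta> assume "\<zeta> \<in> set (\<xi> # xs)"
        then consider "\<zeta> = \<xi>" | "\<zeta> \<in> set xs" by auto
        then show "\<exists>\<gamma>. form_in (compression \<zeta>) P' Q' \<gamma> (\<gamma> + 2 * \<epsilon>)"
        proof cases
          case 2
          then obtain \<gamma> where "form_in (compression \<zeta>) P Q \<gamma> (\<gamma> + 2 * \<epsilon>)" using xs by blast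
          then have "form_in (compression \<zeta>) P' Q' \<gamma> (\<gamma> + 2 * \<epsilon>)"
            using between_mono[OF PQ(1) P'Q'(1) PQ(2) P'Q'(2,3,5)] unfolding form_in_def by blast
          then show ?thesis by blast
        qed (use f in blast)
      qed
    qed
  qed
qed

text \<open>Subtracting the constant \<open>\<gamma>\<close> does not change the commutator and makes the compression small on the interval.\<close>

lemma commutator_small:
  assumes T: "T \<in> bounded_ops" and bound: "\<And>h. norm (T h) \<le> k * norm h" and k: "k \<ge> 0" and \<epsilon>: "\<epsilon> > 0"
    and PQ: "P \<in> L" "Q \<in> L"
    and f: "form_in (compression \<xi>) P Q \<gamma> (\<gamma> + 2 * \<epsilon>)"
    and u: "between P Q u" and v: "between P Q v"
  shows "cmod (cinner (T (compression \<xi> u)) v - cinner (compression \<xi> (T u)) v) \<le> 4 * \<epsilon> * k * norm u * norm v"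
proof -
  define m where "m h = compression \<xi> h - of_real \<gamma> *\<^sub>C h" for h
  have mb: "m \<in> bounded_ops" unfolding m_def
    by (rule bounded_ops_diff[OF compression_bounded bounded_ops_scaleC[OF bounded_ops_ident]])
  have sa: "cinner (m x) y = cinner x (m y)" for x y
    by (simp add: m_def cinner_expand compression_selfadjoint)
  have m_between: "between P Q (m h)" if "between P Q h" for h
    using that by (simp add: between_def m_def bounded_ops_linear[OF L_D(1)[OF PQ(1)]]
        bounded_ops_linear[OF L_D(1)[OF PQ(2)]] compression_commutes_M[OF L_subset_M[OF PQ(1)]]
        compression_commutes_M[OF L_subset_M[OF PQ(2)]] bounded_ops_linear(4)[OF compression_bounded])
  \<comment> \<open>both bounds on the variation are used: a form with values in \<open>[0, 2 * \<epsilon>]\<close> has norm at most \<open>2 * \<epsilon>\<close>\<close>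
  have form: "0 \<le> Re (cinner (m h) h) \<and> Re (cinner (m h) h) \<le> 2 * \<epsilon> * (norm h)\<^sup>2" if "between P Q h" for h
    using f that unfolding form_in_def by (auto simp: m_def cinner_expand cinner_self algebra_simps)
  have m_small: "norm (m h) \<le> 2 * \<epsilon> * norm h" if h: "between P Q h" for h
  proof (rule norm_le_of_form_bounds[OF mb sa])
    have "between P Q (h + t *\<^sub>R m h)" for t
      using h m_between[OF h] by (simp add: between_def bounded_ops_linear[OF L_D(1)[OF PQ(1)]]
        bounded_ops_linear[OF L_D(1)[OF PQ(2)]])
    then show "0 \<le> Re (cinner (m (h + t *\<^sub>R m h)) (h + t *\<^sub>R m h))" for t using form by blast
    show "Re (cinner (m (m h)) (m h)) \<le> 2 * \<epsilon> * (norm (m h))\<^sup>2" "Re (cinner (m h) h) \<le> 2 * \<epsilon> * (norm h)\<^sup>2"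
      using form h m_between[OF h] by blast+
  qed (use \<epsilon> in simp)
  have eq: "cinner (T (compression \<xi> u)) v - cinner (compression \<xi> (T u)) v = cinner (T (m u)) v - cinner (T u) (m v)"
    unfolding sa[symmetric] by (simp add: m_def bounded_ops_linear[OF T] cinner_expand)
  have "cmod (cinner (T (m u)) v) \<le> norm (T (m u)) * norm v" by (rule cinner_Cauchy_Schwarz)
  also have "norm (T (m u)) \<le> 2 * \<epsilon> * (k * norm u)"
    using order_trans[OF bound mult_left_mono[OF m_small[OF u] k]] by (simp add: algebra_simps)
  finally have 1: "cmod (cinner (T (m u)) v) \<le> 2 * \<epsilon> * (k * norm u) * norm v" by (simp add: mult_right_mono)
  have "cmod (cinner (T u) (m v)) \<le> norm (T u) * norm (m v)" by (rule cinner_Cauchy_Schwarz)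
  also have "\<dots> \<le> (k * norm u) * (2 * \<epsilon> * norm v)"
    by (intro mult_mono bound m_small v mult_nonneg_nonneg k) simp_all
  finally have 2: "cmod (cinner (T u) (m v)) \<le> 2 * \<epsilon> * (k * norm u) * norm v" by (simp add: algebra_simps)
  show ?thesis unfolding eq
    using norm_triangle_ineq4[of "cinner (T (m u)) v" "cinner (T u) (m v)"] 1 2 by simp
qed

end

section \<open>Density in the nest algebra\<close>

context masa_algebra
begin

text \<open>The function \<open>\<phi> P Q\<close> is the functional at the diagonal block of \<open>T\<close> for the interval \<open>Q - P\<close>, and \<open>N P Q\<close> is the mass that
  \<open>x\<close> and \<open>y\<close> carry there.  Both are additive over adjacent intervals, so a bound of \<open>\<phi>\<close> by \<open>\<eta> * N\<close> on short
  intervals extends to the whole nest.  As \<open>x\<close> lies in the invariant subspace and \<open>y\<close> is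
  orthogonal to it, \<open>\<phi>\<close> is a sum of commutators of \<open>T\<close> with the entries of the projection, which are small
  on short intervals by \<open>commutator_small\<close> and polarization.\<close>

lemma nest_algebra_subset_closure: "nest_algebra L \<subseteq> B"
proof
  fix T assume T: "T \<in> nest_algebra L"
  have Tb: "T \<in> bounded_ops" using T by (simp add: nest_algebra_def)
  have T_inv: "P (T h) = T h" if P: "P \<in> L" and h: "P h = h" for P h
  proof -
    have "T ` range P \<subseteq> range P" using T P by (simp add: nest_algebra_def leaves_invariant_def)
    moreover have "h \<in> range P" using L_D(4)[OF P] h by blast
    ultimately have "T h \<in> range P" by blast
    then show ?thesis using L_D(4)[OF P] by blast
  qed
  have "tuple_inner n (\<lambda>i. T (x i)) y = 0" if ann: "\<forall>S\<in>D. tuple_inner n (\<lambda>i. S (x i)) y = 0" for n x y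
  proof -
    define Y where "Y = {y. \<forall>S\<in>D. tuple_inner n (\<lambda>i. S (x i)) y = 0}"
    obtain q where q: "projection_matrix n Y q" using projection_matrix_exists by blast
    have K_inv: "(\<lambda>i. S (v i)) \<in> tuple_perp n Y" if S: "S \<in> B" and v: "v \<in> tuple_perp n Y" for S v
    proof -
      have adj: "tuple_inner n (\<lambda>i. S (w i)) z = tuple_inner n w (\<lambda>i. cadjoint S (z i))" for w z
        by (simp add: tuple_inner_def cinner_cadjoint[OF annihilator_closure_bounded[OF S]])
      have "(\<lambda>i. cadjoint S (z i)) \<in> Y" if z: "z \<in> Y" for z
        unfolding Y_def
      proof (intro CollectI ballI)
        fix R assume R: "R \<in> D"
        have "tuple_inner n (\<lambda>i. S (R (x i))) z = 0"
          using annihilator_closureD[OF annihilator_closure_compose[OF D S D_sub_B[OF R]], of n x z] z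
          by (simp add: Y_def)
        then show "tuple_inner n (\<lambda>i. R (x i)) (\<lambda>i. cadjoint S (z i)) = 0" by (simp add: adj)
      qed
      then show ?thesis using v by (simp add: tuple_perp_def adj)
    qed
    interpret projection_matrix n Y q by (rule q)
    interpret invariant_tuple_space D M n Y q by unfold_locales (rule K_inv)
    have xK: "x \<in> tuple_perp n Y"
      using annihilator_closureD[OF ident_B, of n x] by (auto simp: tuple_perp_def Y_def)
    have yY: "y \<in> Y" using ann by (simp add: Y_def)
    define d where "d P Q h = Q h - P h" for P Q :: "'h \<Rightarrow> 'h" and h
    define \<phi> where "\<phi> P Q = tuple_inner n (\<lambda>i. T (d P Q (x i))) (\<lambda>i. d P Q (y i))" for P Q
    define N where "N P Q = tuple_norm2 n (\<lambda>i. d P Q (x i)) + tuple_norm2 n (\<lambda>i. d P Q (y i))" for P Q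
    have d_between: "between P Q (d P Q h)" if "P \<in> L" "Q \<in> L" "below P Q" for P Q h
      using that below_swap[OF that] by (simp add: between_def d_def below_def
          bounded_ops_linear[OF L_D(1)[OF that(1)]] bounded_ops_linear[OF L_D(1)[OF that(2)]] L_D(2))
    have d_sa: "cinner (d P Q g) h = cinner g (d P Q h)" if "P \<in> L" "Q \<in> L" for P Q g h
      using that by (simp add: d_def cinner_diff_left cinner_diff_right L_D(3))
    have d_add: "d P Q h = d P R h + d R Q h" for P Q R h by (simp add: d_def)
    have \<phi>_add: "\<phi> P Q = \<phi> P R + \<phi> R Q"
      if L: "P \<in> L" "R \<in> L" "Q \<in> L" "below P R" "below R Q" for P R Q
    proof -
      have "cinner (T (d P R g)) (d R Q h) = 0" for g h
      proof -
        have "R (T (d P R g)) = T (d P R g)"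
          using T_inv[OF L(2)] d_between[OF L(1,2,4), of g] by (simp add: between_def)
        then have "cinner (T (d P R g)) (d R Q h) = cinner (T (d P R g)) (R (d R Q h))"
          using L_D(3)[OF L(2), of "T (d P R g)" "d R Q h"] by simp
        then show ?thesis using d_between[OF L(2,3,5), of h] by (simp add: between_def)
      qed
      then have 1: "tuple_inner n (\<lambda>i. T (d P R (x i))) (\<lambda>i. d R Q (y i)) = 0"
        by (simp add: tuple_inner_def)
      have "(\<lambda>h. d P R (T (d R Q h))) \<in> B"
        unfolding d_def by (rule off_diagonal[OF L(1,2,3,4,5) Tb])
      from annihilator_closureD[OF this, of n x y] ann
      have 2: "tuple_inner n (\<lambda>i. T (d R Q (x i))) (\<lambda>i. d P R (y i)) = 0"
        by (simp add: tuple_inner_def d_sa[OF L(1,2)])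
      have "\<phi> P Q = tuple_inner n (\<lambda>i. T (d P R (x i)) + T (d R Q (x i))) (\<lambda>i. d P R (y i) + d R Q (y i))"
        by (simp add: \<phi>_def d_add[of P Q _ R] bounded_ops_linear(1)[OF Tb])
      also have "\<dots> = \<phi> P R + \<phi> R Q
          + tuple_inner n (\<lambda>i. T (d P R (x i))) (\<lambda>i. d R Q (y i)) + tuple_inner n (\<lambda>i. T (d R Q (x i))) (\<lambda>i. d P R (y i))"
        by (simp add: \<phi>_def tuple_inner_def cinner_add_left cinner_add_right sum.distrib)
      finally show ?thesis by (simp only: 1 2) simp
    qed
    have N_add: "N P Q = N P R + N R Q"
      if L: "P \<in> L" "R \<in> L" "Q \<in> L" "below P R" "below R Q" for P R Q
    proof -
      have "(norm (d P Q h))\<^sup>2 = (norm (d P R h))\<^sup>2 + (norm (d R Q h))\<^sup>2" for h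
      proof -
        have "cinner (d P R h) (d R Q h) = cinner (d P R h) (R (d R Q h))"
          using L_D(3)[OF L(2), of "d P R h" "d R Q h"] d_between[OF L(1,2,4), of h] by (simp add: between_def)
        then have "cinner (d P R h) (d R Q h) = 0"
          using d_between[OF L(2,3,5), of h] by (simp add: between_def)
        then show ?thesis unfolding d_add[of P Q h R] norm_add_sq by simp
      qed
      then show ?thesis by (simp add: N_def tuple_norm2_def sum.distrib)
    qed
    obtain k where k: "k > 0" "\<And>h. norm (T h) \<le> k * norm h" by (rule bounded_ops_bound[OF Tb]) blast
    have small: "cmod (\<phi> (\<lambda>h. 0) (\<lambda>h. h)) \<le> \<eta> * N (\<lambda>h. 0) (\<lambda>h. h)" if \<eta>: "\<eta> > 0" for \<eta>
    proof -
      \<comment> \<open>\<open>2 * \<epsilon> * k * n\<close> is the constant in the estimate below; adding 1 covers \<open>n = 0\<close>\<close>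
      define \<epsilon> where "\<epsilon> = \<eta> / (2 * k * real n + 1)"
      have pos: "2 * k * real n + 1 > 0" using k(1) by (simp add: add_nonneg_pos)
      have \<epsilon>: "\<epsilon> > 0" using \<eta> pos by (simp add: \<epsilon>_def)
      have \<epsilon>\<eta>: "2 * \<epsilon> * k * real n \<le> \<eta>"
      proof -
        have "2 * k * real n * \<epsilon> \<le> (2 * k * real n + 1) * \<epsilon>" using \<epsilon> by (intro mult_right_mono) auto
        also have "\<dots> = \<eta>" using pos by (simp add: \<epsilon>_def)
        finally show ?thesis by (simp add: ac_simps)
      qed
      let ?xs = "[polarizing_tuple a b l. a \<leftarrow> [0..<n], b \<leftarrow> [0..<n], l \<leftarrow> [0..<4]]"
      show ?thesis
      proof (rule refine_along_compressions[where G = "\<lambda>P Q. cmod (\<phi> P Q) \<le> \<eta> * N P Q" and xs = ?xs, OF _ \<epsilon> _ zero_L ident_L])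
        show "cmod (\<phi> P Q) \<le> \<eta> * N P Q"
          if "P \<in> L" "R \<in> L" "Q \<in> L" "below P R" "below R Q"
            "cmod (\<phi> P R) \<le> \<eta> * N P R" "cmod (\<phi> R Q) \<le> \<eta> * N R Q" for P R Q
          using norm_triangle_ineq[of "\<phi> P R" "\<phi> R Q"] that(6,7)
          by (simp add: \<phi>_add[OF that(1-5)] N_add[OF that(1-5)] distrib_left)
        show "below (\<lambda>h. 0) (\<lambda>h. h)" by (simp add: below_def)
        fix P Q assume PQ: "P \<in> L" "Q \<in> L" "below P Q"
          and xs: "\<And>\<xi>. \<xi> \<in> set ?xs \<Longrightarrow> \<exists>\<gamma>. form_in (compression \<xi>) P Q \<gamma> (\<gamma> + 2 * \<epsilon>)"
        let ?c = "\<lambda>a b u v. cinner (T (q a b u)) v - cinner (q a b (T u)) v"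
        have comm: "cmod (?c a b u v) \<le> 4 * \<epsilon> * k * norm u * norm v"
          if ab: "a < n" "b < n" and uv: "between P Q u" "between P Q v" for a b u v
        proof -
          let ?t = "\<lambda>l. compression (polarizing_tuple a b l)"
          have t: "cmod (cinner (T (?t l u)) v - cinner (?t l (T u)) v) \<le> 4 * \<epsilon> * k * norm u * norm v" if "l < 4" for l
          proof -
            have "set ?xs = (\<Union>a<n. \<Union>b<n. polarizing_tuple a b ` {..<4})"
              by (simp add: atLeast0LessThan)
            then have "polarizing_tuple a b l \<in> set ?xs" using ab that by blast
            then obtain \<gamma> where "form_in (?t l) P Q \<gamma> (\<gamma> + 2 * \<epsilon>)" using xs by blast
            then show ?thesis by (rule commutator_small[OF Tb k(2) less_imp_le[OF k(1)] \<epsilon> PQ(1,2) _ uv])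
          qed
          have "4 * cinner (T (q a b u)) v = cinner (T (4 *\<^sub>C q a b u)) v"
            by (simp add: bounded_ops_linear(3)[OF Tb] cinner_scaleC_left)
          also have "\<dots> = (\<Sum>l<4. cnj (\<i> ^ l) * cinner (T (?t l u)) v)"
            unfolding polarization[OF ab] by (simp only: bounded_ops_linear(3,7)[OF Tb] cinner_sum_left cinner_scaleC_left)
          finally have e1: "4 * cinner (T (q a b u)) v = (\<Sum>l<4. cnj (\<i> ^ l) * cinner (T (?t l u)) v)" .
          have "4 * cinner (q a b (T u)) v = cinner (4 *\<^sub>C q a b (T u)) v" by (simp add: cinner_scaleC_left)
          also have "\<dots> = (\<Sum>l<4. cnj (\<i> ^ l) * cinner (?t l (T u)) v)"
            unfolding polarization[OF ab] by (simp only: cinner_sum_left cinner_scaleC_left)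
          finally have e2: "4 * cinner (q a b (T u)) v = (\<Sum>l<4. cnj (\<i> ^ l) * cinner (?t l (T u)) v)" .
          have "4 * cmod (?c a b u v) = cmod (4 * ?c a b u v)"
            by (simp only: norm_mult) simp
          also have "4 * ?c a b u v = (\<Sum>l<4. cnj (\<i> ^ l) * (cinner (T (?t l u)) v - cinner (?t l (T u)) v))"
            unfolding right_diff_distrib e1 e2 sum_subtractf ..
          also have "cmod \<dots> \<le> (\<Sum>l<4. cmod (cnj (\<i> ^ l) * (cinner (T (?t l u)) v - cinner (?t l (T u)) v)))"
            by (rule norm_sum)
          also have "\<dots> \<le> (\<Sum>l<4::nat. 4 * \<epsilon> * k * norm u * norm v)"
            by (intro sum_mono) (use t in \<open>simp add: norm_mult norm_power\<close>)
          finally show ?thesis by simp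
        qed
        have q_d: "q a b (d P Q h) = d P Q (q a b h)" if "a < n" "b < n" for a b h
          using that by (simp add: d_def bounded_ops_linear(2)[OF q_bounded]
              q_commutes_M[OF L_subset_M[OF PQ(1)]] q_commutes_M[OF L_subset_M[OF PQ(2)]])
        have d_b: "d P Q \<in> bounded_ops" unfolding d_def[abs_def]
          by (rule bounded_ops_diff[OF L_D(1)[OF PQ(2)] L_D(1)[OF PQ(1)]])
        have "T (d P Q (x a)) = (\<Sum>b<n. T (q a b (d P Q (x b))))" if "a < n" for a
        proof -
          have "d P Q (x a) = d P Q (proj x a)" by (simp add: proj_fix[OF xK that])
          also have "\<dots> = (\<Sum>b<n. q a b (d P Q (x b)))"
            using that by (simp add: proj_def bounded_ops_linear(7)[OF d_b] q_d)
          finally show ?thesis by (simp add: bounded_ops_linear(7)[OF Tb])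
        qed
        then have \<phi>1: "\<phi> P Q = (\<Sum>a<n. \<Sum>b<n. cinner (T (q a b (d P Q (x b)))) (d P Q (y a)))"
          by (simp add: \<phi>_def tuple_inner_def cinner_sum_left)
        have dB: "d P Q \<in> B" unfolding d_def[abs_def]
          by (rule annihilator_closure_diff[OF M_B[OF L_subset_M[OF PQ(2)]] M_B[OF L_subset_M[OF PQ(1)]]])
        \<comment> \<open>the projected tuple stays in the invariant subspace under \<open>d P Q\<close>, so it is orthogonal to \<open>y\<close>\<close>
        have "0 = tuple_inner n (\<lambda>i. d P Q (proj (\<lambda>i. T (d P Q (x i))) i)) y"
          using K_inv[OF dB proj_in] yY by (simp add: tuple_perp_def)
        also have "\<dots> = (\<Sum>a<n. \<Sum>b<n. cinner (q a b (T (d P Q (x b)))) (d P Q (y a)))"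
          by (simp add: tuple_inner_def d_sa[OF PQ(1,2)] proj_def cinner_sum_left)
        finally have "\<phi> P Q = (\<Sum>a<n. \<Sum>b<n. ?c a b (d P Q (x b)) (d P Q (y a)))"
          unfolding sum_subtractf \<phi>1 by simp
        then have "cmod (\<phi> P Q) \<le> (\<Sum>a<n. \<Sum>b<n. cmod (?c a b (d P Q (x b)) (d P Q (y a))))"
          by (auto intro!: order_trans[OF norm_sum] sum_mono)
        also have "\<dots> \<le> (\<Sum>a<n. \<Sum>b<n. 2 * \<epsilon> * k * ((norm (d P Q (x b)))\<^sup>2 + (norm (d P Q (y a)))\<^sup>2))"
        proof (intro sum_mono)
          fix a b assume ab: "a \<in> {..<n}" "b \<in> {..<n}"
          let ?u = "norm (d P Q (x b))" and ?v = "norm (d P Q (y a))"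
          have "cmod (?c a b (d P Q (x b)) (d P Q (y a))) \<le> 4 * \<epsilon> * k * ?u * ?v"
            using ab by (intro comm d_between PQ) auto
          also have "\<dots> = 2 * \<epsilon> * k * (2 * ?u * ?v)" by simp
          also have "\<dots> \<le> 2 * \<epsilon> * k * (?u\<^sup>2 + ?v\<^sup>2)"
            using sum_squares_bound[of ?u ?v] \<epsilon> k(1) by (intro mult_left_mono) auto
          finally show "cmod (?c a b (d P Q (x b)) (d P Q (y a))) \<le> 2 * \<epsilon> * k * (?u\<^sup>2 + ?v\<^sup>2)" .
        qed
        also have "\<dots> = 2 * \<epsilon> * k * real n * N P Q"
          by (simp add: N_def tuple_norm2_def sum.distrib sum_distrib_left[symmetric] algebra_simps)
        also have "\<dots> \<le> \<eta> * N P Q" by (rule mult_right_mono[OF \<epsilon>\<eta>]) (simp add: N_def)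
        finally show "cmod (\<phi> P Q) \<le> \<eta> * N P Q" .
      qed
    qed
    have "\<phi> (\<lambda>h. 0) (\<lambda>h. h) = 0"
    proof (rule ccontr)
      let ?a = "cmod (\<phi> (\<lambda>h. 0) (\<lambda>h. h))" and ?N = "N (\<lambda>h. 0) (\<lambda>h. h)"
      assume "\<phi> (\<lambda>h. 0) (\<lambda>h. h) \<noteq> 0"
      then have a: "?a > 0" by simp
      have N: "?N \<ge> 0" by (simp add: N_def)
      have "?a \<le> ?a / (2 * (?N + 1)) * ?N" by (rule small) (use a N in simp)
      also have "\<dots> \<le> ?a / (2 * (?N + 1)) * (?N + 1)" using a N by (intro mult_left_mono) auto
      also have "\<dots> = ?a / 2" using N by (simp add: field_simps)
      finally show False using a by simp
    qed
    then show ?thesis by (simp add: \<phi>_def d_def)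
  qed
  then show "T \<in> B" using Tb by (simp add: annihilator_closure_def)
qed

theorem weakly_dense_in_nest_algebra: "weakly_dense_in D (nest_algebra L)"
  unfolding weakly_dense_in_def wot_closure_eq_annihilator_closure[OF D]
  using nest_algebra_subset_closure D_bounded by (auto simp: nest_algebra_def Lat_def)

end

lemma operator_subalgebra_image:
  fixes \<pi> :: "'a::cstar_algebra \<Rightarrow> 'h::complex_hilbert \<Rightarrow> 'h"
  assumes A: "operator_subalgebra A" and j: "algebra_hom_on A j" and \<pi>: "star_representation \<pi>"
  shows "operator_subalgebra (\<pi> ` j ` A)"
proof -
  note rep = star_representationD[OF \<pi>]
  have zero: "(\<lambda>_. 0) \<in> A" and add: "\<And>S T. S \<in> A \<Longrightarrow> T \<in> A \<Longrightarrow> (\<lambda>x. S x + T x) \<in> A"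
    and comp: "\<And>S T. S \<in> A \<Longrightarrow> T \<in> A \<Longrightarrow> S \<circ> T \<in> A"
    and scale: "\<And>c T. T \<in> A \<Longrightarrow> (\<lambda>x. c *\<^sub>C T x) \<in> A"
    using A by (auto simp: operator_subalgebra_def)
  have j_add: "\<And>S T. S \<in> A \<Longrightarrow> T \<in> A \<Longrightarrow> j (\<lambda>x. S x + T x) = j S + j T"
    and j_comp: "\<And>S T. S \<in> A \<Longrightarrow> T \<in> A \<Longrightarrow> j (S \<circ> T) = j S * j T"
    and j_scale: "\<And>c T. T \<in> A \<Longrightarrow> j (\<lambda>x. c *\<^sub>C T x) = c *\<^sub>C j T"
    using j by (auto simp: algebra_hom_on_def)
  have im: "\<pi> (j S) \<in> \<pi> ` j ` A" if "S \<in> A" for S using that by blast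
  show ?thesis
    unfolding operator_subalgebra_def
  proof (intro conjI ballI allI)
    show "\<pi> ` j ` A \<subseteq> bounded_ops" using rep(1) by blast
    have "\<pi> (j (\<lambda>_. 0)) = (\<lambda>_. 0)"
      using j_scale[OF zero, of 0] rep(3)[of 0 "j (\<lambda>_. 0)"] by (auto simp: fun_eq_iff)
    then show "(\<lambda>_. 0) \<in> \<pi> ` j ` A" using im[OF zero] by simp
    fix S' assume "S' \<in> \<pi> ` j ` A"
    then obtain S where S: "S \<in> A" "S' = \<pi> (j S)" by blast
    show "(\<lambda>x. c *\<^sub>C S' x) \<in> \<pi> ` j ` A" for c
    proof -
      have "(\<lambda>x. c *\<^sub>C S' x) = \<pi> (j (\<lambda>x. c *\<^sub>C S x))" by (simp add: S fun_eq_iff j_scale rep(3))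
      then show ?thesis using im[OF scale[OF S(1)]] by simp
    qed
    fix T' assume "T' \<in> \<pi> ` j ` A"
    then obtain T where T: "T \<in> A" "T' = \<pi> (j T)" by blast
    have "(\<lambda>x. S' x + T' x) = \<pi> (j (\<lambda>x. S x + T x))" using S T by (simp add: fun_eq_iff j_add rep(2))
    then show "(\<lambda>x. S' x + T' x) \<in> \<pi> ` j ` A" using im[OF add[OF S(1) T(1)]] by simp
    have "S' \<circ> T' = \<pi> (j (S \<circ> T))" using S T by (simp add: fun_eq_iff j_comp rep(4))
    then show "S' \<circ> T' \<in> \<pi> ` j ` A" using im[OF comp[OF S(1) T(1)]] by simp
  qed
qed

theorem proposition1:
  fixes A :: "('k::complex_hilbert \<Rightarrow> 'k) set"
    and j :: "('k \<Rightarrow> 'k) \<Rightarrow> 'a::cstar_algebra"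
    and \<pi> :: "'a \<Rightarrow> 'h::complex_hilbert \<Rightarrow> 'h"
  assumes "unital_operator_algebra A"
    and "cstar_cover A j"
    and "dirichlet_in A j"
    and "irreducible_representation \<pi>"
    and "\<exists>M. masa M \<and> M \<subseteq> wot closure_of (\<pi> ` j ` A)"
  shows "nest (Lat (\<pi> ` j ` A)) \<and>
    (\<exists>N. nest N \<and> weakly_dense_in (\<pi> ` j ` A) (nest_algebra N))"
proof -
  let ?D = "\<pi> ` j ` A"
  have \<pi>: "star_representation \<pi>" using assms(4) by (simp add: irreducible_representation_def)
  note rep = star_representationD[OF \<pi>]
  have D: "operator_subalgebra ?D"
    by (rule operator_subalgebra_image[OF _ _ \<pi>])
      (use assms(1,2) in \<open>auto simp: unital_operator_algebra_def cstar_cover_def\<close>)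
  obtain M where M: "masa M" "M \<subseteq> annihilator_closure ?D"
    using assms(5) unfolding wot_closure_eq_annihilator_closure[OF D] by blast
  have ident: "(\<lambda>h. h) \<in> annihilator_closure ?D" using masa_contains_ident[OF M(1)] M(2) by blast
  \<comment> \<open>the masa contains the identity, so \<open>\<pi>\<close> is nondegenerate already on the algebra\<close>
  have "(\<lambda>h. h) \<in> annihilator_closure (range \<pi>)"
    unfolding annihilator_closure_def
  proof (intro CollectI conjI allI impI)
    fix n and x y :: "nat \<Rightarrow> 'h"
    assume "\<forall>S\<in>range \<pi>. tuple_inner n (\<lambda>i. S (x i)) y = 0"
    then show "tuple_inner n (\<lambda>i. x i) y = 0" using annihilator_closureD[OF ident, of n x y] by blast
  qed (rule bounded_ops_ident)
  then have full: "annihilator_closure (range \<pi>) = bounded_ops" by (rule irreducible_density[OF assms(4)])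
  interpret masa_algebra ?D M
  proof
    show "tuple_inner n (\<lambda>i. X (x i)) y = 0"
      if "\<And>S. S \<in> ?D \<Longrightarrow> tuple_inner n (\<lambda>i. S (x i)) y = 0"
        "\<And>S. S \<in> ?D \<Longrightarrow> tuple_inner n (\<lambda>i. cadjoint S (x i)) y = 0" "X \<in> bounded_ops" for n x y X
    proof -
      have "tuple_inner n (\<lambda>i. \<pi> a (x i)) y = 0" for a
        by (rule dirichlet_annihilator[OF \<pi> assms(3)]) (use that(1,2) in \<open>force simp: rep(5)[symmetric]\<close>)+
      then show ?thesis using annihilator_closureD[of X "range \<pi>" n x y] that(3) full by blast
    qed
  qed (rule D M)+
  show ?thesis using nest_L weakly_dense_in_nest_algebra by blast
qed

end
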